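(* Let $m_0:[0,\infty)\to\mathbb C$ be a smooth function such that, for some $\epsilon>0$, $$|m_0^{(k)}(t)|\lesssim t^{-k-\epsilon}\quad\text{as } t\to\infty,\qquad k=0,1,2,$$ where $m_0^{(k)}$ denotes the $k$-th derivative of $m_0$. Then the maximal operator $\mathcal T^*_m$ associated with $m(\xi,\eta)=m_0(|(\xi,\eta)|^2)$ is bounded from $L^2(\mathbb R^n)\times L^2(\mathbb R^n)$ to $L^1(\mathbb R^n)$.
   Context: Fourier transform: $\hat f(\xi)=\int_{\mathbb R^n}f(x)e^{-2\pi i x\cdot\xi}\,dx$; $n\ge1$; $|(\xi,\eta)|^2=|\xi|^2+|\eta|^2$ for $\xi,\eta\in\mathbb R^n$. For $m$ on $\mathbb R^{2n}$, $s>0$ and Schwartz functions $f,g$ on $\mathbb R^n$, $$\mathcal T_{m,s}(f,g)(x)=\int_{\mathbb R^n}\int_{\mathbb R^n}m(s\xi,s\eta)\hat f(\xi)\hat g(\eta)e^{2\pi i x\cdot(\xi+\eta)}\,d\xi\,d\eta,\qquad \mathcal T^*_m(f,g)(x)=\sup_{s>0}|\mathcal T_{m,s}(f,g)(x)|.$$ Boundedness means $\|\mathcal T^*_m(f,g)\|_1\le C\|f\|_2\|g\|_2$ for all Schwartz $f,g$, with $C$ independent of $f,g$. *)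

theory Defs
  imports "HOL-Analysis.Analysis" "HOL-Library.Landau_Symbols"
begin

section \<open>Smooth functions on the closed half-line\<close>

text \<open>Derivatives are taken within \<open>[0,\<infinity>)\<close>: one-sided at \<open>0\<close>, the usual ones at \<open>t > 0\<close>.
  Values on the negative axis are irrelevant.\<close>

primrec nth_deriv_halfline :: "nat \<Rightarrow> (real \<Rightarrow> complex) \<Rightarrow> real \<Rightarrow> complex" where
  "nth_deriv_halfline 0 h = h"
| "nth_deriv_halfline (Suc k) h =
     (\<lambda>t. vector_derivative (nth_deriv_halfline k h) (at t within {0..}))"

definition smooth_halfline :: "(real \<Rightarrow> complex) \<Rightarrow> bool" where
  "smooth_halfline h \<longleftrightarrow> (\<forall>k. nth_deriv_halfline k h differentiable_on {0..})"


section \<open>Schwartz functions\<close>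

definition partial_deriv :: "'n \<Rightarrow> (real ^ 'n \<Rightarrow> complex) \<Rightarrow> real ^ 'n \<Rightarrow> complex" where
  "partial_deriv i f = (\<lambda>x. frechet_derivative f (at x) (axis i 1))"

text \<open>Mixed partial derivatives of arbitrary order are indexed by lists of directions
  instead of multi-indices; for smooth functions the order in the list does not matter.\<close>

definition partial_derivs :: "'n list \<Rightarrow> (real ^ 'n \<Rightarrow> complex) \<Rightarrow> real ^ 'n \<Rightarrow> complex" where
  "partial_derivs is f = foldr partial_deriv is f"

definition schwartz :: "(real ^ 'n \<Rightarrow> complex) \<Rightarrow> bool" where
  "schwartz f \<longleftrightarrow>
     (\<forall>is x. partial_derivs is f differentiable (at x)) \<and>
     (\<forall>is (N::nat). \<exists>C. \<forall>x. norm x ^ N * norm (partial_derivs is f x) \<le> C)"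


section \<open>Bilinear maximal multiplier operators\<close>

definition fourier :: "(real ^ 'n \<Rightarrow> complex) \<Rightarrow> real ^ 'n \<Rightarrow> complex" where
  "fourier f \<xi> = (LINT x|lborel. f x * exp (- 2 * pi * \<i> * complex_of_real (x \<bullet> \<xi>)))"

definition bilinear_mult ::
  "((real ^ 'n) \<times> (real ^ 'n) \<Rightarrow> complex) \<Rightarrow> real \<Rightarrow>
   (real ^ 'n \<Rightarrow> complex) \<Rightarrow> (real ^ 'n \<Rightarrow> complex) \<Rightarrow> real ^ 'n \<Rightarrow> complex" where
  "bilinear_mult m s f g x =
     (LINT \<eta>|lborel. (LINT \<xi>|lborel.
        m (s *\<^sub>R \<xi>, s *\<^sub>R \<eta>) * fourier f \<xi> * fourier g \<eta>
          * exp (2 * pi * \<i> * complex_of_real (x \<bullet> (\<xi> + \<eta>)))))"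

text \<open>The supremum is taken in \<open>[0,\<infinity>]\<close>, so that no finiteness is presupposed.\<close>

definition maximal_bilinear_mult ::
  "((real ^ 'n) \<times> (real ^ 'n) \<Rightarrow> complex) \<Rightarrow>
   (real ^ 'n \<Rightarrow> complex) \<Rightarrow> (real ^ 'n \<Rightarrow> complex) \<Rightarrow> real ^ 'n \<Rightarrow> ennreal" where
  "maximal_bilinear_mult m f g x = (SUP s\<in>{0<..}. ennreal (norm (bilinear_mult m s f g x)))"

definition L2_norm_fun :: "(real ^ 'n \<Rightarrow> complex) \<Rightarrow> real" where
  "L2_norm_fun f = sqrt (LINT x|lborel. (norm (f x))\<^sup>2)"

text \<open>Boundedness from \<open>L\<^sup>2 \<times> L\<^sup>2\<close> to \<open>L\<^sup>1\<close>. Measurability of the maximal function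
  is part of having an \<open>L\<^sup>1\<close> norm; it is stated because the nonnegative integral of a
  nonmeasurable function would only be a lower integral.\<close>

definition maximal_bounded_L2_L2_L1 :: "((real ^ 'n) \<times> (real ^ 'n) \<Rightarrow> complex) \<Rightarrow> bool" where
  "maximal_bounded_L2_L2_L1 m \<longleftrightarrow>
     (\<exists>C\<ge>0. \<forall>f g. schwartz f \<longrightarrow> schwartz g \<longrightarrow>
        maximal_bilinear_mult m f g \<in> borel_measurable lborel \<and>
        (\<integral>\<^sup>+ x. maximal_bilinear_mult m f g x \<partial>lborel) \<le> ennreal (C * L2_norm_fun f * L2_norm_fun g))"

end

theory Submission
  imports Defs "HOL-Probability.Probability"
begin

text \<open>Write \<open>a = |\<xi>|\<^sup>2\<close>, \<open>b = |\<eta>|\<^sup>2\<close>. Two integrations by parts give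
  \<open>m\<^sub>0(c) = \<integral> max 0 (u - c) m\<^sub>0''(u) du\<close> over \<open>u \<ge> 0\<close>, and the decay hypotheses are what makes
  \<open>u m\<^sub>0''(u)\<close> integrable and the boundary terms vanish (\<open>halfline_taylor_representation\<close>).
  So \<open>m\<close> is a superposition of dilates of the bilinear Bochner-Riesz symbol of order one,
  with weights of finite total mass. That symbol separates the variables:
  \<open>max 0 (u - a - b)\<close> is the length of the interval \<open>{t. a \<le> t \<and> b \<le> u - t}\<close>. With the ball
  multiplier \<open>S\<^sub>t\<close> (symbol \<open>1\<close> if \<open>|\<xi>|\<^sup>2 \<le> t\<close>, and \<open>0\<close> otherwise) this gives
  \<open>T\<^sub>s(f, g) = \<integral> m\<^sub>0''(u) \<integral>\<^sub>0\<^sup>u S\<^bsub>t/s\<^sup>2\<^esub> f \<cdot> S\<^bsub>(u - t)/s\<^sup>2\<^esub> g dt du\<close>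
  (\<open>bilinear_superposition\<close>).\<close>

text \<open>The inequality \<open>2 |y z| \<le> r |y|\<^sup>2 + |z|\<^sup>2 / r\<close> reduces the theorem to a bound in \<open>L\<^sup>1\<close>, by
  \<open>\<parallel>f\<parallel>\<^sub>2\<^sup>2\<close>, for the supremum over \<open>u\<close> of the averages of \<open>|S\<^sub>t f|\<^sup>2\<close> over \<open>0 < t < u\<close>; optimizing \<open>r\<close>
  at the end turns the sum of squares into a product. Following Stein, compare \<open>S\<^sub>t\<close> with the
  heat multiplier \<open>P\<^sub>t\<close> of symbol \<open>exp (-|\<xi>|\<^sup>2 / t)\<close>: the average over \<open>0 < t < u\<close> is at most
  \<open>2 \<integral> |S\<^sub>t f - P\<^sub>t f|\<^sup>2 dt/t + 2 sup |P\<^sub>t f|\<^sup>2\<close>. The function \<open>control\<close> below is this majorant, with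
  the supremum replaced by a multiple of one over dyadic times of averages of \<open>|f|\<close>. It
  depends neither on \<open>u\<close> nor on the dilation \<open>s\<close>, because \<open>dt/t\<close> is dilation invariant. By the
  Plancherel inequality (\<open>plancherel_le\<close>) the square function costs the supremum over \<open>a\<close> of
  \<open>\<integral> |1\<^bsub>a \<le> t\<^esub> - exp (-a/t)|\<^sup>2 dt/t\<close>, which is at most \<open>1\<close>.\<close>

text \<open>The remaining ingredient is the maximal inequality for the heat semigroup on \<open>L\<^sup>2\<close>. It is
  obtained by a \<open>T T\<^sup>*\<close> argument: if \<open>T\<close> is a linearization of the supremum over
  finitely many dyadic times, the semigroup law together with the comparison of
  kernels at comparable times bounds \<open>T T\<^sup>*\<close> by a multiple of operators of the same type as \<open>T\<close> and
  \<open>T\<^sup>*\<close>. Hence the square of the norm is bounded by a multiple of the norm, and the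
  bound does not depend on the number of times (\<open>maximal_inequality\<close>).\<close>

section \<open>Characters and the Fourier transform of Gaussians\<close>

lemma
  fixes f :: "'a::euclidean_space \<Rightarrow> real \<Rightarrow> complex"
  assumes f: "\<And>b. b \<in> Basis \<Longrightarrow> integrable lborel (f b)"
  shows integrable_lborel_prod: "integrable lborel (\<lambda>x::'a. \<Prod>b\<in>Basis. f b (x \<bullet> b))"
    and integral_lborel_prod:
      "(LINT x|lborel. (\<Prod>b\<in>Basis. f b (x \<bullet> b))) = (\<Prod>b\<in>Basis. LINT x|lborel. f b x)"
proof -
  interpret product_sigma_finite "\<lambda>_::'a. lborel :: real measure" ..
  have [measurable]: "f b \<in> borel_measurable borel" if "b \<in> Basis" for b
    using borel_measurable_integrable[OF f[OF that]] by simp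
  have meas: "(\<lambda>x::'a. \<Prod>b\<in>Basis. f b (x \<bullet> b)) \<in> borel_measurable borel"
    by measurable
  have map: "(\<lambda>g. \<Sum>b\<in>Basis. g b *\<^sub>R b) \<in> (\<Pi>\<^sub>M b\<in>(Basis::'a set). lborel) \<rightarrow>\<^sub>M borel"
    by measurable
  have comp: "(\<Prod>b\<in>Basis. f b ((\<Sum>c\<in>Basis. g c *\<^sub>R c) \<bullet> b)) = (\<Prod>b\<in>(Basis::'a set). f b (g b))" for g
    by (intro prod.cong) auto
  show "integrable lborel (\<lambda>x::'a. \<Prod>b\<in>Basis. f b (x \<bullet> b))"
    unfolding lborel_eq[where 'a='a] integrable_distr_eq[OF map meas] comp
    by (rule product_integrable_prod) (auto intro: f)
  show "(LINT x|lborel. (\<Prod>b\<in>Basis. f b (x \<bullet> b))) = (\<Prod>b\<in>Basis. LINT x|lborel. f b x)"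
    unfolding lborel_eq[where 'a='a] integral_distr[OF map meas] comp
    by (rule product_integral_prod) (auto intro: f)
qed

definition wave :: "'a::euclidean_space \<Rightarrow> 'a \<Rightarrow> complex" where
  "wave x \<xi> = cis (2 * pi * (x \<bullet> \<xi>))"

lemma norm_wave [simp]: "norm (wave x \<xi>) = 1"
  by (simp add: wave_def)

lemma wave_zero_left [simp]: "wave 0 \<xi> = 1"
  by (simp add: wave_def)

lemma wave_add: "wave x (\<xi> + \<eta>) = wave x \<xi> * wave x \<eta>"
  by (simp add: wave_def cis_mult inner_add_right algebra_simps)

lemma wave_diff: "wave x (\<xi> - \<eta>) = wave x \<xi> * cnj (wave x \<eta>)"
  by (simp add: wave_def cis_cnj cis_mult inner_diff_right algebra_simps)

lemma wave_sym: "wave x \<xi> = wave \<xi> x"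
  by (simp add: wave_def inner_commute)

lemma wave_measurable [measurable]:
  "(\<lambda>x. wave (f x) (g x)) \<in> borel_measurable M"
  if "f \<in> borel_measurable M" "g \<in> borel_measurable M"
  using that unfolding wave_def cis_conv_exp by measurable

lemma continuous_wave: "continuous_on UNIV (\<lambda>x. wave x \<xi>)"
  unfolding wave_def by (intro continuous_intros)

text \<open>The inverse Fourier transform of \<open>exp (- \<tau> |\<xi>|\<^sup>2)\<close>, see \<open>integral_gaussian_wave\<close>; so \<open>\<tau>\<close> is
  proportional to time in the heat equation.\<close>

definition heat_kernel :: "real \<Rightarrow> 'a::euclidean_space \<Rightarrow> real" where
  "heat_kernel \<tau> x = sqrt (pi / \<tau>) ^ DIM('a) * exp (- (pi\<^sup>2 / \<tau>) * (norm x)\<^sup>2)"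

text \<open>This is the characteristic function of the standard normal distribution, after
  the substitution \<open>y = sqrt (2 \<tau>) \<xi>\<close>.\<close>

lemma gaussian_fourier_real:
  fixes x \<tau> :: real
  assumes "\<tau> > 0"
  shows "integrable lborel (\<lambda>\<xi>. complex_of_real (exp (- \<tau> * \<xi>\<^sup>2)) * cis (2 * pi * (x * \<xi>)))"
    and "(LINT \<xi>|lborel. complex_of_real (exp (- \<tau> * \<xi>\<^sup>2)) * cis (2 * pi * (x * \<xi>)))
           = complex_of_real (sqrt (pi / \<tau>) * exp (- (pi\<^sup>2 / \<tau>) * x\<^sup>2))"
proof -
  define c where "c = sqrt (2 * \<tau>)"
  have c: "c > 0" "c\<^sup>2 = 2 * \<tau>" using assms by (auto simp: c_def)
  define t where "t = 2 * pi * x / c"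
  let ?g = "\<lambda>y. std_normal_density y *\<^sub>R iexp (t * y)"
  have int: "integrable lborel ?g"
    by (rule Bochner_Integration.integrable_bound[OF integrable_normal_density[of 1 0]]) auto
  have val: "(LINT y|lborel. ?g y) = exp (- (t\<^sup>2) / 2)"
    using fun_cong[OF char_std_normal_distribution, of t] unfolding char_def
    by (subst (asm) integral_density) auto
  have aff: "?g (c * \<xi>) = (1 / sqrt (2 * pi)) *\<^sub>R
      (complex_of_real (exp (- \<tau> * \<xi>\<^sup>2)) * cis (2 * pi * (x * \<xi>)))" for \<xi>
  proof -
    have 1: "- (c * \<xi>)\<^sup>2 / 2 = - \<tau> * \<xi>\<^sup>2" by (simp add: power_mult_distrib c)
    have 2: "t * (c * \<xi>) = 2 * pi * (x * \<xi>)" using c by (simp add: t_def)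
    show ?thesis
      unfolding std_normal_density_def 1 2
      by (simp add: cis_conv_exp scaleR_conv_of_real)
  qed
  have i1: "integrable lborel (\<lambda>\<xi>. ?g (0 + c * \<xi>))"
    using c by (intro lborel_integrable_real_affine int) auto
  then have i2: "integrable lborel (\<lambda>\<xi>. (1 / sqrt (2 * pi)) *\<^sub>R
      (complex_of_real (exp (- \<tau> * \<xi>\<^sup>2)) * cis (2 * pi * (x * \<xi>))))"
    by (simp only: add_0 aff)
  then show "integrable lborel (\<lambda>\<xi>. complex_of_real (exp (- \<tau> * \<xi>\<^sup>2)) * cis (2 * pi * (x * \<xi>)))"
    using integrable_scaleR_right[of "sqrt (2 * pi)", OF i2] by simp
  have "exp (- (t\<^sup>2) / 2) = c *\<^sub>R (LINT \<xi>|lborel. ?g (0 + c * \<xi>))"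
    using lborel_integral_real_affine[of c ?g 0] c val by simp
  also have "\<dots> = c *\<^sub>R (1 / sqrt (2 * pi)) *\<^sub>R 
      (LINT \<xi>|lborel. complex_of_real (exp (- \<tau> * \<xi>\<^sup>2)) * cis (2 * pi * (x * \<xi>)))"
    by (simp only: add_0 aff integral_scaleR_right)
  finally have *: "(LINT \<xi>|lborel. complex_of_real (exp (- \<tau> * \<xi>\<^sup>2)) * cis (2 * pi * (x * \<xi>)))
     = (sqrt (2 * pi) / c) *\<^sub>R exp (- (t\<^sup>2) / 2)"
    using c by (simp add: field_simps scaleR_conv_of_real)
  have "sqrt (2 * pi) / c = sqrt (pi / \<tau>)"
    unfolding c_def by (simp add: real_sqrt_divide[symmetric] del: real_sqrt_mult)
  moreover have "- (t\<^sup>2) / 2 = - (pi\<^sup>2 / \<tau>) * x\<^sup>2"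
    unfolding t_def power_divide c(2) using assms by (simp add: power_mult_distrib field_simps)
  ultimately show "(LINT \<xi>|lborel. complex_of_real (exp (- \<tau> * \<xi>\<^sup>2)) * cis (2 * pi * (x * \<xi>)))
     = complex_of_real (sqrt (pi / \<tau>) * exp (- (pi\<^sup>2 / \<tau>) * x\<^sup>2))"
    unfolding * by (simp add: scaleR_conv_of_real exp_of_real)
qed

lemma norm_sq_Basis: "(norm (x::'a::euclidean_space))\<^sup>2 = (\<Sum>b\<in>Basis. (x \<bullet> b)\<^sup>2)"
  by (simp add: norm_eq_sqrt_inner euclidean_inner[of x x] power2_eq_square sum_nonneg)

lemma
  fixes x :: "'a::euclidean_space"
  assumes "\<tau> > 0"
  shows integrable_gaussian_wave:
      "integrable lborel (\<lambda>\<xi>. complex_of_real (exp (- \<tau> * (norm \<xi>)\<^sup>2)) * wave x \<xi>)"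
    and integral_gaussian_wave:
      "(LINT \<xi>|lborel. complex_of_real (exp (- \<tau> * (norm \<xi>)\<^sup>2)) * wave x \<xi>) = heat_kernel \<tau> x"
proof -
  have split: "complex_of_real (exp (- \<tau> * (norm \<xi>)\<^sup>2)) * wave x \<xi> =
      (\<Prod>b\<in>Basis. complex_of_real (exp (- \<tau> * (\<xi> \<bullet> b)\<^sup>2)) * cis (2 * pi * ((x \<bullet> b) * (\<xi> \<bullet> b))))" for \<xi>
    unfolding wave_def euclidean_inner[of x \<xi>] norm_sq_Basis
    by (simp add: sum_distrib_left prod.distrib exp_sum cis_conv_exp sum_negf[symmetric] flip: exp_of_real del: of_real_mult)
  note G = gaussian_fourier_real[OF assms]
  show "integrable lborel (\<lambda>\<xi>. complex_of_real (exp (- \<tau> * (norm \<xi>)\<^sup>2)) * wave x \<xi>)"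
    unfolding split by (rule integrable_lborel_prod) (rule G)
  have "(LINT \<xi>|lborel. complex_of_real (exp (- \<tau> * (norm \<xi>)\<^sup>2)) * wave x \<xi>)
    = (\<Prod>b\<in>Basis. complex_of_real (sqrt (pi / \<tau>) * exp (- (pi\<^sup>2 / \<tau>) * (x \<bullet> b)\<^sup>2)))"
    unfolding split by (subst integral_lborel_prod[OF G(1)]) (simp only: G(2))
  also have "\<dots> = heat_kernel \<tau> x"
    unfolding heat_kernel_def norm_sq_Basis of_real_prod[symmetric]
    by (simp only: prod.distrib prod_constant sum_distrib_left exp_sum finite_Basis)
  finally show "(LINT \<xi>|lborel. complex_of_real (exp (- \<tau> * (norm \<xi>)\<^sup>2)) * wave x \<xi>) = heat_kernel \<tau> x" .
qed

section \<open>The heat kernel\<close>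

lemma integrable_gaussian:
  assumes "\<tau> > 0"
  shows "integrable lborel (\<lambda>\<xi>::'a::euclidean_space. complex_of_real (exp (- \<tau> * (norm \<xi>)\<^sup>2)))"
  using integrable_gaussian_wave[OF assms, of "0::'a"] by (simp only: wave_zero_left mult_1_right)

lemma heat_kernel_nonneg: "heat_kernel \<tau> x \<ge> 0" if "\<tau> > 0"
  using that by (simp add: heat_kernel_def)

lemma heat_kernel_commute: "heat_kernel \<tau> (x - y) = heat_kernel \<tau> (y - x)"
  by (simp add: heat_kernel_def norm_minus_commute)

lemma heat_kernel_measurable [measurable]:
  "(\<lambda>x. heat_kernel (s x) (g x)) \<in> borel_measurable M"
  if "s \<in> borel_measurable M" "g \<in> borel_measurable M"
  using that unfolding heat_kernel_def by measurable

lemma nn_integral_lborel_reflect: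
  fixes h :: "'a::euclidean_space \<Rightarrow> ennreal"
  assumes [measurable]: "h \<in> borel_measurable borel"
  shows "(\<integral>\<^sup>+y. h (x - y) \<partial>lborel) = (\<integral>\<^sup>+y. h y \<partial>lborel)"
  by (subst (2) lborel_affine[of "-1" x])
    (simp_all add: density_1 nn_integral_distr)

lemma nn_integral_heat_kernel:
  assumes "\<tau> > 0"
  shows "(\<integral>\<^sup>+x. ennreal (heat_kernel \<tau> (x :: 'a::euclidean_space)) \<partial>lborel) = 1"
proof -
  define t where "t = pi\<^sup>2 / \<tau>"
  have t: "t > 0" using assms by (simp add: t_def)
  have int: "integrable lborel (\<lambda>x::'a. exp (- t * (norm x)\<^sup>2))"
    using integrable_norm[OF integrable_gaussian_wave[OF t, of "0::'a"]]
    by (simp only: norm_mult norm_wave norm_of_real abs_exp_cancel mult_1_right)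
  have "complex_of_real (LINT x::'a|lborel. exp (- t * (norm x)\<^sup>2)) = heat_kernel t (0::'a)"
    using integral_gaussian_wave[OF t, of "0::'a"] by (simp only: wave_zero_left mult_1_right integral_complex_of_real)
  then have "(LINT x::'a|lborel. exp (- t * (norm x)\<^sup>2)) = sqrt (pi / t) ^ DIM('a)"
    unfolding heat_kernel_def by (simp only: of_real_eq_iff) simp
  also have "pi / t = inverse (pi / \<tau>)"
    by (simp add: t_def power2_eq_square)
  finally have val: "(LINT x::'a|lborel. exp (- t * (norm x)\<^sup>2)) = inverse (sqrt (pi / \<tau>) ^ DIM('a))"
    by (simp only: real_sqrt_inverse power_inverse)
  have "(\<integral>\<^sup>+x. ennreal (heat_kernel \<tau> (x :: 'a)) \<partial>lborel) = ennreal (LINT x::'a|lborel. heat_kernel \<tau> x)"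
    unfolding heat_kernel_def t_def[symmetric] using int assms
    by (intro nn_integral_eq_integral integrable_mult_right) auto
  also have "(LINT x::'a|lborel. heat_kernel \<tau> x) = 1"
    unfolding heat_kernel_def t_def[symmetric] integral_mult_right_zero val using assms by simp
  finally show ?thesis by simp
qed

lemma nn_integral_heat_kernel_shift:
  assumes "\<tau> > 0"
  shows "(\<integral>\<^sup>+y. ennreal (heat_kernel \<tau> (x - y)) \<partial>lborel) = 1"
    and "(\<integral>\<^sup>+y. ennreal (heat_kernel \<tau> (y - x)) \<partial>lborel) = 1"
  using nn_integral_lborel_reflect[of "\<lambda>y. ennreal (heat_kernel \<tau> y)" x]
  by (auto simp: nn_integral_heat_kernel[OF assms] heat_kernel_commute)

text \<open>Completing the square: as a function of \<open>z\<close>, the product of two Gaussians is a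
  Gaussian centred at the weighted mean of \<open>x\<close> and \<open>y\<close>. The semigroup law follows by
  integrating in \<open>z\<close>.\<close>

lemma heat_kernel_mult:
  fixes x y z :: "'a::euclidean_space"
  assumes s: "s > 0" and t: "t > 0"
  shows "heat_kernel s (x - z) * heat_kernel t (z - y) =
    heat_kernel (s + t) (x - y) * heat_kernel (s * t / (s + t)) (z - (y + (t / (s + t)) *\<^sub>R (x - y)))"
proof -
  define v where "v = x - y"
  define u where "u = z - (y + (t / (s + t)) *\<^sub>R v)"
  have st: "s + t > 0" "s + t \<noteq> 0" using s t by auto
  \<comment> \<open>\<open>u\<close> is the displacement of \<open>z\<close> from the weighted mean; the mixed terms in \<open>v \<bullet> u\<close> cancel\<close>
  have e1: "x - z = (s / (s + t)) *\<^sub>R v - u"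
  proof -
    have "s / (s + t) = 1 - t / (s + t)" using st by (simp add: field_simps)
    then have "(s / (s + t)) *\<^sub>R v = v - (t / (s + t)) *\<^sub>R v"
      by (simp only: scaleR_left_diff_distrib scaleR_one)
    then show ?thesis by (simp add: u_def v_def)
  qed
  have e2: "z - y = (t / (s + t)) *\<^sub>R v + u"
    by (simp add: u_def)
  define V U W where "V = v \<bullet> v" and "U = u \<bullet> u" and "W = v \<bullet> u"
  have q: "(norm (x - z))\<^sup>2 = (s / (s + t))\<^sup>2 * V - 2 * (s / (s + t)) * W + U"
    "(norm (z - y))\<^sup>2 = (t / (s + t))\<^sup>2 * V + 2 * (t / (s + t)) * W + U"
    unfolding e1 e2 V_def U_def W_def power2_norm_eq_inner
    by (simp_all add: inner_diff_left inner_diff_right inner_add_left inner_add_right inner_commute power2_eq_square)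
  have "(norm (x - z))\<^sup>2 / s + (norm (z - y))\<^sup>2 / t = V / (s + t) + U / (s * t / (s + t))"
  proof -
    have a: "(norm (x - z))\<^sup>2 / s = s / (s + t)\<^sup>2 * V - 2 / (s + t) * W + U / s"
      unfolding q using s st by (simp add: power2_eq_square add_divide_distrib diff_divide_distrib)
    have b: "(norm (z - y))\<^sup>2 / t = t / (s + t)\<^sup>2 * V + 2 / (s + t) * W + U / t"
      unfolding q using t st by (simp add: power2_eq_square add_divide_distrib diff_divide_distrib)
    have c: "s / (s + t)\<^sup>2 * V + t / (s + t)\<^sup>2 * V = V / (s + t)"
      using st by (simp add: power2_eq_square distrib_right[symmetric] add_divide_distrib[symmetric])
    have d: "U / s + U / t = U / (s * t / (s + t))"
      using s t st by (simp add: field_simps)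
    show ?thesis unfolding a b using c d by linarith
  qed
  moreover have "(norm (x - y))\<^sup>2 = V" "(norm u)\<^sup>2 = U"
    by (simp_all add: V_def U_def v_def power2_norm_eq_inner)
  ultimately have ex: "- (pi\<^sup>2 / s) * (norm (x - z))\<^sup>2 + - (pi\<^sup>2 / t) * (norm (z - y))\<^sup>2
      = - (pi\<^sup>2 / (s + t)) * (norm (x - y))\<^sup>2 + - (pi\<^sup>2 / (s * t / (s + t))) * (norm u)\<^sup>2"
  proof -
    assume *: "(norm (x - z))\<^sup>2 / s + (norm (z - y))\<^sup>2 / t = V / (s + t) + U / (s * t / (s + t))"
      and **: "(norm (x - y))\<^sup>2 = V" "(norm u)\<^sup>2 = U"
    have mv: "- (pi\<^sup>2 / c) * q = - (pi\<^sup>2 * (q / c))" for c q :: real by simp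
    have "- (pi\<^sup>2 / s) * (norm (x - z))\<^sup>2 + - (pi\<^sup>2 / t) * (norm (z - y))\<^sup>2
      = - (pi\<^sup>2 * ((norm (x - z))\<^sup>2 / s + (norm (z - y))\<^sup>2 / t))"
      unfolding mv distrib_left by simp
    then show ?thesis unfolding * ** mv distrib_left by simp
  qed
  have "sqrt (pi / s) * sqrt (pi / t) = sqrt (pi / (s + t)) * sqrt (pi / (s * t / (s + t)))"
    unfolding real_sqrt_mult[symmetric] using s t st by simp
  then have "sqrt (pi / s) ^ DIM('a) * sqrt (pi / t) ^ DIM('a)
      = sqrt (pi / (s + t)) ^ DIM('a) * sqrt (pi / (s * t / (s + t))) ^ DIM('a)"
    by (metis power_mult_distrib)
  moreover have "exp (- (pi\<^sup>2 / s) * (norm (x - z))\<^sup>2) * exp (- (pi\<^sup>2 / t) * (norm (z - y))\<^sup>2)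
      = exp (- (pi\<^sup>2 / (s + t)) * (norm (x - y))\<^sup>2) * exp (- (pi\<^sup>2 / (s * t / (s + t))) * (norm u)\<^sup>2)"
    unfolding exp_add[symmetric] ex ..
  moreover have "a * p * (b * q) = c * r * (d * w)" if "a * b = c * d" "p * q = r * w"
    for a b c d p q r w :: real
    using that by (metis mult.assoc mult.left_commute)
  ultimately have "heat_kernel s (x - z) * heat_kernel t (z - y)
      = heat_kernel (s + t) (x - y) * heat_kernel (s * t / (s + t)) u"
    unfolding heat_kernel_def by blast
  then show ?thesis by (simp only: u_def v_def)
qed

lemma heat_kernel_semigroup:
  fixes x y :: "'a::euclidean_space"
  assumes "s > 0" "t > 0"
  shows "(\<integral>\<^sup>+z. ennreal (heat_kernel s (x - z)) * ennreal (heat_kernel t (z - y)) \<partial>lborel)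
     = ennreal (heat_kernel (s + t) (x - y))"
  using assms
  by (simp add: ennreal_mult[symmetric] heat_kernel_nonneg heat_kernel_mult)
     (simp add: ennreal_mult heat_kernel_nonneg nn_integral_cmult nn_integral_heat_kernel_shift)

lemma heat_kernel_le:
  assumes "0 < s" "s \<le> t" "t \<le> 2 * s"
  shows "heat_kernel s (x::'a::euclidean_space) \<le> sqrt 2 ^ DIM('a) * heat_kernel t x"
proof -
  have "pi / s \<le> 2 * (pi / t)" using assms by (simp add: field_simps)
  then have "sqrt (pi / s) \<le> sqrt 2 * sqrt (pi / t)"
    unfolding real_sqrt_mult[symmetric] by (rule real_sqrt_le_mono)
  then have "sqrt (pi / s) ^ DIM('a) \<le> sqrt 2 ^ DIM('a) * sqrt (pi / t) ^ DIM('a)"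
    unfolding power_mult_distrib[symmetric] using assms by (intro power_mono) auto
  moreover have "pi\<^sup>2 / t \<le> pi\<^sup>2 / s"
    using assms by (intro divide_left_mono) auto
  then have "exp (- (pi\<^sup>2 / s) * (norm x)\<^sup>2) \<le> exp (- (pi\<^sup>2 / t) * (norm x)\<^sup>2)"
    unfolding exp_le_cancel_iff by (intro mult_right_mono) auto
  ultimately have "heat_kernel s x \<le> (sqrt 2 ^ DIM('a) * sqrt (pi / t) ^ DIM('a)) * exp (- (pi\<^sup>2 / t) * (norm x)\<^sup>2)"
    unfolding heat_kernel_def using assms by (intro mult_mono) auto
  then show ?thesis by (simp add: heat_kernel_def mult.assoc)
qed

section \<open>A maximal inequality for kernels with a semigroup-type bound\<close>

lemma ennreal_AM_GM:
  fixes a b :: ennreal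
  assumes "r > 0"
  shows "2 * (a * b) \<le> ennreal r * a\<^sup>2 + ennreal (1 / r) * b\<^sup>2"
proof (cases "a = top \<or> b = top")
  case True
  then show ?thesis
    using assms by (auto simp: ennreal_mult_top ennreal_top_mult power2_eq_square)
next
  case False
  then obtain x y where x: "a = ennreal x" "x \<ge> 0" and y: "b = ennreal y" "y \<ge> 0"
    by (metis ennreal_cases)
  have "0 \<le> (r * x - y)\<^sup>2 / r" using assms by simp
  also have "(r * x - y)\<^sup>2 / r = r * x\<^sup>2 + 1 / r * y\<^sup>2 - 2 * (x * y)"
    using assms by (simp add: power2_eq_square field_simps)
  finally have "2 * (x * y) \<le> r * x\<^sup>2 + 1 / r * y\<^sup>2" by simp
  then have "ennreal (2 * (x * y)) \<le> ennreal (r * x\<^sup>2 + 1 / r * y\<^sup>2)"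
    by (rule ennreal_leI)
  moreover have "ennreal (2 * (x * y)) = 2 * (a * b)"
    using x y by (simp add: ennreal_mult)
  moreover have "ennreal (r * x\<^sup>2 + 1 / r * y\<^sup>2) = ennreal r * a\<^sup>2 + ennreal (1 / r) * b\<^sup>2"
    using x(2) y(2) assms
    by (simp only: x(1) y(1) ennreal_plus ennreal_mult ennreal_power zero_le_power2 mult_nonneg_nonneg
        less_imp_le zero_less_divide_1_iff)
  ultimately show ?thesis by simp
qed

lemma ennreal_AM_GM_1: "2 * (a * b) \<le> a\<^sup>2 + b\<^sup>2" for a b :: ennreal
  using ennreal_AM_GM[of 1 a b] by simp

text \<open>The bound \<open>kernel_comp\<close> abstracts the heat kernels at the times \<open>2\<^sup>i c\<close>: the composition at times
  \<open>2\<^sup>j c\<close> and \<open>2\<^sup>k c\<close>, \<open>j \<le> k\<close>, is the kernel at a time between \<open>2\<^sup>k c\<close> and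
  \<open>2\<^bsup>k+1\<^esup> c\<close>, which is dominated, up to the factor \<open>C\<close>, by the kernel at the latter time.\<close>

locale symmetric_contraction_kernels = pair_sigma_finite M M
  for M :: "'a measure" +
  fixes K :: "nat \<Rightarrow> 'a \<Rightarrow> 'a \<Rightarrow> ennreal" and C :: real
  assumes kernel_measurable [measurable]: "\<And>i. case_prod (K i) \<in> borel_measurable (M \<Otimes>\<^sub>M M)"
    and kernel_sym: "\<And>i x y. K i x y = K i y x"
    and kernel_mass: "\<And>i x. (\<integral>\<^sup>+y. K i x y \<partial>M) \<le> 1"
    and kernel_comp: "\<And>j k x y. j \<le> k \<Longrightarrow> (\<integral>\<^sup>+z. K j x z * K k z y \<partial>M) \<le> ennreal C * K (Suc k) x y"
    and C_pos: "C > 0"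
begin

definition avg :: "nat \<Rightarrow> ('a \<Rightarrow> ennreal) \<Rightarrow> 'a \<Rightarrow> ennreal" where
  "avg i h x = (\<integral>\<^sup>+y. K i x y * h y \<partial>M)"

lemma avg_measurable [measurable]:
  assumes [measurable]: "h \<in> borel_measurable M"
  shows "avg i h \<in> borel_measurable M"
  unfolding avg_def[abs_def] by measurable

lemma avg_self_adjoint:
  assumes [measurable]: "g \<in> borel_measurable M" "h \<in> borel_measurable M"
  shows "(\<integral>\<^sup>+x. g x * avg i h x \<partial>M) = (\<integral>\<^sup>+x. avg i g x * h x \<partial>M)"
proof -
  have "(\<integral>\<^sup>+x. g x * avg i h x \<partial>M) = (\<integral>\<^sup>+x. \<integral>\<^sup>+y. g x * (K i x y * h y) \<partial>M \<partial>M)"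
    unfolding avg_def by (intro nn_integral_cong nn_integral_cmult[symmetric]) measurable
  also have "\<dots> = (\<integral>\<^sup>+y. \<integral>\<^sup>+x. g x * (K i x y * h y) \<partial>M \<partial>M)"
    by (rule Fubini'[symmetric]) measurable
  also have "\<dots> = (\<integral>\<^sup>+y. \<integral>\<^sup>+x. K i y x * g x * h y \<partial>M \<partial>M)"
    by (intro nn_integral_cong) (metis kernel_sym mult.assoc mult.commute)
  also have "\<dots> = (\<integral>\<^sup>+y. avg i g y * h y \<partial>M)"
    unfolding avg_def by (intro nn_integral_cong nn_integral_multc) measurable
  finally show ?thesis .
qed

text \<open>Jensen's inequality for the averages, in the form
  \<open>2 (K h)\<^sup>2 = \<integral>\<integral> K K \<cdot> 2 h(y) h(z) \<le> \<integral>\<integral> K K (h(y)\<^sup>2 + h(z)\<^sup>2)\<close>, and then symmetry, which makes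
  the mass of the kernel in the other variable at most one.\<close>

lemma avg_L2_contraction:
  assumes [measurable]: "h \<in> borel_measurable M"
  shows "(\<integral>\<^sup>+x. (avg i h x)\<^sup>2 \<partial>M) \<le> (\<integral>\<^sup>+x. (h x)\<^sup>2 \<partial>M)"
proof -
  have mass': "(\<integral>\<^sup>+x. K i x y \<partial>M) \<le> 1" for y
    using kernel_mass[of i y] by (simp only: kernel_sym[of i _ y])
  have pointwise: "(avg i h x)\<^sup>2 \<le> avg i (\<lambda>y. (h y)\<^sup>2) x" if "x \<in> space M" for x
  proof -
    have "(avg i h x)\<^sup>2 = (\<integral>\<^sup>+y. (K i x y * h y) * avg i h x \<partial>M)"
      unfolding power2_eq_square using that
      by (subst nn_integral_multc) (auto simp: avg_def)
    also have "\<dots> = (\<integral>\<^sup>+y. (\<integral>\<^sup>+z. (K i x y * h y) * (K i x z * h z) \<partial>M) \<partial>M)"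
      unfolding avg_def using that by (intro nn_integral_cong nn_integral_cmult[symmetric]) auto
    finally have "2 * (avg i h x)\<^sup>2 = 2 * (\<integral>\<^sup>+y. (\<integral>\<^sup>+z. (K i x y * h y) * (K i x z * h z) \<partial>M) \<partial>M)"
      by simp
    also have "\<dots> = (\<integral>\<^sup>+y. (\<integral>\<^sup>+z. K i x y * (K i x z * (2 * (h y * h z))) \<partial>M) \<partial>M)"
    proof -
      have "2 * (\<integral>\<^sup>+y. (\<integral>\<^sup>+z. (K i x y * h y) * (K i x z * h z) \<partial>M) \<partial>M)
          = (\<integral>\<^sup>+y. 2 * (\<integral>\<^sup>+z. (K i x y * h y) * (K i x z * h z) \<partial>M) \<partial>M)"
        using that by (intro nn_integral_cmult[symmetric]) auto
      also have "\<dots> = (\<integral>\<^sup>+y. (\<integral>\<^sup>+z. 2 * ((K i x y * h y) * (K i x z * h z)) \<partial>M) \<partial>M)"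
        using that by (intro nn_integral_cong nn_integral_cmult[symmetric]) auto
      finally show ?thesis by (simp add: mult_ac)
    qed
    also have "\<dots> \<le> (\<integral>\<^sup>+y. (\<integral>\<^sup>+z. K i x y * (K i x z * ((h y)\<^sup>2 + (h z)\<^sup>2)) \<partial>M) \<partial>M)"
      by (intro nn_integral_mono mult_left_mono ennreal_AM_GM_1) auto
    also have "\<dots> = (\<integral>\<^sup>+y. K i x y * ((\<integral>\<^sup>+z. K i x z \<partial>M) * (h y)\<^sup>2 + avg i (\<lambda>z. (h z)\<^sup>2) x) \<partial>M)"
      using that by (simp add: nn_integral_cmult distrib_left nn_integral_add nn_integral_multc avg_def)
    also have "\<dots> \<le> (\<integral>\<^sup>+y. K i x y * (1 * (h y)\<^sup>2 + avg i (\<lambda>z. (h z)\<^sup>2) x) \<partial>M)"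
      by (intro nn_integral_mono mult_left_mono add_mono mult_right_mono kernel_mass) auto
    also have "\<dots> = avg i (\<lambda>z. (h z)\<^sup>2) x + (\<integral>\<^sup>+y. K i x y \<partial>M) * avg i (\<lambda>z. (h z)\<^sup>2) x"
      using that by (simp add: distrib_left nn_integral_add nn_integral_multc avg_def)
    also have "\<dots> \<le> avg i (\<lambda>z. (h z)\<^sup>2) x + 1 * avg i (\<lambda>z. (h z)\<^sup>2) x"
      by (intro add_mono mult_right_mono kernel_mass) auto
    also have "\<dots> = 2 * avg i (\<lambda>z. (h z)\<^sup>2) x" by (simp add: mult_2)
    finally show ?thesis
      by (subst (asm) ennreal_mult_le_mult_iff) auto
  qed
  have "(\<integral>\<^sup>+x. (avg i h x)\<^sup>2 \<partial>M) \<le> (\<integral>\<^sup>+x. avg i (\<lambda>y. (h y)\<^sup>2) x \<partial>M)"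
    by (intro nn_integral_mono pointwise)
  also have "\<dots> = (\<integral>\<^sup>+x. 1 * avg i (\<lambda>y. (h y)\<^sup>2) x \<partial>M)" by simp
  also have "\<dots> = (\<integral>\<^sup>+y. avg i (\<lambda>_. 1) y * (h y)\<^sup>2 \<partial>M)"
    by (rule avg_self_adjoint) measurable
  also have "\<dots> \<le> (\<integral>\<^sup>+y. 1 * (h y)\<^sup>2 \<partial>M)"
    unfolding avg_def by (intro nn_integral_mono mult_right_mono) (auto intro: kernel_mass)
  finally show ?thesis by simp
qed

lemma avg_composition:
  assumes [measurable]: "v \<in> borel_measurable M" "w \<in> borel_measurable M" and "j \<le> k"
  shows "(\<integral>\<^sup>+x. avg j v x * avg k w x \<partial>M) \<le> ennreal C * (\<integral>\<^sup>+x. v x * avg (Suc k) w x \<partial>M)"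
proof -
  have comp: "avg j (avg k w) x \<le> ennreal C * avg (Suc k) w x" if "x \<in> space M" for x
  proof -
    have "avg j (avg k w) x = (\<integral>\<^sup>+z. \<integral>\<^sup>+y. K j x z * (K k z y * w y) \<partial>M \<partial>M)"
      unfolding avg_def using that by (intro nn_integral_cong nn_integral_cmult[symmetric]) auto
    also have "\<dots> = (\<integral>\<^sup>+y. \<integral>\<^sup>+z. K j x z * (K k z y * w y) \<partial>M \<partial>M)"
      using that by (intro Fubini'[symmetric]) simp
    also have "\<dots> = (\<integral>\<^sup>+y. (\<integral>\<^sup>+z. K j x z * K k z y \<partial>M) * w y \<partial>M)"
      using that by (intro nn_integral_cong, subst nn_integral_multc[symmetric]) (auto simp: mult_ac)
    also have "\<dots> \<le> (\<integral>\<^sup>+y. (ennreal C * K (Suc k) x y) * w y \<partial>M)"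
      using \<open>j \<le> k\<close> by (intro nn_integral_mono mult_right_mono kernel_comp) auto
    also have "\<dots> = ennreal C * avg (Suc k) w x"
      unfolding avg_def using that by (subst nn_integral_cmult[symmetric]) (auto simp: mult_ac)
    finally show ?thesis .
  qed
  have "(\<integral>\<^sup>+x. avg j v x * avg k w x \<partial>M) = (\<integral>\<^sup>+x. v x * avg j (avg k w) x \<partial>M)"
    by (rule avg_self_adjoint[symmetric]) measurable
  also have "\<dots> \<le> (\<integral>\<^sup>+x. v x * (ennreal C * avg (Suc k) w x) \<partial>M)"
    by (intro nn_integral_mono mult_left_mono comp) auto
  also have "\<dots> = ennreal C * (\<integral>\<^sup>+x. v x * avg (Suc k) w x \<partial>M)"
    by (subst nn_integral_cmult[symmetric]) (auto simp: mult_ac)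
  finally show ?thesis .
qed

definition maxavg :: "nat \<Rightarrow> ('a \<Rightarrow> ennreal) \<Rightarrow> 'a \<Rightarrow> ennreal" where
  "maxavg N h x = (SUP i\<in>{..N}. avg i h x)"

lemma maxavg_measurable [measurable]:
  assumes [measurable]: "h \<in> borel_measurable M"
  shows "maxavg N h \<in> borel_measurable M"
  unfolding maxavg_def[abs_def] by measurable

lemma avg_le_maxavg: "i \<le> N \<Longrightarrow> avg i h x \<le> maxavg N h x"
  unfolding maxavg_def by (rule SUP_upper) simp

lemma maxavg_attained: "\<exists>i\<le>N. maxavg N h x = avg i h x"
proof -
  have "maxavg N h x = Max ((\<lambda>i. avg i h x) ` {..N})"
    unfolding maxavg_def by (rule Max_Sup[symmetric]) auto
  moreover have "Max ((\<lambda>i. avg i h x) ` {..N}) \<in> (\<lambda>i. avg i h x) ` {..N}"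
    by (rule Max_in) auto
  ultimately show ?thesis by (metis (no_types, lifting) atMost_iff imageE)
qed

lemma maxavg_Suc_sq: "(maxavg (Suc N) h x)\<^sup>2 \<le> (maxavg N h x)\<^sup>2 + (avg (Suc N) h x)\<^sup>2"
proof -
  obtain i where i: "i \<le> Suc N" "maxavg (Suc N) h x = avg i h x"
    using maxavg_attained by blast
  then show ?thesis
  proof (cases "i = Suc N")
    case False
    then have "i \<le> N" using i by simp
    then have "(avg i h x)\<^sup>2 \<le> (maxavg N h x)\<^sup>2"
      by (intro power_mono avg_le_maxavg) auto
    then show ?thesis unfolding i(2) by (simp add: add_increasing2)
  qed (simp add: i)
qed

lemma nn_integral_maxavg_Suc_sq:
  assumes [measurable]: "h \<in> borel_measurable M"
  shows "(\<integral>\<^sup>+x. (maxavg (Suc N) h x)\<^sup>2 \<partial>M) \<le> (\<integral>\<^sup>+x. (maxavg N h x)\<^sup>2 \<partial>M) + (\<integral>\<^sup>+x. (h x)\<^sup>2 \<partial>M)"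
proof -
  have "(\<integral>\<^sup>+x. (maxavg (Suc N) h x)\<^sup>2 \<partial>M) \<le> (\<integral>\<^sup>+x. (maxavg N h x)\<^sup>2 + (avg (Suc N) h x)\<^sup>2 \<partial>M)"
    by (intro nn_integral_mono maxavg_Suc_sq)
  also have "\<dots> = (\<integral>\<^sup>+x. (maxavg N h x)\<^sup>2 \<partial>M) + (\<integral>\<^sup>+x. (avg (Suc N) h x)\<^sup>2 \<partial>M)"
    by (intro nn_integral_add) measurable
  also have "\<dots> \<le> (\<integral>\<^sup>+x. (maxavg N h x)\<^sup>2 \<partial>M) + (\<integral>\<^sup>+x. (h x)\<^sup>2 \<partial>M)"
    by (intro add_mono avg_L2_contraction) auto
  finally show ?thesis .
qed

text \<open>A bound that grows with \<open>N\<close>; it gives finiteness, so that terms can be absorbed, and it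
  starts the iteration of \<open>maxavg_improve\<close>.\<close>

lemma maxavg_crude:
  assumes [measurable]: "h \<in> borel_measurable M"
  shows "(\<integral>\<^sup>+x. (maxavg N h x)\<^sup>2 \<partial>M) \<le> ennreal (real N + 1) * (\<integral>\<^sup>+x. (h x)\<^sup>2 \<partial>M)"
proof (induction N)
  case 0
  have "maxavg 0 h = avg 0 h" by (simp add: maxavg_def fun_eq_iff)
  then show ?case using avg_L2_contraction[OF assms, of 0] by simp
next
  case (Suc N)
  have "(\<integral>\<^sup>+x. (maxavg (Suc N) h x)\<^sup>2 \<partial>M) \<le> ennreal (real N + 1) * (\<integral>\<^sup>+x. (h x)\<^sup>2 \<partial>M) + (\<integral>\<^sup>+x. (h x)\<^sup>2 \<partial>M)"
    using nn_integral_maxavg_Suc_sq[OF assms] Suc by (meson add_right_mono order_trans)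
  also have "\<dots> = (ennreal (real N + 1) + ennreal 1) * (\<integral>\<^sup>+x. (h x)\<^sup>2 \<partial>M)"
    by (simp add: distrib_right)
  also have "ennreal (real N + 1) + ennreal 1 = ennreal (real (Suc N) + 1)"
    by (subst ennreal_plus[symmetric]) auto
  finally show ?case .
qed

lemma sum_triangle_le:
  fixes I :: "nat \<Rightarrow> nat \<Rightarrow> ennreal"
  assumes sym: "\<And>j k. I j k = I k j"
  shows "(\<Sum>j\<le>N. \<Sum>k\<le>N. I j k) \<le> 2 * (\<Sum>k\<le>N. \<Sum>j\<le>k. I j k)"
proof -
  have "(\<Sum>j\<le>N. \<Sum>k\<le>N. I j k) \<le> (\<Sum>j\<le>N. \<Sum>k\<le>N. (if j \<le> k then I j k else 0) + (if k \<le> j then I j k else 0))"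
    by (intro sum_mono) auto
  also have "\<dots> = (\<Sum>j\<le>N. \<Sum>k\<le>N. (if j \<le> k then I j k else 0)) + (\<Sum>j\<le>N. \<Sum>k\<le>N. (if k \<le> j then I k j else 0))"
    by (simp only: sum.distrib sym[of _ "_ :: nat"] cong: if_cong)
  also have "(\<Sum>j\<le>N. \<Sum>k\<le>N. (if j \<le> k then I j k else 0)) = (\<Sum>k\<le>N. \<Sum>j\<le>N. (if j \<le> k then I j k else 0))"
    by (rule sum.swap)
  also have "(\<Sum>k\<le>N. \<Sum>j\<le>N. (if j \<le> k then I j k else 0)) = (\<Sum>k\<le>N. \<Sum>j\<le>k. I j k)"
    by (intro sum.cong refl sum.mono_neutral_cong_right) auto
  finally show ?thesis by (simp add: mult_2)
qed

text \<open>The \<open>T T\<^sup>*\<close> step. Let \<open>m\<close> be the maximal function and \<open>w\<^sub>k\<close> its restriction to the set where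
  the maximum is attained first at the index \<open>k\<close>. Duality gives \<open>\<integral> m\<^sup>2 = \<integral> h W\<close> with
  \<open>W = \<Sum>\<^sub>k avg k (w\<^sub>k)\<close>. In \<open>\<integral> W\<^sup>2\<close> the terms with \<open>j \<le> k\<close> are at most
  \<open>C \<integral> w\<^sub>j \<cdot> avg (k + 1) (w\<^sub>k)\<close>. Summing over \<open>j\<close> replaces \<open>w\<^sub>j\<close> by \<open>m\<close>, moving the average to \<open>m\<close> and
  summing over \<open>k\<close> leaves \<open>\<integral> m' m\<close>, where \<open>m'\<close> is the maximal function of \<open>m\<close> with last
  index \<open>N + 1\<close>. Thus \<open>\<integral> W\<^sup>2\<close> is controlled by the assumed bound \<open>A\<close> only through a weighted
  arithmetic-geometric mean, and the weight \<open>2 C\<close> is chosen to make the new bound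
  depend on \<open>A\<close> with the factor \<open>1/2\<close>.\<close>

lemma maxavg_improve:
  assumes A: "A \<ge> 0"
    and bound: "\<And>h. h \<in> borel_measurable M \<Longrightarrow>
      (\<integral>\<^sup>+x. (maxavg N h x)\<^sup>2 \<partial>M) \<le> ennreal A * (\<integral>\<^sup>+x. (h x)\<^sup>2 \<partial>M)"
    and h [measurable]: "h \<in> borel_measurable M"
  shows "(\<integral>\<^sup>+x. (maxavg N h x)\<^sup>2 \<partial>M) \<le> ennreal (2 * C\<^sup>2 + (A + 1) / 2) * (\<integral>\<^sup>+x. (h x)\<^sup>2 \<partial>M)"
proof (cases "(\<integral>\<^sup>+x. (h x)\<^sup>2 \<partial>M) = top")
  case True
  have "0 < 2 * C\<^sup>2 + (A + 1) / 2" using C_pos A by (intro add_pos_pos) auto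
  then show ?thesis unfolding True by (simp add: ennreal_mult_top)
next
  case False
  define m where "m = maxavg N h"
  define L where "L = 2 * C\<^sup>2 + (A + 1) / 2"
  have L: "L > 0" unfolding L_def using C_pos A by (intro add_pos_pos) auto
  have [measurable]: "m \<in> borel_measurable M" unfolding m_def by measurable
  define idx where "idx x = (LEAST i. i \<le> N \<and> m x = avg i h x)" for x
  have idx: "idx x \<le> N \<and> m x = avg (idx x) h x" for x
    unfolding idx_def by (rule LeastI_ex) (use maxavg_attained[of N h x] in \<open>auto simp: m_def\<close>)
  have [measurable]: "idx \<in> measurable M (count_space UNIV)"
    unfolding idx_def by measurable
  define w where "w k x = (if idx x = k then m x else 0)" for k x
  have [measurable]: "w k \<in> borel_measurable M" for k
    unfolding w_def by measurable
  have sum_w: "(\<Sum>k\<le>N. w k x) = m x" for x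
    using idx[of x] by (simp add: w_def)
  have sum_w_le: "(\<Sum>k\<le>l. w k x) \<le> m x" for l x
    by (simp add: w_def)
  define W where "W x = (\<Sum>k\<le>N. avg k (w k) x)" for x
  have [measurable]: "W \<in> borel_measurable M" unfolding W_def by measurable
  have m_sq: "(m x)\<^sup>2 = (\<Sum>k\<le>N. w k x * avg k h x)" for x
  proof -
    have "(\<Sum>k\<le>N. w k x * avg k h x) = (\<Sum>k\<le>N. if idx x = k then m x * avg k h x else 0)"
      by (intro sum.cong) (auto simp: w_def)
    also have "\<dots> = m x * avg (idx x) h x" using idx[of x] by simp
    finally show ?thesis using idx[of x] by (simp add: power2_eq_square)
  qed
  have duality: "(\<integral>\<^sup>+x. (m x)\<^sup>2 \<partial>M) = (\<integral>\<^sup>+x. h x * W x \<partial>M)"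
  proof -
    have "(\<integral>\<^sup>+x. (m x)\<^sup>2 \<partial>M) = (\<Sum>k\<le>N. \<integral>\<^sup>+x. w k x * avg k h x \<partial>M)"
      unfolding m_sq by (rule nn_integral_sum) measurable
    also have "\<dots> = (\<Sum>k\<le>N. \<integral>\<^sup>+x. avg k (w k) x * h x \<partial>M)"
      by (intro sum.cong refl avg_self_adjoint) measurable
    also have "\<dots> = (\<integral>\<^sup>+x. (\<Sum>k\<le>N. avg k (w k) x * h x) \<partial>M)"
      by (rule nn_integral_sum[symmetric]) measurable
    finally show ?thesis by (simp add: W_def sum_distrib_left mult.commute)
  qed
  have W_sq: "(\<integral>\<^sup>+x. (W x)\<^sup>2 \<partial>M) \<le> ennreal L * (\<integral>\<^sup>+x. (m x)\<^sup>2 \<partial>M)"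
  proof -
    let ?m' = "maxavg (Suc N) m"
    have "(\<integral>\<^sup>+x. (W x)\<^sup>2 \<partial>M) = (\<Sum>j\<le>N. \<Sum>k\<le>N. \<integral>\<^sup>+x. avg j (w j) x * avg k (w k) x \<partial>M)"
      unfolding W_def power2_eq_square sum_product
      by (subst nn_integral_sum, measurable, intro sum.cong refl nn_integral_sum) measurable
    also have "\<dots> \<le> 2 * (\<Sum>k\<le>N. \<Sum>j\<le>k. \<integral>\<^sup>+x. avg j (w j) x * avg k (w k) x \<partial>M)"
      by (rule sum_triangle_le) (simp add: mult.commute)
    also have "\<dots> \<le> 2 * (\<Sum>k\<le>N. ennreal C * (\<integral>\<^sup>+x. avg (Suc k) m x * w k x \<partial>M))"
    proof (intro mult_left_mono sum_mono)
      fix k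
      have "(\<Sum>j\<le>k. \<integral>\<^sup>+x. avg j (w j) x * avg k (w k) x \<partial>M)
          \<le> (\<Sum>j\<le>k. ennreal C * (\<integral>\<^sup>+x. w j x * avg (Suc k) (w k) x \<partial>M))"
        by (intro sum_mono avg_composition) auto
      also have "\<dots> = ennreal C * (\<integral>\<^sup>+x. (\<Sum>j\<le>k. w j x * avg (Suc k) (w k) x) \<partial>M)"
        unfolding sum_distrib_left[symmetric] by (subst nn_integral_sum) auto
      also have "\<dots> \<le> ennreal C * (\<integral>\<^sup>+x. m x * avg (Suc k) (w k) x \<partial>M)"
        unfolding sum_distrib_right[symmetric]
        by (intro mult_left_mono nn_integral_mono mult_right_mono sum_w_le) auto
      also have "(\<integral>\<^sup>+x. m x * avg (Suc k) (w k) x \<partial>M) = (\<integral>\<^sup>+x. avg (Suc k) m x * w k x \<partial>M)"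
        by (rule avg_self_adjoint) measurable
      finally show "(\<Sum>j\<le>k. \<integral>\<^sup>+x. avg j (w j) x * avg k (w k) x \<partial>M)
          \<le> ennreal C * (\<integral>\<^sup>+x. avg (Suc k) m x * w k x \<partial>M)" .
    qed auto
    also have "\<dots> \<le> 2 * (\<Sum>k\<le>N. ennreal C * (\<integral>\<^sup>+x. ?m' x * w k x \<partial>M))"
      by (intro mult_left_mono sum_mono nn_integral_mono mult_right_mono avg_le_maxavg) auto
    also have "\<dots> = ennreal C * (2 * (\<integral>\<^sup>+x. ?m' x * m x \<partial>M))"
    proof -
      have "(\<Sum>k\<le>N. \<integral>\<^sup>+x. ?m' x * w k x \<partial>M) = (\<integral>\<^sup>+x. ?m' x * m x \<partial>M)"
        by (subst nn_integral_sum[symmetric]) (auto simp: sum_distrib_left[symmetric] sum_w)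
      then show ?thesis by (simp add: sum_distrib_left[symmetric] mult_ac)
    qed
    also have "2 * (\<integral>\<^sup>+x. ?m' x * m x \<partial>M) = (\<integral>\<^sup>+x. 2 * (m x * ?m' x) \<partial>M)"
      by (subst nn_integral_cmult) (auto simp: mult_ac)
    also have "\<dots> \<le> (\<integral>\<^sup>+x. ennreal (2 * C) * (m x)\<^sup>2 + ennreal (1 / (2 * C)) * (?m' x)\<^sup>2 \<partial>M)"
      using C_pos by (intro nn_integral_mono ennreal_AM_GM) auto
    also have "\<dots> = ennreal (2 * C) * (\<integral>\<^sup>+x. (m x)\<^sup>2 \<partial>M) + ennreal (1 / (2 * C)) * (\<integral>\<^sup>+x. (?m' x)\<^sup>2 \<partial>M)"
      by (simp add: nn_integral_add nn_integral_cmult)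
    also have "(\<integral>\<^sup>+x. (?m' x)\<^sup>2 \<partial>M) \<le> ennreal (A + 1) * (\<integral>\<^sup>+x. (m x)\<^sup>2 \<partial>M)"
    proof -
      have "(\<integral>\<^sup>+x. (?m' x)\<^sup>2 \<partial>M) \<le> ennreal A * (\<integral>\<^sup>+x. (m x)\<^sup>2 \<partial>M) + (\<integral>\<^sup>+x. (m x)\<^sup>2 \<partial>M)"
        using nn_integral_maxavg_Suc_sq[of m N] bound[of m] by (meson \<open>m \<in> _\<close> add_right_mono order_trans)
      then show ?thesis using A by (simp add: distrib_right)
    qed
    finally have "(\<integral>\<^sup>+x. (W x)\<^sup>2 \<partial>M) \<le> ennreal C * (ennreal (2 * C) * (\<integral>\<^sup>+x. (m x)\<^sup>2 \<partial>M)
        + ennreal (1 / (2 * C)) * (ennreal (A + 1) * (\<integral>\<^sup>+x. (m x)\<^sup>2 \<partial>M)))"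
      by (simp add: mult_left_mono)
    also have "\<dots> = (ennreal C * (ennreal (2 * C) + ennreal (1 / (2 * C)) * ennreal (A + 1))) * (\<integral>\<^sup>+x. (m x)\<^sup>2 \<partial>M)"
      by (simp add: distrib_left distrib_right mult_ac)
    also have "ennreal C * (ennreal (2 * C) + ennreal (1 / (2 * C)) * ennreal (A + 1))
        = ennreal (C * (2 * C + 1 / (2 * C) * (A + 1)))"
      using C_pos A by (simp only: ennreal_mult ennreal_plus mult_nonneg_nonneg add_nonneg_nonneg
        zero_le_divide_1_iff zero_le_numeral less_imp_le zero_le_one)
    also have "C * (2 * C + 1 / (2 * C) * (A + 1)) = L"
      using C_pos by (simp add: L_def power2_eq_square field_simps)
    finally show ?thesis .
  qed
  \<comment> \<open>needed to subtract \<open>\<integral> m\<^sup>2\<close> from both sides\<close>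
  have fin: "(\<integral>\<^sup>+x. (m x)\<^sup>2 \<partial>M) < top"
    using maxavg_crude[OF h, of N] False unfolding m_def
    by (metis ennreal_mult_less_top ennreal_less_top order_le_less_trans top.not_eq_extremum)
  have "2 * (\<integral>\<^sup>+x. (m x)\<^sup>2 \<partial>M) = (\<integral>\<^sup>+x. 2 * (h x * W x) \<partial>M)"
    unfolding duality by (subst nn_integral_cmult) auto
  also have "\<dots> \<le> (\<integral>\<^sup>+x. ennreal L * (h x)\<^sup>2 + ennreal (1 / L) * (W x)\<^sup>2 \<partial>M)"
    using L by (intro nn_integral_mono ennreal_AM_GM)
  also have "\<dots> = ennreal L * (\<integral>\<^sup>+x. (h x)\<^sup>2 \<partial>M) + ennreal (1 / L) * (\<integral>\<^sup>+x. (W x)\<^sup>2 \<partial>M)"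
    by (simp add: nn_integral_add nn_integral_cmult)
  also have "\<dots> \<le> ennreal L * (\<integral>\<^sup>+x. (h x)\<^sup>2 \<partial>M) + ennreal (1 / L) * (ennreal L * (\<integral>\<^sup>+x. (m x)\<^sup>2 \<partial>M))"
    by (intro add_left_mono mult_left_mono W_sq) auto
  also have "ennreal (1 / L) * (ennreal L * (\<integral>\<^sup>+x. (m x)\<^sup>2 \<partial>M)) = (\<integral>\<^sup>+x. (m x)\<^sup>2 \<partial>M)"
    using L by (simp add: mult.assoc[symmetric] ennreal_mult[symmetric])
  finally have "(\<integral>\<^sup>+x. (m x)\<^sup>2 \<partial>M) + (\<integral>\<^sup>+x. (m x)\<^sup>2 \<partial>M) \<le> ennreal L * (\<integral>\<^sup>+x. (h x)\<^sup>2 \<partial>M) + (\<integral>\<^sup>+x. (m x)\<^sup>2 \<partial>M)"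
    by (simp add: mult_2)
  then have "(\<integral>\<^sup>+x. (m x)\<^sup>2 \<partial>M) \<le> ennreal L * (\<integral>\<^sup>+x. (h x)\<^sup>2 \<partial>M)"
    using fin by (auto simp: ennreal_add_left_cancel_le add.commute)
  then show ?thesis by (simp add: m_def L_def)
qed

text \<open>The map \<open>A \<mapsto> 2 C\<^sup>2 + (A + 1) / 2\<close> is a contraction with fixed point \<open>4 C\<^sup>2 + 1\<close>, so iterating
  \<open>maxavg_improve\<close> removes the dependence on \<open>N\<close>.\<close>

lemma maxavg_iterated:
  assumes "h \<in> borel_measurable M"
  shows "(\<integral>\<^sup>+x. (maxavg N h x)\<^sup>2 \<partial>M)
    \<le> ennreal (4 * C\<^sup>2 + 1 + (1/2) ^ n * (real N + 1)) * (\<integral>\<^sup>+x. (h x)\<^sup>2 \<partial>M)"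
  using assms
proof (induction n arbitrary: h)
  case 0
  have "(\<integral>\<^sup>+x. (maxavg N h x)\<^sup>2 \<partial>M) \<le> ennreal (real N + 1) * (\<integral>\<^sup>+x. (h x)\<^sup>2 \<partial>M)"
    by (rule maxavg_crude[OF 0])
  also have "\<dots> \<le> ennreal (4 * C\<^sup>2 + 1 + (1/2) ^ 0 * (real N + 1)) * (\<integral>\<^sup>+x. (h x)\<^sup>2 \<partial>M)"
    by (intro mult_right_mono ennreal_leI) auto
  finally show ?case .
next
  case (Suc n)
  have "(\<integral>\<^sup>+x. (maxavg N h x)\<^sup>2 \<partial>M) \<le>
      ennreal (2 * C\<^sup>2 + ((4 * C\<^sup>2 + 1 + (1/2) ^ n * (real N + 1)) + 1) / 2) * (\<integral>\<^sup>+x. (h x)\<^sup>2 \<partial>M)"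
    by (rule maxavg_improve[OF _ Suc.IH Suc.prems]) auto
  also have "2 * C\<^sup>2 + ((4 * C\<^sup>2 + 1 + (1/2) ^ n * (real N + 1)) + 1) / 2
      = 4 * C\<^sup>2 + 1 + (1/2) ^ Suc n * (real N + 1)"
    by (simp add: field_simps)
  finally show ?case .
qed

lemma maxavg_L2:
  assumes h: "h \<in> borel_measurable M"
  shows "(\<integral>\<^sup>+x. (maxavg N h x)\<^sup>2 \<partial>M) \<le> ennreal (4 * C\<^sup>2 + 1) * (\<integral>\<^sup>+x. (h x)\<^sup>2 \<partial>M)"
proof (cases "(\<integral>\<^sup>+x. (h x)\<^sup>2 \<partial>M)" rule: ennreal_cases)
  case top
  have "0 < 4 * C\<^sup>2 + 1" by (intro add_nonneg_pos) auto
  then show ?thesis unfolding top by (simp add: ennreal_mult_top)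
next
  case (real y)
  have "(\<lambda>n. (4 * C\<^sup>2 + 1 + (1/2) ^ n * (real N + 1)) * y) \<longlonglongrightarrow> (4 * C\<^sup>2 + 1 + 0 * (real N + 1)) * y"
    by (intro tendsto_intros LIMSEQ_power_zero) auto
  then have "(\<lambda>n. ennreal ((4 * C\<^sup>2 + 1 + (1/2) ^ n * (real N + 1)) * y)) \<longlonglongrightarrow> ennreal ((4 * C\<^sup>2 + 1) * y)"
    by (intro tendsto_ennrealI) simp
  moreover have "(\<integral>\<^sup>+x. (maxavg N h x)\<^sup>2 \<partial>M) \<le> ennreal ((4 * C\<^sup>2 + 1 + (1/2) ^ n * (real N + 1)) * y)" for n
    using maxavg_iterated[OF h, of N n] real by (simp add: ennreal_mult)
  ultimately have "(\<integral>\<^sup>+x. (maxavg N h x)\<^sup>2 \<partial>M) \<le> ennreal ((4 * C\<^sup>2 + 1) * y)"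
    by (intro LIMSEQ_le_const) auto
  then show ?thesis using real by (simp add: ennreal_mult)
qed

theorem maximal_inequality:
  assumes h [measurable]: "h \<in> borel_measurable M"
  shows "(\<integral>\<^sup>+x. (SUP i. (avg i h x)\<^sup>2) \<partial>M) \<le> ennreal (4 * C\<^sup>2 + 1) * (\<integral>\<^sup>+x. (h x)\<^sup>2 \<partial>M)"
proof -
  have "(SUP i. (avg i h x)\<^sup>2) \<le> (SUP N. (maxavg N h x)\<^sup>2)" for x
    by (intro SUP_mono) (auto intro!: power_mono avg_le_maxavg)
  then have "(\<integral>\<^sup>+x. (SUP i. (avg i h x)\<^sup>2) \<partial>M) \<le> (\<integral>\<^sup>+x. (SUP N. (maxavg N h x)\<^sup>2) \<partial>M)"
    by (intro nn_integral_mono)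
  also have "\<dots> = (SUP N. \<integral>\<^sup>+x. (maxavg N h x)\<^sup>2 \<partial>M)"
  proof (rule nn_integral_monotone_convergence_SUP)
    show "incseq (\<lambda>N x. (maxavg N h x)\<^sup>2)"
      unfolding maxavg_def incseq_def le_fun_def by (auto intro!: power_mono SUP_subset_mono)
  qed measurable
  also have "\<dots> \<le> ennreal (4 * C\<^sup>2 + 1) * (\<integral>\<^sup>+x. (h x)\<^sup>2 \<partial>M)"
    by (intro SUP_least maxavg_L2 h)
  finally show ?thesis .
qed

end

section \<open>The Plancherel inequality\<close>

text \<open>The transform with the sign of the inversion formula, since the multiplier operators are
  written with it; the Fourier transform of \<open>f\<close> is \<open>\<lambda>\<xi>. ft f (- \<xi>)\<close>.\<close>

definition ft :: "('a::euclidean_space \<Rightarrow> complex) \<Rightarrow> 'a \<Rightarrow> complex" where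
  "ft H x = (LINT \<xi>|lborel. H \<xi> * wave x \<xi>)"

lemma integrable_mult_wave:
  "integrable lborel (\<lambda>\<xi>. H \<xi> * wave x \<xi>)" if "integrable lborel H"
  using that by (rule Bochner_Integration.integrable_bound) (use that in \<open>auto simp: norm_mult\<close>)

lemma ft_measurable [measurable]:
  assumes [measurable]: "H \<in> borel_measurable borel"
  shows "ft H \<in> borel_measurable borel"
  unfolding ft_def[abs_def] by measurable

lemma norm_ft_le: "norm (ft H x) \<le> (LINT \<xi>|lborel. norm (H \<xi>))"
  unfolding ft_def using integral_norm_bound[of lborel "\<lambda>\<xi>. H \<xi> * wave x \<xi>"] by (simp add: norm_mult)

lemma
  fixes f :: "'a::euclidean_space \<Rightarrow> complex" and g :: "'b::euclidean_space \<Rightarrow> complex"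
  assumes f: "integrable lborel f" and g: "integrable lborel g"
  shows integrable_lborel_tensor: "integrable lborel (\<lambda>p. f (fst p) * g (snd p))"
    and integral_lborel_tensor:
      "(LINT p|lborel. f (fst p) * g (snd p)) = (LINT x|lborel. f x) * (LINT y|lborel. g y)"
proof -
  have [measurable]: "f \<in> borel_measurable borel" "g \<in> borel_measurable borel"
    using borel_measurable_integrable[OF f] borel_measurable_integrable[OF g] by simp_all
  have int: "integrable (lborel \<Otimes>\<^sub>M lborel) (\<lambda>(x, y). f x * g y)"
    by (rule lborel_pair.Fubini_integrable) (auto simp: norm_mult f g)
  then show "integrable lborel (\<lambda>p. f (fst p) * g (snd p))"
    by (simp add: lborel_prod case_prod_unfold)
  have "(LINT x|lborel. LINT y|lborel. f x * g y) = integral\<^sup>L (lborel \<Otimes>\<^sub>M lborel) (\<lambda>(x, y). f x * g y)"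
    by (rule lborel_pair.integral_fst[OF int])
  then show "(LINT p|lborel. f (fst p) * g (snd p)) = (LINT x|lborel. f x) * (LINT y|lborel. g y)"
    by (simp add: lborel_prod case_prod_unfold)
qed

lemma integral_gaussian_wave_swap:
  assumes "\<delta> > 0"
  shows "(LINT x|lborel. wave x \<xi> * complex_of_real (exp (- \<delta> * (norm x)\<^sup>2))) = heat_kernel \<delta> \<xi>"
  using integral_gaussian_wave[OF assms, of \<xi>] by (simp only: wave_sym[of \<xi>] mult.commute)

text \<open>Schur's test with \<open>2 h(x) h(y) \<le> h(x)\<^sup>2 + h(y)\<^sup>2\<close>; both marginals of the kernel have mass one.\<close>

lemma schur_heat_kernel:
  fixes h :: "'a::euclidean_space \<Rightarrow> ennreal"
  assumes [measurable]: "h \<in> borel_measurable borel" and \<delta>: "\<delta> > 0"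
  shows "(\<integral>\<^sup>+p. h (fst p) * h (snd p) * ennreal (heat_kernel \<delta> (fst p - snd p)) \<partial>lborel)
    \<le> (\<integral>\<^sup>+x. (h x)\<^sup>2 \<partial>lborel)"
proof -
  let ?k = "\<lambda>x y::'a. ennreal (heat_kernel \<delta> (x - y))"
  have "2 * (\<integral>\<^sup>+p. h (fst p) * h (snd p) * ?k (fst p) (snd p) \<partial>(lborel \<Otimes>\<^sub>M lborel))
      = (\<integral>\<^sup>+p. 2 * (h (fst p) * h (snd p)) * ?k (fst p) (snd p) \<partial>(lborel \<Otimes>\<^sub>M lborel))"
    by (subst nn_integral_cmult[symmetric]) (auto simp: mult_ac)
  also have "\<dots> \<le> (\<integral>\<^sup>+p. ((h (fst p))\<^sup>2 + (h (snd p))\<^sup>2) * ?k (fst p) (snd p) \<partial>(lborel \<Otimes>\<^sub>M lborel))"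
    by (intro nn_integral_mono mult_right_mono ennreal_AM_GM_1) auto
  also have "\<dots> = (\<integral>\<^sup>+p. (h (fst p))\<^sup>2 * ?k (fst p) (snd p) \<partial>(lborel \<Otimes>\<^sub>M lborel))
      + (\<integral>\<^sup>+p. (h (snd p))\<^sup>2 * ?k (fst p) (snd p) \<partial>(lborel \<Otimes>\<^sub>M lborel))"
    by (simp add: distrib_right nn_integral_add)
  also have "(\<integral>\<^sup>+p. (h (fst p))\<^sup>2 * ?k (fst p) (snd p) \<partial>(lborel \<Otimes>\<^sub>M lborel)) = (\<integral>\<^sup>+x. (h x)\<^sup>2 \<partial>lborel)"
    by (subst lborel.nn_integral_fst[symmetric])
      (simp_all add: nn_integral_cmult nn_integral_heat_kernel_shift \<delta>)
  also have "(\<integral>\<^sup>+p. (h (snd p))\<^sup>2 * ?k (fst p) (snd p) \<partial>(lborel \<Otimes>\<^sub>M lborel)) = (\<integral>\<^sup>+x. (h x)\<^sup>2 \<partial>lborel)"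
    by (subst lborel_pair.nn_integral_snd[symmetric])
      (simp_all add: nn_integral_cmult nn_integral_heat_kernel_shift \<delta>)
  also have "(\<integral>\<^sup>+x. (h x)\<^sup>2 \<partial>lborel) + (\<integral>\<^sup>+x. (h x)\<^sup>2 \<partial>lborel) = 2 * (\<integral>\<^sup>+x. (h x)\<^sup>2 \<partial>lborel)"
    by (simp add: mult_2)
  finally show ?thesis
    by (subst (asm) ennreal_mult_le_mult_iff) (auto simp: lborel_prod)
qed

text \<open>Expanding the square as a double integral and integrating the Gaussian weight first
  turns the left side into the quadratic form of \<open>H\<close> with the nonnegative kernel
  \<open>heat_kernel \<delta> (\<xi> - \<xi>')\<close>. The weight is there to make the triple integral absolutely convergent.\<close>

lemma ft_gaussian_L2_bound:
  fixes H :: "'a::euclidean_space \<Rightarrow> complex"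
  assumes H: "integrable lborel H" and \<delta>: "\<delta> > 0"
  shows "(\<integral>\<^sup>+x. ennreal ((norm (ft H x))\<^sup>2 * exp (- \<delta> * (norm x)\<^sup>2)) \<partial>lborel)
    \<le> (\<integral>\<^sup>+\<xi>. ennreal ((norm (H \<xi>))\<^sup>2) \<partial>lborel)"
proof -
  have [measurable]: "H \<in> borel_measurable borel"
    using borel_measurable_integrable[OF H] by simp
  define \<gamma> where "\<gamma> x = complex_of_real (exp (- \<delta> * (norm x)\<^sup>2))" for x :: 'a
  have [measurable]: "\<gamma> \<in> borel_measurable borel" unfolding \<gamma>_def by measurable
  have \<gamma>: "integrable lborel \<gamma>"
    unfolding \<gamma>_def by (rule integrable_gaussian[OF \<delta>])
  define T where "T p = H (fst p) * cnj (H (snd p))" for p :: "'a \<times> 'a"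
  have T: "integrable lborel T"
    unfolding T_def by (intro integrable_lborel_tensor) (simp_all add: H)
  have [measurable]: "T \<in> borel_measurable borel"
    using borel_measurable_integrable[OF T] by simp
  have T_wave: "T p * wave x (fst p - snd p) = H (fst p) * wave x (fst p) * cnj (H (snd p) * wave x (snd p))" for p x
    by (simp add: T_def wave_diff mult_ac)
  have sq: "(LINT p|lborel. T p * wave x (fst p - snd p)) = complex_of_real ((norm (ft H x))\<^sup>2)" for x
    unfolding T_wave complex_norm_square
    using integral_lborel_tensor[of "\<lambda>\<xi>. H \<xi> * wave x \<xi>" "\<lambda>\<xi>. cnj (H \<xi> * wave x \<xi>)"] H
    by (simp add: integrable_mult_wave ft_def[symmetric] del: complex_cnj_mult)
  define D where "D p = fst p - snd p" for p :: "'a \<times> 'a"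
  have [measurable]: "D \<in> borel_measurable borel"
    unfolding D_def by (intro borel_measurable_continuous_onI continuous_intros)
  have meas: "(\<lambda>(p, x). T p * wave x (D p) * \<gamma> x) \<in> borel_measurable (lborel \<Otimes>\<^sub>M lborel)"
    by measurable
  have int: "integrable (lborel \<Otimes>\<^sub>M lborel) (\<lambda>(p, x). T p * wave x (fst p - snd p) * \<gamma> x)"
  proof (rule Bochner_Integration.integrable_bound)
    show "integrable (lborel \<Otimes>\<^sub>M lborel) (\<lambda>q. T (fst q) * \<gamma> (snd q))"
      unfolding lborel_prod by (rule integrable_lborel_tensor[OF T \<gamma>])
  qed (use meas in \<open>auto simp: norm_mult D_def\<close>)
  have "(LINT x|lborel. complex_of_real ((norm (ft H x))\<^sup>2) * \<gamma> x)
      = (LINT x|lborel. LINT p|lborel. T p * wave x (fst p - snd p) * \<gamma> x)"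
    by (simp add: sq)
  also have "\<dots> = (LINT p|lborel. LINT x|lborel. T p * wave x (fst p - snd p) * \<gamma> x)"
    by (rule lborel_pair.Fubini_integral[OF int])
  also have "\<dots> = (LINT p|lborel. T p * heat_kernel \<delta> (fst p - snd p))"
    by (simp only: mult.assoc integral_mult_right_zero \<gamma>_def integral_gaussian_wave_swap[OF \<delta>])
  finally have main: "(LINT x|lborel. complex_of_real ((norm (ft H x))\<^sup>2) * \<gamma> x)
      = (LINT p|lborel. T p * heat_kernel \<delta> (fst p - snd p))" .
  have ft_int: "integrable lborel (\<lambda>x. complex_of_real ((norm (ft H x))\<^sup>2) * \<gamma> x)"
    using lborel_pair.integrable_snd[OF int] by (simp add: sq)
  have re: "complex_of_real ((norm (ft H x))\<^sup>2) * \<gamma> x = complex_of_real ((norm (ft H x))\<^sup>2 * exp (- \<delta> * (norm x)\<^sup>2))" for x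
    by (simp add: \<gamma>_def)
  have ft_int': "integrable lborel (\<lambda>x. (norm (ft H x))\<^sup>2 * exp (- \<delta> * (norm x)\<^sup>2))"
    using ft_int unfolding re complex_of_real_integrable_eq .
  have "(\<integral>\<^sup>+x. ennreal ((norm (ft H x))\<^sup>2 * exp (- \<delta> * (norm x)\<^sup>2)) \<partial>lborel)
      = ennreal (LINT x|lborel. (norm (ft H x))\<^sup>2 * exp (- \<delta> * (norm x)\<^sup>2))"
    by (rule nn_integral_eq_integral[OF ft_int']) auto
  also have "\<dots> = ennreal (norm (LINT x|lborel. complex_of_real ((norm (ft H x))\<^sup>2) * \<gamma> x))"
    unfolding re integral_complex_of_real norm_of_real
    by (subst abs_of_nonneg) (auto intro: integral_nonneg)
  also have "\<dots> \<le> (\<integral>\<^sup>+p. ennreal (norm (T p * heat_kernel \<delta> (fst p - snd p))) \<partial>lborel)"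
    unfolding main by (cases "integrable lborel (\<lambda>p. T p * heat_kernel \<delta> (fst p - snd p))")
      (auto intro: integral_norm_bound_ennreal simp: not_integrable_integral_eq)
  also have "\<dots> = (\<integral>\<^sup>+p. ennreal (norm (H (fst p))) * ennreal (norm (H (snd p)))
      * ennreal (heat_kernel \<delta> (fst p - snd p)) \<partial>lborel)"
    by (simp add: T_def norm_mult heat_kernel_nonneg[OF \<delta>] ennreal_mult)
  also have "\<dots> \<le> (\<integral>\<^sup>+\<xi>. (ennreal (norm (H \<xi>)))\<^sup>2 \<partial>lborel)"
    by (rule schur_heat_kernel[OF _ \<delta>]) measurable
  finally show ?thesis by (simp add: ennreal_power)
qed

theorem plancherel_le:
  fixes H :: "'a::euclidean_space \<Rightarrow> complex"
  assumes H: "integrable lborel H"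
  shows "(\<integral>\<^sup>+x. ennreal ((norm (ft H x))\<^sup>2) \<partial>lborel) \<le> (\<integral>\<^sup>+\<xi>. ennreal ((norm (H \<xi>))\<^sup>2) \<partial>lborel)"
proof -
  have [measurable]: "H \<in> borel_measurable borel"
    using borel_measurable_integrable[OF H] by simp
  define F where "F n x = ennreal ((norm (ft H x))\<^sup>2 * exp (- (1 / real (Suc n)) * (norm x)\<^sup>2))" for n x
  have lim: "(\<lambda>n. F n x) \<longlonglongrightarrow> ennreal ((norm (ft H x))\<^sup>2)" for x
  proof -
    have "(\<lambda>n. (norm (ft H x))\<^sup>2 * exp (- (1 / real (Suc n)) * (norm x)\<^sup>2)) \<longlonglongrightarrow> (norm (ft H x))\<^sup>2 * exp (- 0 * (norm x)\<^sup>2)"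
      by (intro tendsto_intros LIMSEQ_Suc[OF lim_1_over_n])
    then show ?thesis unfolding F_def by (intro tendsto_ennrealI) simp
  qed
  have "(\<integral>\<^sup>+x. ennreal ((norm (ft H x))\<^sup>2) \<partial>lborel) = (\<integral>\<^sup>+x. liminf (\<lambda>n. F n x) \<partial>lborel)"
    by (intro nn_integral_cong lim_imp_Liminf[OF sequentially_bot lim, symmetric])
  also have "\<dots> \<le> liminf (\<lambda>n. \<integral>\<^sup>+x. F n x \<partial>lborel)"
    unfolding F_def by (intro nn_integral_liminf) measurable
  also have "\<dots> \<le> liminf (\<lambda>n::nat. \<integral>\<^sup>+\<xi>. ennreal ((norm (H \<xi>))\<^sup>2) \<partial>lborel)"
    unfolding F_def by (intro Liminf_mono always_eventually allI ft_gaussian_L2_bound[OF H]) simp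
  finally show ?thesis by (simp add: Liminf_const)
qed

section \<open>The heat maximal function\<close>

lemma exists_dyadic_scale:
  fixes \<tau> :: real
  assumes "\<tau> > 0"
  obtains i N :: nat where "\<tau> \<le> 2 ^ i / 2 ^ N" "2 ^ i / 2 ^ N \<le> 2 * \<tau>"
proof -
  obtain N :: nat where "1 / \<tau> < 2 ^ N" using real_arch_pow[of 2 "1 / \<tau>"] by auto
  then have N: "1 < 2 ^ N * \<tau>" using assms by (simp add: field_simps)
  have ex: "\<exists>i. 2 ^ N * \<tau> \<le> 2 ^ i" using real_arch_pow[of 2 "2 ^ N * \<tau>"] by (auto intro: less_imp_le)
  define i where "i = (LEAST i. 2 ^ N * \<tau> \<le> 2 ^ i)"
  have i: "2 ^ N * \<tau> \<le> 2 ^ i" unfolding i_def by (rule LeastI_ex[OF ex])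
  then have "i \<noteq> 0" using N by (metis not_le power_0)
  then obtain l where l: "i = Suc l" using not0_implies_Suc by blast
  have "2 ^ l < 2 ^ N * \<tau>"
    using not_less_Least[of l "\<lambda>i. 2 ^ N * \<tau> \<le> 2 ^ i"] l unfolding i_def[symmetric] by simp
  then have "2 ^ i \<le> 2 * (2 ^ N * \<tau>)" by (simp add: l)
  with i show ?thesis by (intro that[of i N]) (simp_all add: field_simps)
qed

definition heat_avg :: "real \<Rightarrow> ('a::euclidean_space \<Rightarrow> ennreal) \<Rightarrow> 'a \<Rightarrow> ennreal" where
  "heat_avg \<tau> h x = (\<integral>\<^sup>+y. ennreal (heat_kernel \<tau> (x - y)) * h y \<partial>lborel)"

text \<open>The square of the supremum of the heat averages over all times \<open>2\<^sup>k\<close>, \<open>k\<close> an integer. It is written with the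
  two indices \<open>i - N = k\<close> because \<open>maximal_inequality\<close> concerns sequences of times with a first
  element; the inner supremum increases with \<open>N\<close>.\<close>

definition heat_max_sq :: "('a::euclidean_space \<Rightarrow> ennreal) \<Rightarrow> 'a \<Rightarrow> ennreal" where
  "heat_max_sq h x = (SUP N::nat. SUP i::nat. (heat_avg (2 ^ i / 2 ^ N) h x)\<^sup>2)"

lemma heat_avg_measurable [measurable]:
  assumes [measurable]: "h \<in> borel_measurable borel"
  shows "heat_avg \<tau> h \<in> borel_measurable borel"
  unfolding heat_avg_def[abs_def] by measurable

lemma heat_max_sq_measurable [measurable]:
  assumes [measurable]: "h \<in> borel_measurable borel"
  shows "heat_max_sq h \<in> borel_measurable borel"
  unfolding heat_max_sq_def[abs_def] by measurable

lemma heat_maximal_inequality_scaled: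
  fixes h :: "'a::euclidean_space \<Rightarrow> ennreal"
  assumes h: "h \<in> borel_measurable borel" and c: "c > 0"
  shows "(\<integral>\<^sup>+x. (SUP i::nat. (heat_avg (2 ^ i * c) h x)\<^sup>2) \<partial>lborel)
    \<le> ennreal (4 * (sqrt 2 ^ DIM('a))\<^sup>2 + 1) * (\<integral>\<^sup>+x. (h x)\<^sup>2 \<partial>lborel)"
proof -
  interpret symmetric_contraction_kernels lborel
    "\<lambda>i x y::'a. ennreal (heat_kernel (2 ^ i * c) (x - y))" "sqrt 2 ^ DIM('a)"
  proof unfold_locales
    fix j k :: nat and x y :: 'a
    assume jk: "j \<le> k"
    have pos: "2 ^ i * c > 0" for i :: nat using c by simp
    have "(\<integral>\<^sup>+z. ennreal (heat_kernel (2 ^ j * c) (x - z)) * ennreal (heat_kernel (2 ^ k * c) (z - y)) \<partial>lborel)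
        = ennreal (heat_kernel (2 ^ j * c + 2 ^ k * c) (x - y))"
      by (rule heat_kernel_semigroup[OF pos pos])
    also have "\<dots> \<le> ennreal (sqrt 2 ^ DIM('a) * heat_kernel (2 ^ Suc k * c) (x - y))"
    proof (intro ennreal_leI heat_kernel_le)
      have "(2::real) ^ j * c \<le> 2 ^ k * c"
        using c jk by (intro mult_right_mono power_increasing) auto
      then show "2 ^ j * c + 2 ^ k * c \<le> 2 ^ Suc k * c" by (simp add: mult.commute)
      show "2 ^ Suc k * c \<le> 2 * (2 ^ j * c + 2 ^ k * c)" using pos[of j] by simp
      show "0 < 2 ^ j * c + 2 ^ k * c" using pos[of j] pos[of k] by simp
    qed
    also have "\<dots> = ennreal (sqrt 2 ^ DIM('a)) * ennreal (heat_kernel (2 ^ Suc k * c) (x - y))"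
      by (intro ennreal_mult heat_kernel_nonneg[OF pos]) simp
    finally show "(\<integral>\<^sup>+z. ennreal (heat_kernel (2 ^ j * c) (x - z)) * ennreal (heat_kernel (2 ^ k * c) (z - y)) \<partial>lborel)
        \<le> ennreal (sqrt 2 ^ DIM('a)) * ennreal (heat_kernel (2 ^ Suc k * c) (x - y))" .
  next
    fix i and x :: 'a
    show "(\<integral>\<^sup>+y. ennreal (heat_kernel (2 ^ i * c) (x - y)) \<partial>lborel) \<le> 1"
      using c by (subst nn_integral_heat_kernel_shift) auto
  next
    fix i and x y :: 'a
    show "ennreal (heat_kernel (2 ^ i * c) (x - y)) = ennreal (heat_kernel (2 ^ i * c) (y - x))"
      by (simp only: heat_kernel_commute)
  qed simp_all
  show ?thesis
    using maximal_inequality[of h] h by (simp add: avg_def heat_avg_def)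
qed

lemma heat_maximal_inequality:
  fixes h :: "'a::euclidean_space \<Rightarrow> ennreal"
  assumes h [measurable]: "h \<in> borel_measurable borel"
  shows "(\<integral>\<^sup>+x. heat_max_sq h x \<partial>lborel)
    \<le> ennreal (4 * (sqrt 2 ^ DIM('a))\<^sup>2 + 1) * (\<integral>\<^sup>+x. (h x)\<^sup>2 \<partial>lborel)"
proof -
  have "(\<integral>\<^sup>+x. heat_max_sq h x \<partial>lborel)
      = (SUP N::nat. \<integral>\<^sup>+x. (SUP i::nat. (heat_avg (2 ^ i / 2 ^ N) h x)\<^sup>2) \<partial>lborel)"
    unfolding heat_max_sq_def
  proof (rule nn_integral_monotone_convergence_SUP)
    show "incseq (\<lambda>N x. SUP i::nat. (heat_avg (2 ^ i / 2 ^ N) h x)\<^sup>2)"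
    proof (rule incseq_SucI, rule le_funI, rule SUP_mono)
      fix N i :: nat and x :: 'a
      have "(2::real) ^ i / 2 ^ N = 2 ^ Suc i / 2 ^ Suc N" by simp
      then show "\<exists>m\<in>UNIV. (heat_avg (2 ^ i / 2 ^ N) h x)\<^sup>2 \<le> (heat_avg (2 ^ m / 2 ^ Suc N) h x)\<^sup>2"
        by (metis UNIV_I order_refl)
    qed
  qed measurable
  also have "\<dots> \<le> ennreal (4 * (sqrt 2 ^ DIM('a))\<^sup>2 + 1) * (\<integral>\<^sup>+x. (h x)\<^sup>2 \<partial>lborel)"
    using heat_maximal_inequality_scaled[OF h, of "1 / 2 ^ _"]
    by (intro SUP_least) simp
  finally show ?thesis .
qed

lemma heat_avg_sq_le_heat_max_sq:
  fixes h :: "'a::euclidean_space \<Rightarrow> ennreal"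
  assumes [measurable]: "h \<in> borel_measurable borel" and \<tau>: "\<tau> > 0"
  shows "(heat_avg \<tau> h x)\<^sup>2 \<le> ennreal ((sqrt 2 ^ DIM('a))\<^sup>2) * heat_max_sq h x"
proof -
  obtain i N :: nat where iN: "\<tau> \<le> 2 ^ i / 2 ^ N" "2 ^ i / 2 ^ N \<le> 2 * \<tau>"
    using exists_dyadic_scale[OF \<tau>] .
  let ?t = "2 ^ i / 2 ^ N :: real" and ?c = "sqrt 2 ^ DIM('a)"
  have t: "?t > 0" by simp
  have "heat_avg \<tau> h x \<le> (\<integral>\<^sup>+y. (ennreal ?c * ennreal (heat_kernel ?t (x - y))) * h y \<partial>lborel)"
    unfolding heat_avg_def
    by (intro nn_integral_mono mult_right_mono)
      (auto simp: ennreal_mult[symmetric] heat_kernel_nonneg intro!: ennreal_leI heat_kernel_le \<tau> iN)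
  also have "\<dots> = ennreal ?c * heat_avg ?t h x"
    unfolding heat_avg_def by (subst nn_integral_cmult[symmetric]) (auto simp: mult_ac)
  finally have "(heat_avg \<tau> h x)\<^sup>2 \<le> (ennreal ?c * heat_avg ?t h x)\<^sup>2"
    by (intro power_mono) auto
  also have "\<dots> = ennreal (?c\<^sup>2) * (heat_avg ?t h x)\<^sup>2"
    by (simp add: power_mult_distrib ennreal_power)
  also have "\<dots> \<le> ennreal (?c\<^sup>2) * heat_max_sq h x"
    unfolding heat_max_sq_def by (intro mult_left_mono SUP_upper2[of N] SUP_upper2[of i]) auto
  finally show ?thesis .
qed

text \<open>Fubini's theorem makes a multiplier with integrable symbol a convolution with \<open>f\<close>, the
  kernel being the inverse transform of the symbol.\<close>

lemma ft_heat_multiplier: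
  fixes f :: "'a::euclidean_space \<Rightarrow> complex"
  assumes f: "integrable lborel f" and \<tau>: "\<tau> > 0"
  shows "ft (\<lambda>\<xi>. complex_of_real (exp (- \<tau> * (norm \<xi>)\<^sup>2)) * ft f (- \<xi>)) x
    = (LINT y|lborel. f y * complex_of_real (heat_kernel \<tau> (x - y)))"
proof -
  have [measurable]: "f \<in> borel_measurable borel"
    using borel_measurable_integrable[OF f] by simp
  define \<gamma> where "\<gamma> \<xi> = complex_of_real (exp (- \<tau> * (norm \<xi>)\<^sup>2))" for \<xi> :: 'a
  have [measurable]: "\<gamma> \<in> borel_measurable borel" unfolding \<gamma>_def by measurable
  have \<gamma>: "integrable lborel \<gamma>"
    unfolding \<gamma>_def by (rule integrable_gaussian[OF \<tau>])
  have w: "wave (x - y) \<xi> = wave (- \<xi>) y * wave x \<xi>" for y \<xi>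
    by (simp add: wave_def cis_mult inner_diff_left inner_commute algebra_simps)
  have int: "integrable (lborel \<Otimes>\<^sub>M lborel) (\<lambda>(y, \<xi>). f y * (\<gamma> \<xi> * wave (x - y) \<xi>))"
  proof (rule Bochner_Integration.integrable_bound)
    show "integrable (lborel \<Otimes>\<^sub>M lborel) (\<lambda>q. f (fst q) * \<gamma> (snd q))"
      unfolding lborel_prod by (rule integrable_lborel_tensor[OF f \<gamma>])
  qed (auto simp: norm_mult)
  have "ft (\<lambda>\<xi>. \<gamma> \<xi> * ft f (- \<xi>)) x = (LINT \<xi>|lborel. LINT y|lborel. f y * (\<gamma> \<xi> * wave (x - y) \<xi>))"
    unfolding ft_def
    by (intro Bochner_Integration.integral_cong refl)
      (simp add: w integral_mult_left_zero[symmetric] integral_mult_right_zero[symmetric] mult_ac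
        del: integral_mult_left_zero integral_mult_right_zero)
  also have "\<dots> = (LINT y|lborel. LINT \<xi>|lborel. f y * (\<gamma> \<xi> * wave (x - y) \<xi>))"
    by (rule lborel_pair.Fubini_integral[OF int])
  also have "\<dots> = (LINT y|lborel. f y * complex_of_real (heat_kernel \<tau> (x - y)))"
    by (simp only: integral_mult_right_zero \<gamma>_def integral_gaussian_wave[OF \<tau>])
  finally show ?thesis by (simp add: \<gamma>_def)
qed

lemma norm_ft_heat_multiplier_sq_le:
  fixes f :: "'a::euclidean_space \<Rightarrow> complex"
  assumes f: "integrable lborel f" and \<tau>: "\<tau> > 0"
  shows "ennreal ((norm (ft (\<lambda>\<xi>. complex_of_real (exp (- \<tau> * (norm \<xi>)\<^sup>2)) * ft f (- \<xi>)) x))\<^sup>2)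
    \<le> ennreal ((sqrt 2 ^ DIM('a))\<^sup>2) * heat_max_sq (\<lambda>y. ennreal (norm (f y))) x"
proof -
  have [measurable]: "f \<in> borel_measurable borel"
    using borel_measurable_integrable[OF f] by simp
  let ?g = "\<lambda>y. f y * complex_of_real (heat_kernel \<tau> (x - y))"
  have "ennreal (norm (LINT y|lborel. ?g y)) \<le> (\<integral>\<^sup>+y. ennreal (norm (?g y)) \<partial>lborel)"
    by (cases "integrable lborel ?g") (auto intro: integral_norm_bound_ennreal simp: not_integrable_integral_eq)
  also have "\<dots> = heat_avg \<tau> (\<lambda>y. ennreal (norm (f y))) x"
    unfolding heat_avg_def
    by (simp add: norm_mult heat_kernel_nonneg[OF \<tau>] ennreal_mult mult.commute)
  finally have "(ennreal (norm (LINT y|lborel. ?g y)))\<^sup>2 \<le> (heat_avg \<tau> (\<lambda>y. ennreal (norm (f y))) x)\<^sup>2"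
    by (intro power_mono) auto
  also have "\<dots> \<le> ennreal ((sqrt 2 ^ DIM('a))\<^sup>2) * heat_max_sq (\<lambda>y. ennreal (norm (f y))) x"
    by (rule heat_avg_sq_le_heat_max_sq[OF _ \<tau>]) measurable
  finally show ?thesis
    unfolding ft_heat_multiplier[OF f \<tau>] by (simp add: ennreal_power)
qed

section \<open>The square function and the control of ball multipliers\<close>

definition ball_mult :: "real \<Rightarrow> ('a::euclidean_space \<Rightarrow> complex) \<Rightarrow> 'a \<Rightarrow> complex" where
  "ball_mult t F x = ft (\<lambda>\<xi>. (if (norm \<xi>)\<^sup>2 \<le> t then 1 else 0) * F \<xi>) x"

text \<open>The parameter is normalized so that the symbol, like that of \<open>ball_mult t\<close>, is close to one for
  \<open>|\<xi>|\<^sup>2\<close> much smaller than \<open>t\<close> and close to zero for \<open>|\<xi>|\<^sup>2\<close> much larger than \<open>t\<close>.\<close>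

definition heat_mult :: "real \<Rightarrow> ('a::euclidean_space \<Rightarrow> complex) \<Rightarrow> 'a \<Rightarrow> complex" where
  "heat_mult t F x = ft (\<lambda>\<xi>. complex_of_real (exp (- (1 / t) * (norm \<xi>)\<^sup>2)) * F \<xi>) x"

lemma ball_mult_measurable [measurable]:
  assumes [measurable]: "F \<in> borel_measurable borel" "u \<in> borel_measurable N" "v \<in> borel_measurable N"
  shows "(\<lambda>p. ball_mult (u p) F (v p)) \<in> borel_measurable N"
  unfolding ball_mult_def ft_def by measurable

lemma heat_mult_measurable [measurable]:
  assumes [measurable]: "F \<in> borel_measurable borel" "u \<in> borel_measurable N" "v \<in> borel_measurable N"
  shows "(\<lambda>p. heat_mult (u p) F (v p)) \<in> borel_measurable N"
  unfolding heat_mult_def ft_def by measurable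

definition square_fun :: "('a::euclidean_space \<Rightarrow> complex) \<Rightarrow> 'a \<Rightarrow> ennreal" where
  "square_fun F x = (\<integral>\<^sup>+t\<in>{0<..}. ennreal ((norm (ball_mult t F x - heat_mult t F x))\<^sup>2 / t) \<partial>lborel)"

lemma square_fun_measurable [measurable]:
  assumes [measurable]: "F \<in> borel_measurable borel"
  shows "square_fun F \<in> borel_measurable borel"
  unfolding square_fun_def[abs_def] by measurable

text \<open>For \<open>t < a\<close> the integrand is \<open>exp (-a/t)\<^sup>2 / t \<le> (t/a)\<^sup>2 / t\<close>, for \<open>t \<ge> a\<close> it is
  \<open>(1 - exp (-a/t))\<^sup>2 / t \<le> (a/t)\<^sup>2 / t\<close>. Each range contributes at most \<open>1/2\<close>.\<close>

lemma nn_integral_symbol_difference: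
  fixes a :: real
  assumes "a \<ge> 0"
  shows "(\<integral>\<^sup>+t\<in>{0<..}. ennreal (((if a \<le> t then 1 else 0) - exp (- (1 / t) * a))\<^sup>2 / t) \<partial>lborel) \<le> 1"
proof (cases "a = 0")
  case True
  then have "(\<integral>\<^sup>+t\<in>{0<..}. ennreal (((if a \<le> t then 1 else 0) - exp (- (1 / t) * a))\<^sup>2 / t) \<partial>lborel) = (\<integral>\<^sup>+(t::real). 0 \<partial>lborel)"
    by (intro nn_integral_cong) (auto split: split_indicator)
  then show ?thesis by simp
next
  case False
  then have a: "a > 0" using assms by simp
  let ?D = "\<lambda>t. ennreal (((if a \<le> t then 1 else 0) - exp (- (1 / t) * a))\<^sup>2 / t)"
  have small: "?D t \<le> ennreal (t / a\<^sup>2)" if "0 < t" "t < a" for t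
  proof -
    have "exp (- (1 / t) * a) \<le> t / a"
    proof -
      have "a / t \<le> exp (a / t)" using exp_ge_add_one_self[of "a / t"] by linarith
      then have "inverse (exp (a / t)) \<le> inverse (a / t)"
        using a that by (intro le_imp_inverse_le) auto
      then show ?thesis by (simp add: exp_minus)
    qed
    then have "(exp (- (1 / t) * a))\<^sup>2 \<le> (t / a)\<^sup>2" by (intro power_mono) auto
    then have "(exp (- (1 / t) * a))\<^sup>2 / t \<le> (t / a)\<^sup>2 / t" using that by (intro divide_right_mono) auto
    also have "(t / a)\<^sup>2 / t = t / a\<^sup>2" using that by (simp add: power2_eq_square)
    finally show ?thesis using that by (intro ennreal_leI) simp
  qed
  have large: "?D t \<le> ennreal (a\<^sup>2 / t ^ 3)" if "a \<le> t" for t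
  proof -
    have t: "t > 0" using a that by simp
    have "0 \<le> 1 - exp (- (1 / t) * a)" using a t by simp
    moreover have "1 - exp (- (1 / t) * a) \<le> a / t"
      using exp_ge_add_one_self[of "- (1 / t) * a"] by simp
    ultimately have "(1 - exp (- (1 / t) * a))\<^sup>2 \<le> (a / t)\<^sup>2" by (intro power_mono)
    then have "(1 - exp (- (1 / t) * a))\<^sup>2 / t \<le> (a / t)\<^sup>2 / t" using t by (intro divide_right_mono) auto
    also have "(a / t)\<^sup>2 / t = a\<^sup>2 / t ^ 3" by (simp add: power2_eq_square power3_eq_cube)
    finally show ?thesis using that by (intro ennreal_leI) simp
  qed
  have "(\<integral>\<^sup>+t\<in>{0<..}. ?D t \<partial>lborel)
      \<le> (\<integral>\<^sup>+t. ennreal (t / a\<^sup>2) * indicator {0..a} t + ennreal (a\<^sup>2 / t ^ 3) * indicator {a..} t \<partial>lborel)"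
  proof (intro nn_integral_mono)
    fix t :: real
    show "?D t * indicator {0<..} t \<le> ennreal (t / a\<^sup>2) * indicator {0..a} t + ennreal (a\<^sup>2 / t ^ 3) * indicator {a..} t"
    proof (cases "0 < t")
      case True
      show ?thesis
      proof (cases "t < a")
        case True
        then show ?thesis using small[of t] \<open>0 < t\<close> by simp
      next
        case False
        then have "?D t \<le> ennreal (a\<^sup>2 / t ^ 3) * indicator {a..} t" using large[of t] by simp
        then show ?thesis using \<open>0 < t\<close> by (simp add: add_increasing)
      qed
    qed simp
  qed
  also have "\<dots> = (\<integral>\<^sup>+t. ennreal (t / a\<^sup>2) * indicator {0..a} t \<partial>lborel) + (\<integral>\<^sup>+t. ennreal (a\<^sup>2 / t ^ 3) * indicator {a..} t \<partial>lborel)"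
    by (rule nn_integral_add) measurable
  also have "(\<integral>\<^sup>+t. ennreal (t / a\<^sup>2) * indicator {0..a} t \<partial>lborel) = ennreal (a\<^sup>2 / (2 * a\<^sup>2) - 0\<^sup>2 / (2 * a\<^sup>2))"
    using a by (intro nn_integral_FTC_Icc[where F="\<lambda>t. t\<^sup>2 / (2 * a\<^sup>2)"])
      (auto intro!: derivative_eq_intros simp: field_simps power2_eq_square)
  also have "(\<integral>\<^sup>+t. ennreal (a\<^sup>2 / t ^ 3) * indicator {a..} t \<partial>lborel) = ennreal (0 - (- (a\<^sup>2 / (2 * a\<^sup>2))))"
  proof (rule nn_integral_FTC_atLeast[where F="\<lambda>t. - (a\<^sup>2 / (2 * t\<^sup>2))"])
    show "((\<lambda>t. - (a\<^sup>2 / (2 * t\<^sup>2))) \<longlongrightarrow> 0) at_top" by real_asymp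
    fix t assume "a \<le> t"
    then have "t > 0" using a by simp
    then show "((\<lambda>t. - (a\<^sup>2 / (2 * t\<^sup>2))) has_real_derivative a\<^sup>2 / t ^ 3) (at t)"
      by (auto intro!: derivative_eq_intros simp: field_simps power2_eq_square power3_eq_cube)
  qed (use a in auto)
  also have "ennreal (a\<^sup>2 / (2 * a\<^sup>2) - 0\<^sup>2 / (2 * a\<^sup>2)) + ennreal (0 - (- (a\<^sup>2 / (2 * a\<^sup>2)))) = 1"
    using a by (subst ennreal_plus[symmetric]) auto
  finally show ?thesis .
qed

text \<open>Plancherel in \<open>x\<close> for each fixed \<open>t\<close>, then integration of the symbol in \<open>t\<close> for each fixed \<open>\<xi>\<close>.\<close>

lemma square_fun_L1:
  fixes F :: "'a::euclidean_space \<Rightarrow> complex"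
  assumes F: "integrable lborel F"
  shows "(\<integral>\<^sup>+x. square_fun F x \<partial>lborel) \<le> (\<integral>\<^sup>+\<xi>. ennreal ((norm (F \<xi>))\<^sup>2) \<partial>lborel)"
proof -
  have [measurable]: "F \<in> borel_measurable borel"
    using borel_measurable_integrable[OF F] by simp
  define d where "d t \<xi> = (if (norm \<xi>)\<^sup>2 \<le> t then 1 else 0) - exp (- (1 / t) * (norm \<xi>)\<^sup>2)" for t and \<xi> :: 'a
  have [measurable]: "(\<lambda>p. d (fst p) (snd p)) \<in> borel_measurable (lborel \<Otimes>\<^sub>M lborel)"
    unfolding d_def by measurable
  have plancherel: "(\<integral>\<^sup>+x. ennreal ((norm (ball_mult t F x - heat_mult t F x))\<^sup>2 / t) \<partial>lborel)
      \<le> (\<integral>\<^sup>+\<xi>. ennreal ((d t \<xi>)\<^sup>2 / t) * ennreal ((norm (F \<xi>))\<^sup>2) \<partial>lborel)" if t: "t > 0" for t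
  proof -
    have i1: "integrable lborel (\<lambda>\<xi>. (if (norm \<xi>)\<^sup>2 \<le> t then 1 else 0) * F \<xi>)"
      by (rule Bochner_Integration.integrable_bound[OF F]) auto
    have i2: "integrable lborel (\<lambda>\<xi>. complex_of_real (exp (- (1 / t) * (norm \<xi>)\<^sup>2)) * F \<xi>)"
      using t by (intro Bochner_Integration.integrable_bound[OF F]) (auto simp: norm_mult mult_left_le_one_le)
    have eq: "complex_of_real (d t \<xi>) * F \<xi> = (if (norm \<xi>)\<^sup>2 \<le> t then 1 else 0) * F \<xi>
        - complex_of_real (exp (- (1 / t) * (norm \<xi>)\<^sup>2)) * F \<xi>" for \<xi>
      by (simp add: d_def algebra_simps)
    have i3: "integrable lborel (\<lambda>\<xi>. complex_of_real (d t \<xi>) * F \<xi>)"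
      unfolding eq using i1 i2 by (rule Bochner_Integration.integrable_diff)
    have "ball_mult t F x - heat_mult t F x = ft (\<lambda>\<xi>. complex_of_real (d t \<xi>) * F \<xi>) x" for x
      unfolding ball_mult_def heat_mult_def ft_def eq left_diff_distrib
      by (rule Bochner_Integration.integral_diff[symmetric]; rule integrable_mult_wave; rule i1 i2)
    then have "(\<integral>\<^sup>+x. ennreal ((norm (ball_mult t F x - heat_mult t F x))\<^sup>2 / t) \<partial>lborel)
        = (\<integral>\<^sup>+x. ennreal (1 / t) * ennreal ((norm (ft (\<lambda>\<xi>. complex_of_real (d t \<xi>) * F \<xi>) x))\<^sup>2) \<partial>lborel)"
      using t by (simp add: ennreal_mult[symmetric])
    also have "\<dots> = ennreal (1 / t) * (\<integral>\<^sup>+x. ennreal ((norm (ft (\<lambda>\<xi>. complex_of_real (d t \<xi>) * F \<xi>) x))\<^sup>2) \<partial>lborel)"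
      using borel_measurable_integrable[OF i3] by (intro nn_integral_cmult) simp
    also have "\<dots> \<le> ennreal (1 / t) * (\<integral>\<^sup>+\<xi>. ennreal ((norm (complex_of_real (d t \<xi>) * F \<xi>))\<^sup>2) \<partial>lborel)"
      by (intro mult_left_mono plancherel_le[OF i3]) simp
    also have "\<dots> = (\<integral>\<^sup>+\<xi>. ennreal (1 / t) * ennreal ((norm (complex_of_real (d t \<xi>) * F \<xi>))\<^sup>2) \<partial>lborel)"
      by (intro nn_integral_cmult[symmetric]) (simp add: d_def)
    also have "\<dots> = (\<integral>\<^sup>+\<xi>. ennreal ((d t \<xi>)\<^sup>2 / t) * ennreal ((norm (F \<xi>))\<^sup>2) \<partial>lborel)"
      using t by (simp add: ennreal_mult[symmetric] norm_mult power_mult_distrib)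
    finally show ?thesis .
  qed
  have "(\<integral>\<^sup>+x. square_fun F x \<partial>lborel)
      = (\<integral>\<^sup>+t. (\<integral>\<^sup>+x. ennreal ((norm (ball_mult t F x - heat_mult t F x))\<^sup>2 / t) * indicator {0<..} t \<partial>lborel) \<partial>lborel)"
    unfolding square_fun_def by (rule lborel_pair.Fubini') measurable
  also have "\<dots> = (\<integral>\<^sup>+t. (\<integral>\<^sup>+x. ennreal ((norm (ball_mult t F x - heat_mult t F x))\<^sup>2 / t) \<partial>lborel) * indicator {0<..} t \<partial>lborel)"
    by (intro nn_integral_cong nn_integral_multc) measurable
  also have "\<dots> \<le> (\<integral>\<^sup>+t. (\<integral>\<^sup>+\<xi>. ennreal ((d t \<xi>)\<^sup>2 / t) * ennreal ((norm (F \<xi>))\<^sup>2) \<partial>lborel) * indicator {0<..} t \<partial>lborel)"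
    by (intro nn_integral_mono) (auto split: split_indicator intro!: plancherel)
  also have "\<dots> = (\<integral>\<^sup>+t. (\<integral>\<^sup>+\<xi>. ennreal ((d t \<xi>)\<^sup>2 / t) * indicator {0<..} t * ennreal ((norm (F \<xi>))\<^sup>2) \<partial>lborel) \<partial>lborel)"
    by (intro nn_integral_cong, subst nn_integral_multc[symmetric]) (auto simp: mult_ac d_def)
  also have "\<dots> = (\<integral>\<^sup>+\<xi>. (\<integral>\<^sup>+t. ennreal ((d t \<xi>)\<^sup>2 / t) * indicator {0<..} t * ennreal ((norm (F \<xi>))\<^sup>2) \<partial>lborel) \<partial>lborel)"
    unfolding d_def by (rule lborel_pair.Fubini') measurable
  also have "\<dots> = (\<integral>\<^sup>+\<xi>. (\<integral>\<^sup>+t\<in>{0<..}. ennreal ((d t \<xi>)\<^sup>2 / t) \<partial>lborel) * ennreal ((norm (F \<xi>))\<^sup>2) \<partial>lborel)"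
    unfolding d_def by (intro nn_integral_cong nn_integral_multc) measurable
  also have "\<dots> \<le> (\<integral>\<^sup>+\<xi>. 1 * ennreal ((norm (F \<xi>))\<^sup>2) \<partial>lborel)"
    unfolding d_def by (intro nn_integral_mono mult_right_mono nn_integral_symbol_difference) auto
  finally show ?thesis by simp
qed

lemma square_fun_dilation:
  fixes F :: "'a::euclidean_space \<Rightarrow> complex"
  assumes [measurable]: "F \<in> borel_measurable borel" and \<sigma>: "\<sigma> > 0"
  shows "(\<integral>\<^sup>+t\<in>{0<..}. ennreal ((norm (ball_mult (t / \<sigma>) F x - heat_mult (t / \<sigma>) F x))\<^sup>2 / t) \<partial>lborel) = square_fun F x"
proof -
  let ?g = "\<lambda>t. (norm (ball_mult t F x - heat_mult t F x))\<^sup>2"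
  have "(\<integral>\<^sup>+t\<in>{0<..}. ennreal (?g (t / \<sigma>) / t) \<partial>lborel)
      = ennreal \<bar>\<sigma>\<bar> * (\<integral>\<^sup>+t. ennreal (?g ((0 + \<sigma> * t) / \<sigma>) / (0 + \<sigma> * t)) * indicator {0<..} (0 + \<sigma> * t) \<partial>lborel)"
    using \<sigma> by (intro nn_integral_real_affine) auto
  also have "\<dots> = (\<integral>\<^sup>+t. ennreal \<sigma> * (ennreal (?g ((0 + \<sigma> * t) / \<sigma>) / (0 + \<sigma> * t)) * indicator {0<..} (0 + \<sigma> * t)) \<partial>lborel)"
    using \<sigma> by (subst nn_integral_cmult) auto
  also have "\<dots> = square_fun F x"
    unfolding square_fun_def
    by (intro nn_integral_cong)
      (use \<sigma> in \<open>auto split: split_indicator simp: ennreal_mult[symmetric] zero_less_mult_iff\<close>)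
  finally show ?thesis .
qed

text \<open>The majorant, uniform in the length \<open>u\<close> and the dilation \<open>\<sigma>\<close>, of the averages in
  \<open>ball_mult_mean_square_le\<close>.\<close>

definition control :: "('a::euclidean_space \<Rightarrow> complex) \<Rightarrow> 'a \<Rightarrow> ennreal" where
  "control f x = 2 * square_fun (\<lambda>\<xi>. ft f (- \<xi>)) x
     + 2 * (ennreal ((sqrt 2 ^ DIM('a))\<^sup>2) * heat_max_sq (\<lambda>y. ennreal (norm (f y))) x)"

lemma control_measurable [measurable]:
  assumes [measurable]: "f \<in> borel_measurable borel"
  shows "control f \<in> borel_measurable borel"
  unfolding control_def[abs_def] by measurable

text \<open>Split \<open>S\<^sub>t = (S\<^sub>t - P\<^sub>t) + P\<^sub>t\<close>; on the range of integration \<open>1 \<le> u / t\<close>, which brings in the measure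
  \<open>dt/t\<close> of the square function.\<close>

lemma ball_mult_mean_square_le:
  fixes f :: "'a::euclidean_space \<Rightarrow> complex"
  assumes f: "integrable lborel f" and \<sigma>: "\<sigma> > 0" and u: "u \<ge> 0"
  shows "(\<integral>\<^sup>+t\<in>{0<..<u}. ennreal ((norm (ball_mult (t / \<sigma>) (\<lambda>\<xi>. ft f (- \<xi>)) x))\<^sup>2) \<partial>lborel)
    \<le> ennreal u * control f x"
proof -
  define F where "F = (\<lambda>\<xi>. ft f (- \<xi>))"
  have [measurable]: "f \<in> borel_measurable borel"
    using borel_measurable_integrable[OF f] by simp
  have [measurable]: "F \<in> borel_measurable borel" unfolding F_def by measurable
  define R where "R = ennreal ((sqrt 2 ^ DIM('a))\<^sup>2) * heat_max_sq (\<lambda>y. ennreal (norm (f y))) x"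
  let ?S = "\<lambda>t. ball_mult (t / \<sigma>) F x" and ?P = "\<lambda>t. heat_mult (t / \<sigma>) F x"
  have heat: "ennreal ((norm (?P t))\<^sup>2) \<le> R" if "t > 0" for t
    unfolding R_def heat_mult_def F_def using that \<sigma>
    by (intro norm_ft_heat_multiplier_sq_le[OF f]) simp
  have "(\<integral>\<^sup>+t\<in>{0<..<u}. ennreal ((norm (?S t))\<^sup>2) \<partial>lborel)
      \<le> (\<integral>\<^sup>+t. ennreal (2 * u) * (ennreal ((norm (?S t - ?P t))\<^sup>2 / t) * indicator {0<..} t) + 2 * R * indicator {0<..<u} t \<partial>lborel)"
  proof (rule nn_integral_mono)
    fix t :: real
    show "ennreal ((norm (?S t))\<^sup>2) * indicator {0<..<u} t
      \<le> ennreal (2 * u) * (ennreal ((norm (?S t - ?P t))\<^sup>2 / t) * indicator {0<..} t) + 2 * R * indicator {0<..<u} t"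
    proof (cases "t \<in> {0<..<u}")
      case True
      have "(norm (?S t))\<^sup>2 \<le> (norm (?S t - ?P t) + norm (?P t))\<^sup>2"
        by (intro power_mono) (use norm_triangle_ineq[of "?S t - ?P t" "?P t"] in auto)
      also have "\<dots> \<le> 2 * (norm (?S t - ?P t))\<^sup>2 + 2 * (norm (?P t))\<^sup>2"
        using sum_squares_bound[of "norm (?S t - ?P t)" "norm (?P t)"] by (simp add: power2_sum)
      also have "2 * (norm (?S t - ?P t))\<^sup>2 \<le> 2 * u * ((norm (?S t - ?P t))\<^sup>2 / t)"
      proof -
        have "(norm (?S t - ?P t))\<^sup>2 * t \<le> (norm (?S t - ?P t))\<^sup>2 * u"
          using True by (intro mult_left_mono) auto
        then show ?thesis using True by (simp add: field_simps)
      qed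
      finally have "ennreal ((norm (?S t))\<^sup>2) \<le> ennreal (2 * u * ((norm (?S t - ?P t))\<^sup>2 / t) + 2 * (norm (?P t))\<^sup>2)"
        by (simp add: ennreal_leI)
      also have "\<dots> = ennreal (2 * u) * ennreal ((norm (?S t - ?P t))\<^sup>2 / t) + 2 * ennreal ((norm (?P t))\<^sup>2)"
      proof -
        have *: "ennreal (2 * u * A + 2 * B) = ennreal (2 * u) * ennreal A + 2 * ennreal B"
          if "A \<ge> 0" "B \<ge> 0" for A B
          using that u by (simp only: ennreal_plus ennreal_mult mult_nonneg_nonneg zero_le_numeral ennreal_numeral)
        show ?thesis using True by (intro *) auto
      qed
      also have "\<dots> \<le> ennreal (2 * u) * ennreal ((norm (?S t - ?P t))\<^sup>2 / t) + 2 * R"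
        using True by (intro add_left_mono mult_left_mono heat) auto
      finally show ?thesis using True by simp
    qed simp
  qed
  also have "\<dots> = ennreal (2 * u) * (\<integral>\<^sup>+t\<in>{0<..}. ennreal ((norm (?S t - ?P t))\<^sup>2 / t) \<partial>lborel) + 2 * R * ennreal u"
    using u by (simp add: nn_integral_add nn_integral_cmult)
  also have "\<dots> = ennreal u * control f x"
    unfolding control_def F_def[symmetric] R_def[symmetric] square_fun_dilation[OF \<open>F \<in> _\<close> \<sigma>]
    using u by (simp add: ennreal_mult distrib_left mult_ac)
  finally show ?thesis by (simp add: F_def)
qed

definition control_const :: "nat \<Rightarrow> real" where
  "control_const n = 2 + 2 * ((sqrt 2 ^ n)\<^sup>2 * (4 * (sqrt 2 ^ n)\<^sup>2 + 1))"

lemma control_L1: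
  fixes f :: "'a::euclidean_space \<Rightarrow> complex"
  assumes f: "integrable lborel f" and F: "integrable lborel (\<lambda>\<xi>. ft f (- \<xi>))"
  shows "(\<integral>\<^sup>+x. control f x \<partial>lborel)
    \<le> ennreal (control_const DIM('a)) * (\<integral>\<^sup>+x. ennreal ((norm (f x))\<^sup>2) \<partial>lborel)"
proof -
  have [measurable]: "f \<in> borel_measurable borel"
    using borel_measurable_integrable[OF f] by simp
  define I where "I = (\<integral>\<^sup>+x. ennreal ((norm (f x))\<^sup>2) \<partial>lborel)"
  let ?q = "(sqrt 2 ^ DIM('a))\<^sup>2"
  have "(\<integral>\<^sup>+x. square_fun (\<lambda>\<xi>. ft f (- \<xi>)) x \<partial>lborel) \<le> (\<integral>\<^sup>+\<xi>. ennreal ((norm (ft f (0 - \<xi>)))\<^sup>2) \<partial>lborel)"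
    using square_fun_L1[OF F] by simp
  also have "\<dots> = (\<integral>\<^sup>+\<xi>. ennreal ((norm (ft f \<xi>))\<^sup>2) \<partial>lborel)"
    by (rule nn_integral_lborel_reflect) measurable
  also have "\<dots> \<le> I" unfolding I_def by (rule plancherel_le[OF f])
  finally have sq: "(\<integral>\<^sup>+x. square_fun (\<lambda>\<xi>. ft f (- \<xi>)) x \<partial>lborel) \<le> I" .
  have mx: "(\<integral>\<^sup>+x. heat_max_sq (\<lambda>y. ennreal (norm (f y))) x \<partial>lborel) \<le> ennreal (4 * ?q + 1) * I"
    using heat_maximal_inequality[of "\<lambda>y. ennreal (norm (f y))"] by (simp add: I_def ennreal_power)
  have "(\<integral>\<^sup>+x. control f x \<partial>lborel) = 2 * (\<integral>\<^sup>+x. square_fun (\<lambda>\<xi>. ft f (- \<xi>)) x \<partial>lborel)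
      + 2 * (ennreal ?q * (\<integral>\<^sup>+x. heat_max_sq (\<lambda>y. ennreal (norm (f y))) x \<partial>lborel))"
    unfolding control_def by (simp add: nn_integral_add nn_integral_cmult)
  also have "\<dots> \<le> 2 * I + 2 * (ennreal ?q * (ennreal (4 * ?q + 1) * I))"
    by (intro add_mono mult_left_mono sq mx) auto
  also have "\<dots> = (ennreal 2 + ennreal 2 * (ennreal ?q * ennreal (4 * ?q + 1))) * I"
    by (simp only: distrib_right mult.assoc ennreal_numeral)
  also have "ennreal 2 + ennreal 2 * (ennreal ?q * ennreal (4 * ?q + 1)) = ennreal (control_const DIM('a))"
    unfolding control_const_def
    by (simp only: ennreal_mult ennreal_plus mult_nonneg_nonneg add_nonneg_nonneg zero_le_power2 zero_le_numeral zero_le_one)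
  finally show ?thesis by (simp only: I_def)
qed

section \<open>Schwartz functions and their Fourier transforms\<close>

text \<open>The product of the one-dimensional weights \<open>1 / (1 + x\<^sub>b\<^sup>2)\<close> is an integrable majorant, because
  \<open>\<Prod>\<^sub>b (1 + x\<^sub>b\<^sup>2) \<le> (1 + |x|\<^sup>2)\<^sup>n \<le> 2\<^sup>n (1 + |x|\<^bsup>2n\<^esup>)\<close>.\<close>

lemma integrable_if_polynomial_decay:
  fixes f :: "'a::euclidean_space \<Rightarrow> complex"
  assumes [measurable]: "f \<in> borel_measurable borel"
    and bd: "\<And>x. norm (f x) \<le> C" and dec: "\<And>x. norm x ^ (2 * DIM('a)) * norm (f x) \<le> C"
  shows "integrable lborel f"
proof -
  define n where "n = DIM('a)"
  have C: "C \<ge> 0" using bd[of 0] norm_ge_zero order_trans by blast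
  let ?w = "\<lambda>x::'a. \<Prod>b\<in>Basis. complex_of_real (inverse (1 + (x \<bullet> b)\<^sup>2))"
  have "integrable lborel (\<lambda>t::real. inverse (1 + t\<^sup>2))"
    using integrable_inverse_1_plus_square by (simp add: set_integrable_def)
  then have w: "integrable lborel ?w"
    by (intro integrable_lborel_prod) (simp only: complex_of_real_integrable_eq)
  show ?thesis
  proof (rule Bochner_Integration.integrable_bound)
    show "integrable lborel (\<lambda>x. complex_of_real (2 ^ n * (2 * C)) * ?w x)"
      by (intro integrable_mult_right w)
    show "AE x in lborel. norm (f x) \<le> norm (complex_of_real (2 ^ n * (2 * C)) * ?w x)"
    proof (rule AE_I2)
      fix x :: 'a
      define r where "r = (norm x)\<^sup>2"
      have r: "r \<ge> 0" by (simp add: r_def)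
      define W where "W = (\<Prod>b\<in>Basis. 1 + (x \<bullet> b)\<^sup>2)"
      have W0: "W > 0" unfolding W_def by (intro prod_pos) (simp add: add_pos_nonneg)
      have "W \<le> (\<Prod>b\<in>(Basis::'a set). 1 + r)"
        unfolding W_def r_def
        by (intro prod_mono conjI add_left_mono) (auto simp: abs_le_square_iff[symmetric] Basis_le_norm)
      also have "\<dots> = (1 + r) ^ n" by (simp add: n_def)
      also have "\<dots> \<le> (2 * max 1 r) ^ n" using r by (intro power_mono) auto
      also have "\<dots> \<le> 2 ^ n * (1 + r ^ n)"
        using r by (cases "r \<le> 1") (auto simp: power_mult_distrib max_def)
      finally have W: "W \<le> 2 ^ n * (1 + r ^ n)" .
      have rn: "r ^ n = norm x ^ (2 * DIM('a))" by (simp add: r_def n_def power_mult)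
      have "W * norm (f x) \<le> 2 ^ n * (1 + r ^ n) * norm (f x)"
        by (intro mult_right_mono W) auto
      also have "\<dots> = 2 ^ n * (norm (f x) + norm x ^ (2 * DIM('a)) * norm (f x))"
        unfolding rn by (simp add: algebra_simps)
      also have "\<dots> \<le> 2 ^ n * (2 * C)"
        using bd[of x] dec[of x] by (intro mult_left_mono) auto
      finally have "norm (f x) \<le> 2 ^ n * (2 * C) / W" using W0 by (simp add: field_simps)
      also have "\<dots> = norm (complex_of_real (2 ^ n * (2 * C)) * ?w x)"
      proof -
        have "?w x = complex_of_real (inverse W)"
          unfolding W_def by (simp add: prod_inversef[symmetric])
        then show ?thesis using W0 C by (simp add: norm_mult norm_inverse norm_power divide_inverse)
      qed
      finally show "norm (f x) \<le> norm (complex_of_real (2 ^ n * (2 * C)) * ?w x)" .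
    qed
  qed simp
qed

lemma integral_lborel_shift:
  fixes h :: "'a::euclidean_space \<Rightarrow> complex"
  assumes [measurable]: "h \<in> borel_measurable borel"
  shows "(LINT x|lborel. h (x + v)) = (LINT x|lborel. h x)"
    and "integrable lborel (\<lambda>x. h (x + v)) \<longleftrightarrow> integrable lborel h"
proof -
  have "(LINT x|lborel. h x) = (LINT x|distr lborel borel ((+) v). h x)"
    by (simp add: lborel_distr_plus)
  also have "\<dots> = (LINT x|lborel. h (x + v))"
    by (subst integral_distr) (simp_all add: add.commute)
  finally show "(LINT x|lborel. h (x + v)) = (LINT x|lborel. h x)" ..
  have "integrable lborel h \<longleftrightarrow> integrable (distr lborel borel ((+) v)) h"
    by (simp add: lborel_distr_plus)
  also have "\<dots> \<longleftrightarrow> integrable lborel (\<lambda>x. h (x + v))"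
    by (subst integrable_distr_eq) (simp_all add: add.commute)
  finally show "integrable lborel (\<lambda>x. h (x + v)) \<longleftrightarrow> integrable lborel h" ..
qed

text \<open>Integrate \<open>h (x + v) - h x = \<integral>\<^sub>0\<^sup>1 h' (x + \<tau> v) d\<tau>\<close> over \<open>x\<close>: the left side vanishes by translation
  invariance, and for the same reason the right side is the integral of \<open>h'\<close>. Applied to
  \<open>h = f \<cdot> wave\<close> this is the integration by parts behind \<open>fourier_partial_deriv\<close>.\<close>

lemma integral_directional_derivative_eq_0:
  fixes h h' :: "'a::euclidean_space \<Rightarrow> complex"
  assumes h: "integrable lborel h" and h': "integrable lborel h'"
    and cont: "continuous_on UNIV h'"
    and deriv: "\<And>x \<tau>. ((\<lambda>\<tau>. h (x + \<tau> *\<^sub>R v)) has_vector_derivative h' (x + \<tau> *\<^sub>R v)) (at \<tau>)"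
  shows "(LINT x|lborel. h' x) = 0"
proof -
  have [measurable]: "h \<in> borel_measurable borel" "h' \<in> borel_measurable borel"
    using borel_measurable_integrable[OF h] borel_measurable_integrable[OF h'] by simp_all
  let ?k = "\<lambda>\<tau> x. indicator {0..1} \<tau> *\<^sub>R h' (x + \<tau> *\<^sub>R v)"
  have ftc: "(LINT \<tau>|lborel. ?k \<tau> x) = h (x + v) - h x" for x
  proof -
    have "(LINT \<tau>|lborel. ?k \<tau> x) = h (x + 1 *\<^sub>R v) - h (x + 0 *\<^sub>R v)"
    proof (rule integral_FTC_Icc)
      show "((\<lambda>\<tau>. h (x + \<tau> *\<^sub>R v)) has_vector_derivative h' (x + \<tau> *\<^sub>R v)) (at \<tau> within {0..1})" for \<tau>
        by (rule has_vector_derivative_at_within[OF deriv])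
      show "continuous_on {0..1} (\<lambda>\<tau>. h' (x + \<tau> *\<^sub>R v))"
        by (rule continuous_on_compose2[OF cont]) (auto intro!: continuous_intros)
    qed simp
    then show ?thesis by simp
  qed
  have int: "integrable (lborel \<Otimes>\<^sub>M lborel) (\<lambda>(\<tau>, x). ?k \<tau> x)"
  proof (rule lborel_pair.Fubini_integrable)
    have n: "(LINT x|lborel. norm (?k \<tau> x)) = indicator {0..1} \<tau> *\<^sub>R (LINT x|lborel. norm (h' x))" for \<tau>
    proof -
      have "complex_of_real (LINT x|lborel. norm (h' (x + \<tau> *\<^sub>R v))) = complex_of_real (LINT x|lborel. norm (h' x))"
        unfolding integral_complex_of_real[symmetric]
        by (rule integral_lborel_shift(1)) measurable
      then show ?thesis by (simp only: of_real_eq_iff norm_scaleR) simp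
    qed
    have "set_integrable lborel {0..1::real} (\<lambda>_. LINT x|lborel. norm (h' x))"
      by (rule borel_integrable_atLeastAtMost') (rule continuous_on_const)
    then show "integrable lborel (\<lambda>\<tau>. LINT x|lborel. norm (case (\<tau>, x) of (\<tau>, x) \<Rightarrow> ?k \<tau> x))"
      unfolding prod.case n set_integrable_def .
    show "AE \<tau> in lborel. integrable lborel (\<lambda>x. case (\<tau>, x) of (\<tau>, x) \<Rightarrow> ?k \<tau> x)"
      using h' by (simp add: integral_lborel_shift(2))
  qed measurable
  have "0 = (LINT x|lborel. h (x + v)) - (LINT x|lborel. h x)"
    by (simp add: integral_lborel_shift(1))
  also have "\<dots> = (LINT x|lborel. h (x + v) - h x)"
    using h by (intro Bochner_Integration.integral_diff[symmetric]) (simp_all add: integral_lborel_shift(2))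
  also have "\<dots> = (LINT x|lborel. LINT \<tau>|lborel. ?k \<tau> x)"
    by (simp only: ftc)
  also have "\<dots> = (LINT \<tau>|lborel. LINT x|lborel. ?k \<tau> x)"
    by (rule lborel_pair.Fubini_integral[OF int])
  also have "\<dots> = (LINT \<tau>|lborel. indicator {0..1::real} \<tau> *\<^sub>R (LINT x|lborel. h' x))"
    by (simp only: integral_scaleR_right integral_lborel_shift(1)[OF \<open>h' \<in> borel_measurable borel\<close>])
  also have "\<dots> = (LINT \<tau>|lborel. indicator {0..1::real} \<tau>) *\<^sub>R (LINT x|lborel. h' x)"
    by (rule integral_scaleR_left) simp
  also have "\<dots> = (LINT x|lborel. h' x)"
    by simp
  finally show ?thesis ..
qed

lemma schwartz_partial_deriv: "schwartz f \<Longrightarrow> schwartz (partial_deriv i f)"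
proof -
  have "partial_derivs is (partial_deriv i f) = partial_derivs (is @ [i]) f" for "is"
    by (simp add: partial_derivs_def)
  then show "schwartz f \<Longrightarrow> schwartz (partial_deriv i f)"
    by (simp add: schwartz_def)
qed

lemma schwartz_funpow_partial_deriv: "schwartz f \<Longrightarrow> schwartz ((partial_deriv i ^^ k) f)"
  by (induction k) (auto intro: schwartz_partial_deriv)

lemma schwartz_differentiable: "schwartz f \<Longrightarrow> f differentiable (at x)"
  by (auto simp: schwartz_def partial_derivs_def dest: spec[of _ "[]"])

lemma schwartz_continuous: "schwartz f \<Longrightarrow> continuous_on UNIV f"
  by (intro continuous_at_imp_continuous_on ballI differentiable_imp_continuous_within schwartz_differentiable)

lemma schwartz_measurable: "schwartz f \<Longrightarrow> f \<in> borel_measurable borel"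
  by (intro borel_measurable_continuous_onI schwartz_continuous)

lemma schwartz_decay: "schwartz f \<Longrightarrow> \<exists>C. \<forall>x. norm x ^ N * norm (f x) \<le> C"
  unfolding schwartz_def partial_derivs_def by (drule conjunct2, drule spec[of _ "[]"]) simp

lemma schwartz_integrable:
  assumes "schwartz f"
  shows "integrable lborel f"
proof -
  obtain C1 where C1: "\<And>x. norm (f x) \<le> C1" using schwartz_decay[OF assms, of 0] by auto
  obtain C2 where C2: "\<And>x. norm x ^ (2 * DIM(real^'a)) * norm (f x) \<le> C2"
    using schwartz_decay[OF assms] by blast
  show ?thesis
    by (rule integrable_if_polynomial_decay[of _ "max C1 C2"])
      (use C1 C2 schwartz_measurable[OF assms] in \<open>auto simp: le_max_iff_disj\<close>)
qed

lemma schwartz_square_integrable: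
  assumes "schwartz f"
  shows "integrable lborel (\<lambda>x. (norm (f x))\<^sup>2)"
proof -
  obtain C where C: "\<And>x. norm (f x) \<le> C" using schwartz_decay[OF assms, of 0] by auto
  have [measurable]: "f \<in> borel_measurable borel" by (rule schwartz_measurable[OF assms])
  show ?thesis
  proof (rule Bochner_Integration.integrable_bound)
    show "integrable lborel (\<lambda>x. C *\<^sub>R f x)" using schwartz_integrable[OF assms] by simp
    show "AE x in lborel. norm ((norm (f x))\<^sup>2) \<le> norm (C *\<^sub>R f x)"
      using C by (intro AE_I2) (auto simp: power2_eq_square intro!: mult_right_mono order_trans[OF C abs_ge_self])
  qed measurable
qed

lemma fourier_eq_ft: "fourier f \<xi> = ft f (- \<xi>)"
  unfolding fourier_def ft_def wave_def
  by (intro Bochner_Integration.integral_cong refl) (simp add: cis_conv_exp inner_commute algebra_simps)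

lemma fourier_partial_deriv:
  fixes f :: "real ^ 'n \<Rightarrow> complex"
  assumes f: "schwartz f"
  shows "fourier (partial_deriv i f) \<xi> = 2 * pi * \<i> * complex_of_real (\<xi> $ i) * fourier f \<xi>"
proof -
  let ?e = "axis i 1 :: real ^ 'n" and ?c = "2 * pi * \<i> * complex_of_real (\<xi> $ i)"
  define h where "h x = f x * wave (- \<xi>) x" for x
  define h' where "h' x = partial_deriv i f x * wave (- \<xi>) x - ?c * (f x * wave (- \<xi>) x)" for x
  have df: "schwartz (partial_deriv i f)" by (rule schwartz_partial_deriv[OF f])
  have i1: "integrable lborel (\<lambda>x. partial_deriv i f x * wave (- \<xi>) x)"
    by (intro integrable_mult_wave schwartz_integrable df)
  have i2: "integrable lborel (\<lambda>x. ?c * (f x * wave (- \<xi>) x))"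
    by (intro integrable_mult_right integrable_mult_wave schwartz_integrable f)
  have cw: "continuous_on UNIV (\<lambda>x. wave (- \<xi>) x)"
    unfolding wave_def by (intro continuous_intros)
  have "(LINT x|lborel. h' x) = 0"
  proof (rule integral_directional_derivative_eq_0[where h=h and v="?e"])
    show "integrable lborel h"
      unfolding h_def by (intro integrable_mult_wave schwartz_integrable f)
    show "integrable lborel h'"
      unfolding h'_def by (rule Bochner_Integration.integrable_diff[OF i1 i2])
    show "continuous_on UNIV h'"
      unfolding h'_def by (intro continuous_intros cw schwartz_continuous f df)
    fix x :: "real ^ 'n" and \<tau> :: real
    let ?y = "x + \<tau> *\<^sub>R ?e"
    have line: "((\<lambda>\<tau>. x + \<tau> *\<^sub>R ?e) has_vector_derivative ?e) (at \<tau>)"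
      by (auto intro!: derivative_eq_intros)
    have "((\<lambda>\<tau>. f (x + \<tau> *\<^sub>R ?e)) has_vector_derivative partial_deriv i f ?y) (at \<tau>)"
    proof -
      have "(f has_derivative frechet_derivative f (at ?y)) (at ?y)"
        using schwartz_differentiable[OF f] frechet_derivative_works by blast
      from vector_derivative_diff_chain_within[OF line, of f, OF has_derivative_at_withinI[OF this]]
      show ?thesis by (simp add: partial_deriv_def o_def)
    qed
    moreover have "((\<lambda>\<tau>. wave (- \<xi>) (x + \<tau> *\<^sub>R ?e)) has_vector_derivative - ?c * wave (- \<xi>) ?y) (at \<tau>)"
    proof -
      have eq: "(\<lambda>\<tau>. wave (- \<xi>) (x + \<tau> *\<^sub>R ?e)) = (\<lambda>\<tau>. wave (- \<xi>) x * exp (complex_of_real \<tau> * (- ?c)))"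
      proof
        fix \<tau>
        have "wave (- \<xi>) (x + \<tau> *\<^sub>R ?e) = wave (- \<xi>) x * wave (- \<xi>) (\<tau> *\<^sub>R ?e)"
          by (rule wave_add)
        also have "wave (- \<xi>) (\<tau> *\<^sub>R ?e) = exp (complex_of_real \<tau> * (- ?c))"
          by (simp add: wave_def cis_conv_exp inner_axis algebra_simps)
        finally show "wave (- \<xi>) (x + \<tau> *\<^sub>R ?e) = wave (- \<xi>) x * exp (complex_of_real \<tau> * (- ?c))" .
      qed
      have "((\<lambda>z. wave (- \<xi>) x * exp (z * (- ?c))) has_field_derivative
          wave (- \<xi>) x * (exp (complex_of_real \<tau> * (- ?c)) * (- ?c))) (at (complex_of_real \<tau>))"
        by (auto intro!: derivative_eq_intros)
      from has_vector_derivative_real_field[OF this]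
      have "((\<lambda>\<tau>. wave (- \<xi>) x * exp (complex_of_real \<tau> * (- ?c))) has_vector_derivative
          wave (- \<xi>) x * (exp (complex_of_real \<tau> * (- ?c)) * (- ?c))) (at \<tau>)" .
      then show ?thesis
        unfolding eq fun_cong[OF eq, of \<tau>] by (simp only: mult_ac)
    qed
    ultimately have "((\<lambda>\<tau>. f (x + \<tau> *\<^sub>R ?e) * wave (- \<xi>) (x + \<tau> *\<^sub>R ?e)) has_vector_derivative
        f ?y * (- ?c * wave (- \<xi>) ?y) + partial_deriv i f ?y * wave (- \<xi>) ?y) (at \<tau>)"
      by (rule has_vector_derivative_mult)
    then show "((\<lambda>\<tau>. h (x + \<tau> *\<^sub>R ?e)) has_vector_derivative h' ?y) (at \<tau>)"
      unfolding h_def h'_def by (simp add: algebra_simps)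
  qed
  then have "(LINT x|lborel. partial_deriv i f x * wave (- \<xi>) x) = (LINT x|lborel. ?c * (f x * wave (- \<xi>) x))"
    unfolding h'_def Bochner_Integration.integral_diff[OF i1 i2] by simp
  then show ?thesis
    unfolding fourier_eq_ft ft_def by simp
qed

lemma fourier_funpow_partial_deriv:
  assumes "schwartz f"
  shows "fourier ((partial_deriv i ^^ k) f) \<xi> = (2 * pi * \<i> * complex_of_real (\<xi> $ i)) ^ k * fourier f \<xi>"
  using assms
  by (induction k) (simp_all add: fourier_partial_deriv schwartz_funpow_partial_deriv)

lemma norm_fourier_le: "norm (fourier f \<xi>) \<le> (LINT x|lborel. norm (f x))"
  unfolding fourier_eq_ft by (rule norm_ft_le)

lemma norm_power_le_sum_component_powers:
  fixes x :: "real ^ 'n"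
  shows "norm x ^ (2 * k) \<le> real CARD('n) ^ k * (\<Sum>i\<in>UNIV. \<bar>x $ i\<bar> ^ (2 * k))"
proof -
  obtain i where i: "\<And>j. \<bar>x $ j\<bar> \<le> \<bar>x $ i\<bar>"
  proof -
    have "Max (range (\<lambda>j. \<bar>x $ j\<bar>)) \<in> range (\<lambda>j. \<bar>x $ j\<bar>)" by (intro Max_in) auto
    then obtain i where "Max (range (\<lambda>j. \<bar>x $ j\<bar>)) = \<bar>x $ i\<bar>" by (elim imageE)
    moreover have "\<bar>x $ j\<bar> \<le> Max (range (\<lambda>j. \<bar>x $ j\<bar>))" for j by (intro Max_ge) auto
    ultimately show ?thesis using that by metis
  qed
  have "(norm x)\<^sup>2 = (\<Sum>j\<in>UNIV. (x $ j)\<^sup>2)"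
    by (simp add: norm_vec_def L2_set_def sum_nonneg)
  also have "\<dots> \<le> (\<Sum>j\<in>(UNIV::'n set). (x $ i)\<^sup>2)"
    by (intro sum_mono) (use i in \<open>simp add: abs_le_square_iff\<close>)
  finally have "((norm x)\<^sup>2) ^ k \<le> (real CARD('n) * (x $ i)\<^sup>2) ^ k"
    by (intro power_mono) auto
  also have "\<dots> = real CARD('n) ^ k * \<bar>x $ i\<bar> ^ (2 * k)"
    by (simp add: power_mult_distrib power_mult)
  also have "\<dots> \<le> real CARD('n) ^ k * (\<Sum>i\<in>UNIV. \<bar>x $ i\<bar> ^ (2 * k))"
    by (intro mult_left_mono member_le_sum) auto
  finally show ?thesis by (simp add: power_mult)
qed

text \<open>Without this the double integral that defines the bilinear operator need not
  converge absolutely: the symbol decays only like a small negative power. Differentiating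
  \<open>2n\<close> times in each coordinate direction gives enough decay.\<close>

lemma integrable_fourier:
  fixes f :: "real ^ 'n \<Rightarrow> complex"
  assumes f: "schwartz f"
  shows "integrable lborel (fourier f)"
proof -
  define K where "K i = (LINT x|lborel. norm ((partial_deriv i ^^ (2 * CARD('n))) f x))" for i :: 'n
  have K: "\<bar>\<xi> $ i\<bar> ^ (2 * CARD('n)) * norm (fourier f \<xi>) \<le> K i" for \<xi> i
  proof -
    have "1 * \<bar>\<xi> $ i\<bar> \<le> 2 * pi * \<bar>\<xi> $ i\<bar>" using pi_gt3 by (intro mult_right_mono) auto
    then have "\<bar>\<xi> $ i\<bar> ^ (2 * CARD('n)) \<le> (2 * pi * \<bar>\<xi> $ i\<bar>) ^ (2 * CARD('n))"
      by (intro power_mono) auto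
    then have "\<bar>\<xi> $ i\<bar> ^ (2 * CARD('n)) * norm (fourier f \<xi>) \<le> (2 * pi * \<bar>\<xi> $ i\<bar>) ^ (2 * CARD('n)) * norm (fourier f \<xi>)"
      by (intro mult_right_mono) auto
    also have "\<dots> = norm (fourier ((partial_deriv i ^^ (2 * CARD('n))) f) \<xi>)"
      by (simp only: fourier_funpow_partial_deriv[OF f] norm_mult norm_power) simp
    also have "\<dots> \<le> K i" unfolding K_def by (rule norm_fourier_le)
    finally show ?thesis .
  qed
  define C where "C = max (LINT x|lborel. norm (f x)) (real CARD('n) ^ CARD('n) * (\<Sum>i\<in>UNIV. K i))"
  have [measurable]: "f \<in> borel_measurable borel" by (rule schwartz_measurable[OF f])
  show ?thesis
  proof (rule integrable_if_polynomial_decay)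
    show "fourier f \<in> borel_measurable borel"
      unfolding fourier_eq_ft[abs_def] by measurable
    fix \<xi> :: "real ^ 'n"
    show "norm (fourier f \<xi>) \<le> C" unfolding C_def using norm_fourier_le[of f \<xi>] by simp
    have "norm \<xi> ^ (2 * CARD('n)) * norm (fourier f \<xi>)
        \<le> (real CARD('n) ^ CARD('n) * (\<Sum>i\<in>UNIV. \<bar>\<xi> $ i\<bar> ^ (2 * CARD('n)))) * norm (fourier f \<xi>)"
      by (intro mult_right_mono norm_power_le_sum_component_powers) auto
    also have "\<dots> = real CARD('n) ^ CARD('n) * (\<Sum>i\<in>UNIV. \<bar>\<xi> $ i\<bar> ^ (2 * CARD('n)) * norm (fourier f \<xi>))"
      by (simp add: sum_distrib_right mult.assoc)
    also have "\<dots> \<le> real CARD('n) ^ CARD('n) * (\<Sum>i\<in>UNIV. K i)"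
      by (intro mult_left_mono sum_mono K) auto
    also have "\<dots> \<le> C" by (simp add: C_def)
    finally show "norm \<xi> ^ (2 * DIM(real ^ 'n)) * norm (fourier f \<xi>) \<le> C" by simp
  qed
qed

section \<open>The symbol as a superposition of Bochner-Riesz symbols\<close>

lemma set_integrable_powr_tail:
  fixes T \<epsilon> :: real
  assumes T: "T > 0" and \<epsilon>: "\<epsilon> > 0"
  shows "set_integrable lborel {T..} (\<lambda>u. u powr (- 1 - \<epsilon>))"
proof -
  have "(\<integral>\<^sup>+u. ennreal (u powr (- 1 - \<epsilon>)) * indicator {T..} u \<partial>lborel) = ennreal (0 - (- (T powr (- \<epsilon>) / \<epsilon>)))"
  proof (rule nn_integral_FTC_atLeast[where F="\<lambda>u. - (u powr (- \<epsilon>) / \<epsilon>)"])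
    show "((\<lambda>u. - (u powr (- \<epsilon>) / \<epsilon>)) \<longlongrightarrow> 0) at_top" using \<epsilon> by real_asymp
    fix u assume "T \<le> u"
    then have "u > 0" using T by simp
    then show "((\<lambda>u. - (u powr (- \<epsilon>) / \<epsilon>)) has_real_derivative u powr (- 1 - \<epsilon>)) (at u)"
      unfolding minus_diff_commute[of 1 \<epsilon>] using \<epsilon> by (auto intro!: derivative_eq_intros)
  qed auto
  then have fin: "(\<integral>\<^sup>+u. ennreal (u powr (- 1 - \<epsilon>)) * indicator {T..} u \<partial>lborel) < \<infinity>" by simp
  have "(\<integral>\<^sup>+u. ennreal (norm (indicator {T..} u *\<^sub>R (u powr (- 1 - \<epsilon>)))) \<partial>lborel)
      = (\<integral>\<^sup>+u. ennreal (u powr (- 1 - \<epsilon>)) * indicator {T..} u \<partial>lborel)"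
    by (intro nn_integral_cong) (auto split: split_indicator)
  with fin show ?thesis
    unfolding set_integrable_def by (intro integrableI_bounded) auto
qed

lemma bigo_powr_obtains:
  fixes h :: "real \<Rightarrow> complex"
  assumes "(\<lambda>t. norm (h t)) \<in> O[at_top](\<lambda>t. t powr p)"
  obtains c T where "c > 0" "T \<ge> 1" "\<And>t. t \<ge> T \<Longrightarrow> norm (h t) \<le> c * t powr p"
proof -
  from landau_o.bigE[OF assms] obtain c where c: "c > 0"
    "eventually (\<lambda>t. norm (norm (h t)) \<le> c * norm (t powr p)) at_top" .
  from c(2) obtain T where "\<And>t. t \<ge> T \<Longrightarrow> norm (h t) \<le> c * t powr p"
    unfolding eventually_at_top_linorder by auto
  with c(1) show ?thesis by (intro that[of c "max T 1"]) auto
qed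

text \<open>Taylor's formula based at infinity, with \<open>w = m\<^sub>0''\<close> extended by zero. An antiderivative
  of \<open>(u - c) m\<^sub>0''(u)\<close> is \<open>g u = (u - c) m\<^sub>0'(u) - m\<^sub>0(u)\<close>; it equals \<open>- m\<^sub>0(c)\<close> at \<open>u = c\<close> and tends to
  \<open>0\<close> at infinity.\<close>

lemma halfline_taylor_representation:
  fixes m0 :: "real \<Rightarrow> complex" and \<epsilon> :: real
  assumes smooth: "smooth_halfline m0"
    and eps: "\<epsilon> > 0"
    and decay: "\<And>k. k \<in> {0, 1, 2} \<Longrightarrow>
      (\<lambda>t. norm (nth_deriv_halfline k m0 t)) \<in> O[at_top](\<lambda>t. t powr (- real k - \<epsilon>))"
  obtains w :: "real \<Rightarrow> complex"
    where "w \<in> borel_measurable borel" "\<And>u. u < 0 \<Longrightarrow> w u = 0" "integrable lborel (\<lambda>u. u *\<^sub>R w u)"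
      "\<And>c. c \<ge> 0 \<Longrightarrow> m0 c = (LINT u|lborel. max 0 (u - c) *\<^sub>R w u)"
proof -
  define m1 where "m1 = nth_deriv_halfline 1 m0"
  define m2 where "m2 = nth_deriv_halfline 2 m0"
  have m1_eq: "m1 = (\<lambda>t. vector_derivative m0 (at t within {0..}))" by (simp add: m1_def)
  have m2_eq: "m2 = (\<lambda>t. vector_derivative m1 (at t within {0..}))" by (simp add: m1_def m2_def numeral_2_eq_2)
  have diff: "nth_deriv_halfline k m0 differentiable_on {0..}" for k
    using smooth by (simp add: smooth_halfline_def)
  have d0: "(m0 has_vector_derivative m1 t) (at t within {0..})" if "t \<ge> 0" for t
    unfolding m1_eq using diff[of 0] that by (simp add: differentiable_on_def vector_derivative_works[symmetric])
  have d1: "(m1 has_vector_derivative m2 t) (at t within {0..})" if "t \<ge> 0" for t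
    unfolding m2_eq using diff[of 1] that by (simp add: differentiable_on_def vector_derivative_works[symmetric] m1_def)
  have cont2: "continuous_on {0..} m2"
    unfolding m2_def by (rule differentiable_imp_continuous_on[OF diff])
  have b0: "(\<lambda>t. norm (m0 t)) \<in> O[at_top](\<lambda>t. t powr (- \<epsilon>))" using decay[of 0] by simp
  have b1: "(\<lambda>t. norm (m1 t)) \<in> O[at_top](\<lambda>t. t powr (- 1 - \<epsilon>))" using decay[of 1] by (simp add: m1_def)
  have b2: "(\<lambda>t. norm (m2 t)) \<in> O[at_top](\<lambda>t. t powr (- 2 - \<epsilon>))" using decay[of 2] by (simp add: m2_def)
  define w where "w u = indicator {0..} u *\<^sub>R m2 u" for u
  have w_meas [measurable]: "w \<in> borel_measurable borel"
    unfolding w_def by (rule borel_measurable_continuous_on_indicator[OF _ cont2]) simp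
  have w_int: "integrable lborel (\<lambda>u. u *\<^sub>R w u)"
  proof -
    obtain c T where cT: "c > 0" "T \<ge> 1" "\<And>t. t \<ge> T \<Longrightarrow> norm (m2 t) \<le> c * t powr (- 2 - \<epsilon>)"
      using bigo_powr_obtains[OF b2] by blast
    have "set_integrable lborel {0..T} (\<lambda>u. u *\<^sub>R m2 u)"
      by (intro borel_integrable_atLeastAtMost' continuous_intros continuous_on_subset[OF cont2]) auto
    then have "integrable lborel (\<lambda>u. norm (indicator {0..T} u *\<^sub>R (u *\<^sub>R m2 u)))"
      unfolding set_integrable_def by (rule integrable_norm)
    moreover have "integrable lborel (\<lambda>u. c * (indicator {T..} u *\<^sub>R (u powr (- 1 - \<epsilon>))))"
      using set_integrable_powr_tail[of T \<epsilon>] cT(2) eps unfolding set_integrable_def by simp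
    ultimately have "integrable lborel (\<lambda>u. norm (indicator {0..T} u *\<^sub>R (u *\<^sub>R m2 u)) + c * (indicator {T..} u *\<^sub>R (u powr (- 1 - \<epsilon>))))"
      by (rule Bochner_Integration.integrable_add)
    then show ?thesis
    proof (rule Bochner_Integration.integrable_bound)
      have pw: "norm (u *\<^sub>R w u) \<le> norm (indicator {0..T} u *\<^sub>R (u *\<^sub>R m2 u)) + c * (indicator {T..} u *\<^sub>R (u powr (- 1 - \<epsilon>)))" for u
      proof (cases "u \<ge> T")
        case True
        then have u: "u \<ge> 1" using cT(2) by simp
        have "norm (u *\<^sub>R w u) = u * norm (m2 u)" using u by (simp add: w_def)
        also have "\<dots> \<le> u * (c * u powr (- 2 - \<epsilon>))" using u True by (intro mult_left_mono cT) auto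
        also have "\<dots> = c * u powr (- 1 - \<epsilon>)"
        proof -
          have "u * u powr (- 2 - \<epsilon>) = u powr (1 + (- 2 - \<epsilon>))" using u powr_add[of u 1 "- 2 - \<epsilon>"] by simp
          then show ?thesis by (simp add: algebra_simps)
        qed
        finally show ?thesis using True by (simp add: add_increasing)
      next
        case False
        then show ?thesis using cT(1) by (auto simp: w_def split: split_indicator)
      qed
      then show "AE u in lborel. norm (u *\<^sub>R w u) \<le> norm (norm (indicator {0..T} u *\<^sub>R (u *\<^sub>R m2 u)) + c * (indicator {T..} u *\<^sub>R (u powr (- 1 - \<epsilon>))))"
        by (intro AE_I2 order_trans[OF pw]) (simp only: real_norm_def abs_ge_self)
    qed measurable
  qed
  have rep: "m0 c = (LINT u|lborel. max 0 (u - c) *\<^sub>R w u)" if c: "c \<ge> 0" for c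
  proof -
    define g where "g u = (u - c) *\<^sub>R m1 u - m0 u" for u
    have g_lim: "(g \<longlongrightarrow> 0) at_top"
    proof -
      obtain c0 T0 where cT0: "c0 > 0" "T0 \<ge> 1" "\<And>t. t \<ge> T0 \<Longrightarrow> norm (m0 t) \<le> c0 * t powr (- \<epsilon>)"
        using bigo_powr_obtains[OF b0] by blast
      obtain c1 T1 where cT1: "c1 > 0" "T1 \<ge> 1" "\<And>t. t \<ge> T1 \<Longrightarrow> norm (m1 t) \<le> c1 * t powr (- 1 - \<epsilon>)"
        using bigo_powr_obtains[OF b1] by blast
      have "norm (g t) \<le> (c0 + c1) * t powr (- \<epsilon>)" if t: "t \<ge> max c (max T0 T1)" for t
      proof -
        have t1: "t \<ge> 1" "t \<ge> c" using t cT0 by auto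
        have "norm (g t) \<le> norm ((t - c) *\<^sub>R m1 t) + norm (m0 t)" unfolding g_def by (rule norm_triangle_ineq4)
        also have "norm ((t - c) *\<^sub>R m1 t) \<le> t * (c1 * t powr (- 1 - \<epsilon>))"
          unfolding norm_scaleR using t t1 c by (intro mult_mono cT1) auto
        also have "t * (c1 * t powr (- 1 - \<epsilon>)) = c1 * t powr (- \<epsilon>)"
        proof -
          have "t * t powr (- 1 - \<epsilon>) = t powr (1 + (- 1 - \<epsilon>))" using t1 powr_add[of t 1 "- 1 - \<epsilon>"] by simp
          then show ?thesis by (simp add: algebra_simps)
        qed
        also have "norm (m0 t) \<le> c0 * t powr (- \<epsilon>)" using t by (intro cT0) auto
        finally show ?thesis by (simp add: algebra_simps)
      qed
      then have "eventually (\<lambda>t. norm (g t) \<le> (c0 + c1) * t powr (- \<epsilon>)) at_top"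
        using eventually_ge_at_top by (rule eventually_mono[rotated])
      moreover have "((\<lambda>t. (c0 + c1) * t powr (- \<epsilon>)) \<longlongrightarrow> 0) at_top"
        using eps by real_asymp
      ultimately show ?thesis by (rule Lim_null_comparison)
    qed
    have ftc: "(LINT u|lborel. indicator {c..c + real n} u *\<^sub>R ((u - c) *\<^sub>R m2 u)) = g (c + real n) - g c" for n
    proof (rule integral_FTC_Icc)
      fix u assume u: "c \<le> u" "u \<le> c + real n"
      have s: "{c..c + real n} \<subseteq> {0..}" using c by auto
      have l: "((\<lambda>u. u - c) has_vector_derivative 1) (at u within {c..c + real n})"
        by (auto intro!: derivative_eq_intros)
      have "(g has_vector_derivative ((u - c) *\<^sub>R m2 u + 1 *\<^sub>R m1 u) - m1 u) (at u within {c..c + real n})"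
        unfolding g_def
        by (intro has_vector_derivative_diff has_vector_derivative_scaleR
            has_vector_derivative_within_subset[OF d1 s] has_vector_derivative_within_subset[OF d0 s])
          (use u c l in \<open>auto simp: has_real_derivative_iff_has_vector_derivative\<close>)
      then show "(g has_vector_derivative (u - c) *\<^sub>R m2 u) (at u within {c..c + real n})" by simp
    next
      show "continuous_on {c..c + real n} (\<lambda>u. (u - c) *\<^sub>R m2 u)"
        using c by (intro continuous_intros continuous_on_subset[OF cont2]) auto
    qed simp
    have gc: "g c = - m0 c" by (simp add: g_def)
    have "(\<lambda>n. LINT u|lborel. indicator {c..c + real n} u *\<^sub>R ((u - c) *\<^sub>R m2 u)) \<longlonglongrightarrow> 0 - g c"
      unfolding ftc
      by (intro tendsto_intros filterlim_compose[OF g_lim] filterlim_tendsto_add_at_top[OF tendsto_const] filterlim_real_sequentially)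
    moreover have "(\<lambda>n. LINT u|lborel. indicator {c..c + real n} u *\<^sub>R ((u - c) *\<^sub>R m2 u))
        \<longlonglongrightarrow> (LINT u|lborel. max 0 (u - c) *\<^sub>R w u)"
    proof (rule integral_dominated_convergence[where w="\<lambda>u. norm (u *\<^sub>R w u)"])
      have eq: "indicator {c..c + real n} u *\<^sub>R ((u - c) *\<^sub>R m2 u) = indicator {c..c + real n} u *\<^sub>R ((u - c) *\<^sub>R w u)" for n u
        using c by (auto simp: w_def split: split_indicator)
      show "(\<lambda>u. indicator {c..c + real n} u *\<^sub>R ((u - c) *\<^sub>R m2 u)) \<in> borel_measurable lborel" for n
        unfolding eq by measurable
      show "AE u in lborel. norm (indicator {c..c + real n} u *\<^sub>R ((u - c) *\<^sub>R m2 u)) \<le> norm (u *\<^sub>R w u)" for n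
        unfolding eq using c by (intro AE_I2) (auto split: split_indicator intro!: mult_right_mono)
      show "integrable lborel (\<lambda>u. norm (u *\<^sub>R w u))" by (rule integrable_norm[OF w_int])
      show "AE u in lborel. (\<lambda>n. indicator {c..c + real n} u *\<^sub>R ((u - c) *\<^sub>R m2 u)) \<longlonglongrightarrow> max 0 (u - c) *\<^sub>R w u"
      proof (rule AE_I2, unfold eq, rule tendsto_eventually)
        fix u :: real
        obtain n0 :: nat where "u - c \<le> real n0" using real_arch_simple by blast
        then show "\<forall>\<^sub>F n in sequentially. indicator {c..c + real n} u *\<^sub>R ((u - c) *\<^sub>R w u) = max 0 (u - c) *\<^sub>R w u"
          by (intro eventually_sequentiallyI[of n0]) (auto split: split_indicator simp: max_def)
      qed
    qed measurable
    ultimately have "0 - g c = (LINT u|lborel. max 0 (u - c) *\<^sub>R w u)"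
      by (rule LIMSEQ_unique)
    then show ?thesis by (simp add: gc)
  qed
  show ?thesis
    by (rule that[of w]) (use w_meas w_int rep in \<open>auto simp: w_def\<close>)
qed

lemma overlap_length:
  fixes p q u \<sigma> :: real
  assumes "\<sigma> > 0"
  shows "(LINT t|lborel. (if p \<le> t / \<sigma> then 1 else 0) * (if q \<le> (u - t) / \<sigma> then 1 else (0::complex)))
    = complex_of_real (max 0 (u - \<sigma> * (p + q)))"
proof -
  have "(if p \<le> t / \<sigma> then 1 else 0) * (if q \<le> (u - t) / \<sigma> then 1 else (0::complex))
      = complex_of_real (indicator {\<sigma> * p..u - \<sigma> * q} t)" for t
    using assms by (auto split: split_indicator simp: field_simps)
  then have "(LINT t|lborel. (if p \<le> t / \<sigma> then 1 else 0) * (if q \<le> (u - t) / \<sigma> then 1 else (0::complex)))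
      = complex_of_real (measure lborel {\<sigma> * p..u - \<sigma> * q})"
    by (simp only: integral_complex_of_real) simp
  then show ?thesis by (simp add: max_def algebra_simps)
qed

text \<open>Fubini's theorem for the frequencies \<open>(\<eta>, \<xi>)\<close> against the parameters \<open>q = (u, t)\<close>, after inserting
  \<open>overlap_length\<close> into the representation \<open>rep\<close> of \<open>m\<^sub>0\<close>. The indicators force \<open>0 \<le> t \<le> u\<close>, so
  integrability in \<open>q\<close> is that of \<open>u w(u)\<close>. The first component of a point \<open>p\<close> is \<open>\<eta>\<close>.\<close>

lemma bilinear_superposition:
  fixes F G :: "'a::euclidean_space \<Rightarrow> complex" and w m0 :: "real \<Rightarrow> complex" and x :: 'a
  assumes F: "integrable lborel F" and G: "integrable lborel G"
    and w [measurable]: "w \<in> borel_measurable borel"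
    and w_neg: "\<And>u. u < 0 \<Longrightarrow> w u = 0"
    and w_int: "integrable lborel (\<lambda>u. u *\<^sub>R w u)"
    and rep: "\<And>c. c \<ge> 0 \<Longrightarrow> m0 c = (LINT u|lborel. max 0 (u - c) *\<^sub>R w u)"
    and \<sigma>: "\<sigma> > 0"
  defines "h \<equiv> \<lambda>p. m0 (\<sigma> * ((norm (snd p))\<^sup>2 + (norm (fst p))\<^sup>2)) * (G (fst p) * wave x (fst p) * (F (snd p) * wave x (snd p)))"
  shows "integrable lborel h"
    and "(LINT p|lborel. h p)
      = (LINT q|lborel. w (fst q) * ball_mult (snd q / \<sigma>) F x * ball_mult ((fst q - snd q) / \<sigma>) G x)"
proof -
  have [measurable]: "F \<in> borel_measurable borel" "G \<in> borel_measurable borel"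
    using borel_measurable_integrable[OF F] borel_measurable_integrable[OF G] by simp_all
  define P where "P p = G (fst p) * wave x (fst p) * (F (snd p) * wave x (snd p))" for p :: "'a \<times> 'a"
  have P: "integrable lborel P"
    unfolding P_def by (intro integrable_lborel_tensor integrable_mult_wave F G)
  have [measurable]: "P \<in> borel_measurable borel"
    using borel_measurable_integrable[OF P] by simp
  define \<beta> where "\<beta> t \<xi> = (if (norm \<xi>)\<^sup>2 \<le> t / \<sigma> then 1 else (0::complex))" for t and \<xi> :: 'a
  define overlap where "overlap p q = \<beta> (snd q) (snd p) * \<beta> (fst q - snd q) (fst p)" for p :: "'a \<times> 'a" and q :: "real \<times> real"
  define V where "V q = w (fst q) * (if 0 \<le> snd q \<and> snd q \<le> fst q then 1 else 0)" for q :: "real \<times> real"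
  have V_meas: "V \<in> borel_measurable (lborel \<Otimes>\<^sub>M lborel)"
    unfolding V_def by measurable
  have V: "integrable lborel V"
  proof -
    have "integrable (lborel \<Otimes>\<^sub>M lborel) V"
    proof (rule lborel_pair.Fubini_integrable[OF V_meas])
      have V_eq: "V (u, t) = w u * complex_of_real (indicator {0..u} t)" for u t
        by (simp add: V_def split: split_indicator)
      have "(LINT t|lborel. norm (V (u, t))) = norm (u *\<^sub>R w u)" for u
        using w_neg[of u] unfolding V_eq by (cases "u \<ge> 0") (simp_all add: norm_mult)
      then show "integrable lborel (\<lambda>u. LINT t|lborel. norm (V (u, t)))"
        using integrable_norm[OF w_int] by simp
      have "integrable lborel (\<lambda>t. V (u, t))" for u
        unfolding V_eq
        by (intro integrable_mult_right) (simp add: complex_of_real_integrable_eq integrable_indicator_iff emeasure_lborel_Icc_eq)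
      then show "AE u in lborel. integrable lborel (\<lambda>t. V (u, t))" by simp
    qed
    then show ?thesis by (simp add: lborel_prod)
  qed
  define \<Phi> where "\<Phi> p q = P p * (w (fst q) * overlap p q)" for p q
  have overlap_supp: "norm (w (fst q) * overlap p q) \<le> norm (V q)" for p q
  proof (cases "0 \<le> snd q \<and> snd q \<le> fst q")
    case True
    then show ?thesis by (simp add: V_def overlap_def \<beta>_def norm_mult)
  next
    case False
    have "overlap p q = 0"
    proof (cases "snd q < 0")
      case True
      then have "snd q / \<sigma> < 0" using \<sigma> by (simp add: divide_neg_pos)
      then have "\<not> (norm (snd p))\<^sup>2 \<le> snd q / \<sigma>" by (smt (verit) zero_le_power2)
      then show ?thesis by (simp add: overlap_def \<beta>_def)
    next
      case False
      with \<open>\<not> (0 \<le> snd q \<and> snd q \<le> fst q)\<close> have "(fst q - snd q) / \<sigma> < 0" using \<sigma> by (simp add: divide_neg_pos)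
      then have "\<not> (norm (fst p))\<^sup>2 \<le> (fst q - snd q) / \<sigma>" by (smt (verit) zero_le_power2)
      then show ?thesis by (simp add: overlap_def \<beta>_def)
    qed
    then show ?thesis by simp
  qed
  have meas: "(\<lambda>(p, q). \<Phi> p q) \<in> borel_measurable (lborel \<Otimes>\<^sub>M lborel)"
  proof -
    have [measurable]: "(\<lambda>p::'a \<times> 'a. fst p) \<in> borel_measurable borel" "(\<lambda>p::'a \<times> 'a. snd p) \<in> borel_measurable borel"
      "(\<lambda>p::real \<times> real. fst p) \<in> borel_measurable borel" "(\<lambda>p::real \<times> real. snd p) \<in> borel_measurable borel"
      by (intro borel_measurable_continuous_onI continuous_intros)+
    show ?thesis
      unfolding \<Phi>_def overlap_def \<beta>_def by measurable
  qed
  have int: "integrable (lborel \<Otimes>\<^sub>M lborel) (\<lambda>(p, q). \<Phi> p q)"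
  proof (rule Bochner_Integration.integrable_bound)
    show "integrable (lborel \<Otimes>\<^sub>M lborel) (\<lambda>z. P (fst z) * V (snd z))"
      unfolding lborel_prod by (rule integrable_lborel_tensor[OF P V])
    show "AE z in lborel \<Otimes>\<^sub>M lborel. norm (case z of (p, q) \<Rightarrow> \<Phi> p q) \<le> norm (P (fst z) * V (snd z))"
      using overlap_supp by (intro AE_I2) (auto simp: \<Phi>_def norm_mult intro!: mult_left_mono)
  qed (rule meas)
  have inner_q: "(LINT q|lborel. \<Phi> p q) = h p" for p
  proof -
    have i: "integrable (lborel \<Otimes>\<^sub>M lborel) (\<lambda>(u, t). w u * overlap p (u, t))"
    proof (rule Bochner_Integration.integrable_bound)
      show "integrable (lborel \<Otimes>\<^sub>M lborel) V" using V by (simp add: lborel_prod)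
      show "(\<lambda>(u, t). w u * overlap p (u, t)) \<in> borel_measurable (lborel \<Otimes>\<^sub>M lborel)"
        unfolding overlap_def \<beta>_def by measurable
      show "AE q in lborel \<Otimes>\<^sub>M lborel. norm (case q of (u, t) \<Rightarrow> w u * overlap p (u, t)) \<le> norm (V q)"
        using overlap_supp[of _ p] by (intro AE_I2) auto
    qed
    have "(LINT q|lborel. w (fst q) * overlap p q) = integral\<^sup>L (lborel \<Otimes>\<^sub>M lborel) (\<lambda>(u, t). w u * overlap p (u, t))"
      by (simp add: lborel_prod case_prod_unfold)
    also have "\<dots> = (LINT u|lborel. LINT t|lborel. w u * overlap p (u, t))"
      by (rule lborel_pair.integral_fst[OF i, symmetric])
    also have "\<dots> = (LINT u|lborel. max 0 (u - \<sigma> * ((norm (snd p))\<^sup>2 + (norm (fst p))\<^sup>2)) *\<^sub>R w u)"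
      unfolding overlap_def \<beta>_def fst_conv snd_conv integral_mult_right_zero overlap_length[OF \<sigma>]
      by (simp add: scaleR_conv_of_real mult.commute)
    also have "\<dots> = m0 (\<sigma> * ((norm (snd p))\<^sup>2 + (norm (fst p))\<^sup>2))"
      using \<sigma> by (intro rep[symmetric]) simp
    finally show ?thesis unfolding \<Phi>_def integral_mult_right_zero by (simp add: h_def P_def)
  qed
  show "integrable lborel h"
    using lborel_pair.integrable_fst[OF int] by (simp add: inner_q)
  have inner_p: "(LINT p|lborel. \<Phi> p q)
      = w (fst q) * ball_mult (snd q / \<sigma>) F x * ball_mult ((fst q - snd q) / \<sigma>) G x" for q
  proof -
    have cut: "integrable lborel (\<lambda>\<xi>. \<beta> t \<xi> * E \<xi> * wave x \<xi>)" if "integrable lborel E" for E t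
    proof (rule Bochner_Integration.integrable_bound[OF that])
      have [measurable]: "E \<in> borel_measurable borel" using borel_measurable_integrable[OF that] by simp
      show "(\<lambda>\<xi>. \<beta> t \<xi> * E \<xi> * wave x \<xi>) \<in> borel_measurable lborel" unfolding \<beta>_def by measurable
    qed (auto simp: \<beta>_def norm_mult)
    have "\<Phi> p q = w (fst q) * ((\<beta> (fst q - snd q) (fst p) * G (fst p) * wave x (fst p))
        * (\<beta> (snd q) (snd p) * F (snd p) * wave x (snd p)))" for p
      by (simp add: \<Phi>_def P_def overlap_def mult_ac)
    then have "(LINT p|lborel. \<Phi> p q) = w (fst q) * ((LINT \<eta>|lborel. \<beta> (fst q - snd q) \<eta> * G \<eta> * wave x \<eta>)
        * (LINT \<xi>|lborel. \<beta> (snd q) \<xi> * F \<xi> * wave x \<xi>))"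
      using integral_lborel_tensor[OF cut[OF G] cut[OF F]] by simp
    then show ?thesis by (simp add: ball_mult_def ft_def \<beta>_def mult_ac)
  qed
  have "(LINT p|lborel. h p) = (LINT p|lborel. LINT q|lborel. \<Phi> p q)" by (simp only: inner_q)
  also have "\<dots> = (LINT q|lborel. LINT p|lborel. \<Phi> p q)"
    by (rule lborel_pair.Fubini_integral[OF int, symmetric])
  finally show "(LINT p|lborel. h p)
      = (LINT q|lborel. w (fst q) * ball_mult (snd q / \<sigma>) F x * ball_mult ((fst q - snd q) / \<sigma>) G x)"
    by (simp only: inner_p)
qed

lemma ball_mult_neg: "t < 0 \<Longrightarrow> ball_mult t F x = 0"
proof -
  assume "t < 0"
  then have "\<not> (norm \<xi>)\<^sup>2 \<le> t" for \<xi> :: 'a by (smt (verit) zero_le_power2)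
  then show ?thesis by (simp add: ball_mult_def ft_def)
qed

text \<open>For each \<open>u\<close> the inner integral in \<open>t\<close> is at most \<open>u / 2\<close> times the weighted sum of the two control
  functions, whatever the dilation \<open>\<sigma>\<close>; this is where the supremum over dilations is absorbed.\<close>

lemma superposition_bound:
  fixes f g :: "'a::euclidean_space \<Rightarrow> complex" and x :: 'a
  assumes f: "integrable lborel f" and g: "integrable lborel g"
    and w [measurable]: "w \<in> borel_measurable borel"
    and w_neg: "\<And>u. u < 0 \<Longrightarrow> w u = 0"
    and \<sigma>: "\<sigma> > 0" and r: "r > 0"
  defines "F \<equiv> \<lambda>\<xi>. ft f (- \<xi>)" and "G \<equiv> \<lambda>\<xi>. ft g (- \<xi>)"
  shows "2 * ennreal (norm (LINT q|lborel. w (fst q) * ball_mult (snd q / \<sigma>) F x * ball_mult ((fst q - snd q) / \<sigma>) G x))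
    \<le> (\<integral>\<^sup>+u. ennreal (norm (u *\<^sub>R w u)) \<partial>lborel) * (ennreal r * control f x + ennreal (1 / r) * control g x)"
proof -
  have [measurable]: "f \<in> borel_measurable borel" "g \<in> borel_measurable borel"
    using borel_measurable_integrable[OF f] borel_measurable_integrable[OF g] by simp_all
  have [measurable]: "F \<in> borel_measurable borel" "G \<in> borel_measurable borel"
    unfolding F_def G_def by measurable
  let ?R = "ennreal r * control f x + ennreal (1 / r) * control g x"
  let ?A = "\<lambda>t. ennreal (norm (ball_mult (t / \<sigma>) F x))" and ?B = "\<lambda>t. ennreal (norm (ball_mult (t / \<sigma>) G x))"
  have slice: "2 * (\<integral>\<^sup>+t. ?A t * ?B (u - t) \<partial>lborel) \<le> ennreal u * ?R" if u: "u \<ge> 0" for u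
  proof -
    have "2 * (\<integral>\<^sup>+t. ?A t * ?B (u - t) \<partial>lborel) = (\<integral>\<^sup>+t. 2 * (?A t * ?B (u - t)) \<partial>lborel)"
      by (subst nn_integral_cmult) auto
    also have "\<dots> \<le> (\<integral>\<^sup>+t. ennreal r * ((?A t)\<^sup>2 * indicator {0<..<u} t) + ennreal (1 / r) * ((?B (u - t))\<^sup>2 * indicator {0<..<u} (u - t)) \<partial>lborel)"
    proof (rule nn_integral_mono_AE)
      show "AE t in lborel. 2 * (?A t * ?B (u - t))
          \<le> ennreal r * ((?A t)\<^sup>2 * indicator {0<..<u} t) + ennreal (1 / r) * ((?B (u - t))\<^sup>2 * indicator {0<..<u} (u - t))"
        using AE_lborel_singleton[of 0] AE_lborel_singleton[of u]
      proof eventually_elim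
        case (elim t)
        show ?case
        proof (cases "0 < t \<and> t < u")
          case True
          then show ?thesis using ennreal_AM_GM[OF r, of "?A t" "?B (u - t)"] by simp
        next
          case False
          then have "t / \<sigma> < 0 \<or> (u - t) / \<sigma> < 0" using elim \<sigma> by (auto simp: divide_neg_pos)
          then have "?A t * ?B (u - t) = 0" by (auto simp: ball_mult_neg)
          then show ?thesis by (simp only: mult_zero_right zero_le)
        qed
      qed
    qed
    also have "\<dots> = ennreal r * (\<integral>\<^sup>+t. (?A t)\<^sup>2 * indicator {0<..<u} t \<partial>lborel)
        + ennreal (1 / r) * (\<integral>\<^sup>+t. (?B (u - t))\<^sup>2 * indicator {0<..<u} (u - t) \<partial>lborel)"
      by (simp add: nn_integral_add nn_integral_cmult)
    also have "(\<integral>\<^sup>+t. (?B (u - t))\<^sup>2 * indicator {0<..<u} (u - t) \<partial>lborel) = (\<integral>\<^sup>+t. (?B t)\<^sup>2 * indicator {0<..<u} t \<partial>lborel)"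
      by (rule nn_integral_lborel_reflect) measurable
    also have "ennreal r * (\<integral>\<^sup>+t. (?A t)\<^sup>2 * indicator {0<..<u} t \<partial>lborel)
        + ennreal (1 / r) * (\<integral>\<^sup>+t. (?B t)\<^sup>2 * indicator {0<..<u} t \<partial>lborel)
        \<le> ennreal r * (ennreal u * control f x) + ennreal (1 / r) * (ennreal u * control g x)"
      using ball_mult_mean_square_le[OF f \<sigma> u, of x] ball_mult_mean_square_le[OF g \<sigma> u, of x]
      by (intro add_mono mult_left_mono) (auto simp: ennreal_power F_def G_def)
    also have "\<dots> = ennreal u * ?R" by (simp add: distrib_left mult_ac)
    finally show ?thesis .
  qed
  let ?\<Psi> = "\<lambda>q. w (fst q) * ball_mult (snd q / \<sigma>) F x * ball_mult ((fst q - snd q) / \<sigma>) G x"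
  have "ennreal (norm (LINT q|lborel. ?\<Psi> q)) \<le> (\<integral>\<^sup>+q. ennreal (norm (?\<Psi> q)) \<partial>lborel)"
    by (cases "integrable lborel ?\<Psi>") (auto intro: integral_norm_bound_ennreal simp: not_integrable_integral_eq)
  also have "\<dots> = (\<integral>\<^sup>+q. ennreal (norm (?\<Psi> q)) \<partial>(lborel \<Otimes>\<^sub>M lborel))"
    by (simp add: lborel_prod)
  also have "\<dots> = (\<integral>\<^sup>+u. \<integral>\<^sup>+t. ennreal (norm (?\<Psi> (u, t))) \<partial>lborel \<partial>lborel)"
    by (rule lborel.nn_integral_fst[symmetric]) measurable
  also have "\<dots> = (\<integral>\<^sup>+u. ennreal (norm (w u)) * (\<integral>\<^sup>+t. ?A t * ?B (u - t) \<partial>lborel) \<partial>lborel)"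
    by (simp add: norm_mult ennreal_mult nn_integral_cmult mult.assoc)
  finally have "2 * ennreal (norm (LINT q|lborel. ?\<Psi> q))
      \<le> 2 * (\<integral>\<^sup>+u. ennreal (norm (w u)) * (\<integral>\<^sup>+t. ?A t * ?B (u - t) \<partial>lborel) \<partial>lborel)"
    by (rule mult_left_mono) simp
  also have "\<dots> = (\<integral>\<^sup>+u. ennreal (norm (w u)) * (2 * (\<integral>\<^sup>+t. ?A t * ?B (u - t) \<partial>lborel)) \<partial>lborel)"
    by (subst nn_integral_cmult[symmetric]) (auto simp: mult_ac)
  also have "\<dots> \<le> (\<integral>\<^sup>+u. ennreal (norm (w u)) * (ennreal \<bar>u\<bar> * ?R) \<partial>lborel)"
  proof (rule nn_integral_mono)
    fix u :: real
    show "ennreal (norm (w u)) * (2 * (\<integral>\<^sup>+t. ?A t * ?B (u - t) \<partial>lborel)) \<le> ennreal (norm (w u)) * (ennreal \<bar>u\<bar> * ?R)"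
      using slice[of u] w_neg[of u] by (cases "u \<ge> 0") (auto intro: mult_left_mono)
  qed
  also have "\<dots> = (\<integral>\<^sup>+u. ennreal (norm (u *\<^sub>R w u)) * ?R \<partial>lborel)"
    by (simp add: ennreal_mult mult_ac)
  also have "\<dots> = (\<integral>\<^sup>+u. ennreal (norm (u *\<^sub>R w u)) \<partial>lborel) * ?R"
    by (rule nn_integral_multc) measurable
  finally show ?thesis .
qed

section \<open>Boundedness of the maximal operator\<close>

lemma continuous_integral_wave:
  fixes h :: "'b::euclidean_space \<Rightarrow> complex" and v :: "'b \<Rightarrow> 'a::euclidean_space"
  assumes h: "integrable lborel h" and [measurable]: "v \<in> borel_measurable borel"
  shows "continuous_on UNIV (\<lambda>x. LINT p|lborel. h p * wave x (v p))"
  unfolding continuous_on_sequentially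
proof (intro allI ballI impI, elim conjE)
  have [measurable]: "h \<in> borel_measurable borel" using borel_measurable_integrable[OF h] by simp
  fix y :: "nat \<Rightarrow> 'a" and x
  assume y: "y \<longlonglongrightarrow> x"
  show "((\<lambda>x. LINT p|lborel. h p * wave x (v p)) \<circ> y) \<longlonglongrightarrow> (LINT p|lborel. h p * wave x (v p))"
    unfolding o_def
  proof (rule integral_dominated_convergence[where w="\<lambda>p. norm (h p)"])
    show "AE p in lborel. (\<lambda>n. h p * wave (y n) (v p)) \<longlonglongrightarrow> h p * wave x (v p)"
    proof (intro AE_I2 tendsto_mult tendsto_const)
      fix p
      have "isCont (\<lambda>x. wave x (v p)) x"
        using continuous_wave[of "v p"] by (simp add: continuous_on_eq_continuous_at)
      then show "(\<lambda>n. wave (y n) (v p)) \<longlonglongrightarrow> wave x (v p)"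
        using y by (rule isCont_tendsto_compose)
    qed
  qed (use h in \<open>auto simp: norm_mult\<close>)
qed

text \<open>An uncountable supremum of continuous functions is lower semicontinuous.\<close>

lemma borel_measurable_SUP_continuous:
  fixes \<phi> :: "'i \<Rightarrow> 'a::topological_space \<Rightarrow> real"
  assumes "\<And>s. s \<in> S \<Longrightarrow> continuous_on UNIV (\<phi> s)"
  shows "(\<lambda>x. SUP s\<in>S. ennreal (\<phi> s x)) \<in> borel_measurable borel"
proof (rule borel_measurableI_greater)
  fix y :: ennreal
  have "open {x. y < ennreal (\<phi> s x)}" if "s \<in> S" for s
    by (rule open_Collect_less[OF continuous_on_const])
      (use assms[OF that] in \<open>auto intro!: continuous_on_ennreal\<close>)
  then have "open (\<Union>s\<in>S. {x. y < ennreal (\<phi> s x)})" by blast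
  moreover have "{x \<in> space borel. y < (SUP s\<in>S. ennreal (\<phi> s x))} = (\<Union>s\<in>S. {x. y < ennreal (\<phi> s x)})"
    by (auto simp: less_SUP_iff)
  ultimately show "{x \<in> space borel. y < (SUP s\<in>S. ennreal (\<phi> s x))} \<in> sets borel" by simp
qed

text \<open>The optimal \<open>r = b/a\<close> is unavailable when \<open>a\<close> or \<open>b\<close> vanishes, so both are first enlarged by \<open>d > 0\<close>.\<close>

lemma ennreal_le_product_if_AM_GM:
  fixes X :: ennreal
  assumes K: "K \<ge> 0" and a: "a \<ge> 0" and b: "b \<ge> 0"
    and le: "\<And>r. r > 0 \<Longrightarrow> 2 * X \<le> ennreal (K * (r * a\<^sup>2 + 1 / r * b\<^sup>2))"
  shows "X \<le> ennreal (K * a * b)"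
proof -
  have bound: "X \<le> ennreal (K * (a + d) * (b + d))" if d: "d > 0" for d
  proof -
    let ?r = "(b + d) / (a + d)"
    have ab: "a + d > 0" "b + d > 0" using a b d by auto
    then have r: "?r > 0" by simp
    have "?r * a\<^sup>2 \<le> ?r * (a + d)\<^sup>2" using a d ab by (intro mult_left_mono power_mono) auto
    moreover have "1 / ?r * b\<^sup>2 \<le> 1 / ?r * (b + d)\<^sup>2" using b d ab by (intro mult_left_mono power_mono) auto
    ultimately have "?r * a\<^sup>2 + 1 / ?r * b\<^sup>2 \<le> 2 * ((a + d) * (b + d))"
      using ab by (simp add: power2_eq_square mult.commute)
    then have "K * (?r * a\<^sup>2 + 1 / ?r * b\<^sup>2) \<le> K * (2 * ((a + d) * (b + d)))"
      using K by (rule mult_left_mono)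
    then have "2 * X \<le> ennreal (2 * (K * (a + d) * (b + d)))"
      using le[OF r] by (elim order_trans) (auto intro!: ennreal_leI simp: mult_ac)
    also have "\<dots> = 2 * ennreal (K * (a + d) * (b + d))"
      using K ab by (simp add: ennreal_mult')
    finally show ?thesis by (subst (asm) ennreal_mult_le_mult_iff) auto
  qed
  have "(\<lambda>n. K * (a + 1 / real (Suc n)) * (b + 1 / real (Suc n))) \<longlonglongrightarrow> K * (a + 0) * (b + 0)"
    by (intro tendsto_intros LIMSEQ_Suc[OF lim_1_over_n])
  then have "(\<lambda>n. ennreal (K * (a + 1 / real (Suc n)) * (b + 1 / real (Suc n)))) \<longlonglongrightarrow> ennreal (K * a * b)"
    by (intro tendsto_ennrealI) simp
  then show ?thesis
    by (rule LIMSEQ_le_const) (intro exI[of _ 0] allI impI bound, simp)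
qed

theorem theorem2p10:
  fixes m0 :: "real \<Rightarrow> complex" and \<epsilon> :: real
    and m :: "(real ^ 'n) \<times> (real ^ 'n) \<Rightarrow> complex"
  assumes smooth: "smooth_halfline m0"
    and eps: "\<epsilon> > 0"
    and decay: "\<And>k. k \<in> {0, 1, 2} \<Longrightarrow>
      (\<lambda>t. norm (nth_deriv_halfline k m0 t)) \<in> O[at_top](\<lambda>t. t powr (- real k - \<epsilon>))"
    and m_def: "\<And>\<xi> \<eta>. m (\<xi>, \<eta>) = m0 ((norm (\<xi>, \<eta>))\<^sup>2)"
  shows "maximal_bounded_L2_L2_L1 m"
proof -
  obtain w :: "real \<Rightarrow> complex" where w [measurable]: "w \<in> borel_measurable borel"
    and w_neg: "\<And>u. u < 0 \<Longrightarrow> w u = 0" and w_int: "integrable lborel (\<lambda>u. u *\<^sub>R w u)"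
    and rep: "\<And>c. c \<ge> 0 \<Longrightarrow> m0 c = (LINT u|lborel. max 0 (u - c) *\<^sub>R w u)"
    using halfline_taylor_representation[OF smooth eps decay] by blast
  define W where "W = (LINT u|lborel. norm (u *\<^sub>R w u))"
  have W: "(\<integral>\<^sup>+u. ennreal (norm (u *\<^sub>R w u)) \<partial>lborel) = ennreal W"
    unfolding W_def by (intro nn_integral_eq_integral integrable_norm w_int) simp
  have W0: "W \<ge> 0" unfolding W_def by (intro Bochner_Integration.integral_nonneg) simp
  define \<kappa> where "\<kappa> = control_const DIM(real ^ 'n)"
  have \<kappa>0: "\<kappa> \<ge> 0" by (simp add: \<kappa>_def control_const_def)
  show ?thesis
    unfolding maximal_bounded_L2_L2_L1_def
  proof (intro exI[of _ "W * \<kappa>"] conjI allI impI)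
    show "0 \<le> W * \<kappa>" using W0 \<kappa>0 by simp
    fix f g :: "real ^ 'n \<Rightarrow> complex"
    assume f: "schwartz f" and g: "schwartz g"
    note fi = schwartz_integrable[OF f] and gi = schwartz_integrable[OF g]
    have [measurable]: "f \<in> borel_measurable borel" "g \<in> borel_measurable borel"
      using schwartz_measurable f g by auto
    have Fi: "integrable lborel (\<lambda>\<xi>. ft f (- \<xi>))" and Gi: "integrable lborel (\<lambda>\<xi>. ft g (- \<xi>))"
      using integrable_fourier[OF f] integrable_fourier[OF g] by (simp_all add: fourier_eq_ft[abs_def])
    define h where "h s x p = m0 (s\<^sup>2 * ((norm (snd p))\<^sup>2 + (norm (fst p))\<^sup>2))
        * (ft g (- fst p) * wave x (fst p) * (ft f (- snd p) * wave x (snd p)))" for s x and p :: "(real ^ 'n) \<times> (real ^ 'n)"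
    have h_int: "integrable lborel (h s x)" if "s > 0" for s x
      unfolding h_def using that by (intro bilinear_superposition(1)[OF Fi Gi w w_neg w_int rep]) auto
    have T_eq: "bilinear_mult m s f g x = (LINT p|lborel. h s x p)" if s: "s > 0" for s x
    proof -
      have "m (s *\<^sub>R \<xi>, s *\<^sub>R \<eta>) * fourier f \<xi> * fourier g \<eta> * exp (2 * pi * \<i> * complex_of_real (x \<bullet> (\<xi> + \<eta>)))
          = h s x (\<eta>, \<xi>)" for \<xi> \<eta>
      proof -
        have 1: "exp (2 * pi * \<i> * complex_of_real (x \<bullet> (\<xi> + \<eta>))) = wave x \<xi> * wave x \<eta>"
          unfolding wave_add[symmetric] by (simp add: wave_def cis_conv_exp mult_ac)
        have 2: "(norm (s *\<^sub>R \<xi>, s *\<^sub>R \<eta>))\<^sup>2 = s\<^sup>2 * ((norm \<xi>)\<^sup>2 + (norm \<eta>)\<^sup>2)"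
          by (simp add: norm_Pair power_mult_distrib distrib_left)
        show ?thesis unfolding m_def 1 2 fourier_eq_ft h_def by (simp add: mult_ac)
      qed
      then have "bilinear_mult m s f g x = (LINT \<eta>|lborel. LINT \<xi>|lborel. h s x (\<eta>, \<xi>))"
        unfolding bilinear_mult_def by simp
      also have "\<dots> = integral\<^sup>L (lborel \<Otimes>\<^sub>M lborel) (h s x)"
        using lborel_pair.integral_fst'[of "h s x"] h_int[OF s, of x] by (simp add: lborel_prod)
      finally show ?thesis by (simp add: lborel_prod)
    qed
    have cont: "continuous_on UNIV (\<lambda>x. norm (bilinear_mult m s f g x))" if s: "s > 0" for s
    proof -
      have heq: "h s x p = h s 0 p * wave x (fst p + snd p)" for x p
        by (simp only: h_def wave_add wave_zero_left mult_1_right mult_1_left mult_ac)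
      have "bilinear_mult m s f g = (\<lambda>x. LINT p|lborel. h s 0 p * wave x (fst p + snd p))"
        by (intro ext trans[OF T_eq[OF s]] Bochner_Integration.integral_cong refl heq)
      moreover have "continuous_on UNIV (\<lambda>x. LINT p|lborel. h s 0 p * wave x (fst p + snd p))"
        by (intro continuous_integral_wave h_int s borel_measurable_continuous_onI continuous_intros)
      ultimately show ?thesis by (simp add: continuous_on_norm)
    qed
    have max_meas: "maximal_bilinear_mult m f g \<in> borel_measurable borel"
      unfolding maximal_bilinear_mult_def[abs_def]
      by (rule borel_measurable_SUP_continuous) (auto intro: cont)
    then show "maximal_bilinear_mult m f g \<in> borel_measurable lborel" by simp
    have pointwise: "2 * maximal_bilinear_mult m f g x
        \<le> ennreal W * (ennreal r * control f x + ennreal (1 / r) * control g x)" if r: "r > 0" for x r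
    proof -
      have "2 * ennreal (norm (bilinear_mult m s f g x))
          \<le> ennreal W * (ennreal r * control f x + ennreal (1 / r) * control g x)" if s: "s > 0" for s
      proof -
        have "s\<^sup>2 > 0" using s by simp
        then have eq: "bilinear_mult m s f g x = (LINT q|lborel. w (fst q) * ball_mult (snd q / s\<^sup>2) (\<lambda>\<xi>. ft f (- \<xi>)) x
            * ball_mult ((fst q - snd q) / s\<^sup>2) (\<lambda>\<xi>. ft g (- \<xi>)) x)"
          unfolding T_eq[OF s] h_def
          by (intro bilinear_superposition(2)[OF Fi Gi w w_neg w_int rep])
        show ?thesis unfolding eq W[symmetric]
          using s r by (intro superposition_bound[OF fi gi w w_neg]) auto
      qed
      then show ?thesis
        unfolding maximal_bilinear_mult_def SUP_mult_left_ennreal by (intro SUP_least) simp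
    qed
    have L2: "(\<integral>\<^sup>+x. ennreal ((norm (k x))\<^sup>2) \<partial>lborel) = ennreal ((L2_norm_fun k)\<^sup>2)" if "schwartz k" for k :: "real ^ 'n \<Rightarrow> complex"
    proof -
      have "(\<integral>\<^sup>+x. ennreal ((norm (k x))\<^sup>2) \<partial>lborel) = ennreal (LINT x|lborel. (norm (k x))\<^sup>2)"
        by (intro nn_integral_eq_integral schwartz_square_integrable that) simp
      then show ?thesis by (simp add: L2_norm_fun_def Bochner_Integration.integral_nonneg)
    qed
    have "(\<integral>\<^sup>+x. maximal_bilinear_mult m f g x \<partial>lborel) \<le> ennreal (W * \<kappa> * L2_norm_fun f * L2_norm_fun g)"
    proof (rule ennreal_le_product_if_AM_GM)
      show "0 \<le> W * \<kappa>" using W0 \<kappa>0 by simp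
      show "0 \<le> L2_norm_fun f" "0 \<le> L2_norm_fun g" by (simp_all add: L2_norm_fun_def Bochner_Integration.integral_nonneg)
      fix r :: real assume r: "r > 0"
      let ?a = "(L2_norm_fun f)\<^sup>2" and ?b = "(L2_norm_fun g)\<^sup>2"
      have "2 * (\<integral>\<^sup>+x. maximal_bilinear_mult m f g x \<partial>lborel) = (\<integral>\<^sup>+x. 2 * maximal_bilinear_mult m f g x \<partial>lborel)"
        using max_meas by (intro nn_integral_cmult[symmetric]) simp
      also have "\<dots> \<le> (\<integral>\<^sup>+x. ennreal W * (ennreal r * control f x + ennreal (1 / r) * control g x) \<partial>lborel)"
        by (intro nn_integral_mono pointwise r)
      also have "\<dots> = ennreal W * (ennreal r * (\<integral>\<^sup>+x. control f x \<partial>lborel) + ennreal (1 / r) * (\<integral>\<^sup>+x. control g x \<partial>lborel))"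
        by (simp add: nn_integral_cmult nn_integral_add)
      also have "\<dots> \<le> ennreal W * (ennreal r * (ennreal \<kappa> * ennreal ?a) + ennreal (1 / r) * (ennreal \<kappa> * ennreal ?b))"
        using control_L1[OF fi Fi] control_L1[OF gi Gi]
        by (intro mult_left_mono add_mono) (simp_all add: L2 f g \<kappa>_def)
      also have "\<dots> = ennreal (W * (r * (\<kappa> * ?a) + 1 / r * (\<kappa> * ?b)))"
        using W0 \<kappa>0 r
        by (simp only: ennreal_mult ennreal_plus mult_nonneg_nonneg add_nonneg_nonneg zero_le_power2 less_imp_le zero_less_divide_1_iff)
      also have "W * (r * (\<kappa> * ?a) + 1 / r * (\<kappa> * ?b)) = W * \<kappa> * (r * ?a + 1 / r * ?b)"
        by (simp add: algebra_simps)
      finally show "2 * (\<integral>\<^sup>+x. maximal_bilinear_mult m f g x \<partial>lborel) \<le> ennreal (W * \<kappa> * (r * ?a + 1 / r * ?b))" .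
    qed
    then show "(\<integral>\<^sup>+x. maximal_bilinear_mult m f g x \<partial>lborel) \<le> ennreal (W * \<kappa> * L2_norm_fun f * L2_norm_fun g)" .
  qed
qed

end
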